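(* Let $1\le k\le n-1$, let $\lambda\in\mathbb{R}^n$ with $\lambda_1=\cdots=\lambda_k>\lambda_{k+1}=\cdots=\lambda_n$, and let $N\in\mathfrak{u}_n$. Then the gradient flow on $\mathcal{O}_\lambda$ with respect to $N$ in the Kähler metric (equivalently, in the normal or induced metrics) weakly preserves positivity if and only if the following condition holds, depending on the value of $k$: (i) $k=1$: $\mathrm{i}N_{i,j}\ge0$ for all $i\ne j$ in $\{1,\dots,n\}$; (ii) $k=n-1$: $(-1)^{i+j-1}\mathrm{i}N_{i,j}\ge0$ for all $i\neq j$ in $\{1,\dots,n\}$; (iii) $2\le k\le n-2$: $\mathrm{i}N_{1,2},\ \mathrm{i}N_{2,3},\dots,\mathrm{i}N_{n-1,n},\ (-1)^{k-1}\mathrm{i}N_{n,1}\ge0$, and $N_{i,j}=0$ for all $i,j\in\{1,\dots,n\}$ with $i-j\not\equiv-1,0,1\pmod n$. Moreover, let $\Gamma$ be the undirected graph on the vertex set $\{1,\dots,n\}$ in which $\{i,j\}$ ($i\neq j$) is an edge if and only if $N_{i,j}\ne0$. Then the gradient flow strictly preserves positivity if and only if, additionally, $\Gamma$ is connected. (For $2\le k\le n-2$, this means that at least $n-1$ of the $n$ inequalities in (iii) hold strictly.)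
   Context: Here $\mathrm{i}=\sqrt{-1}$ when it appears as a scalar (subscripts $i,j$ are indices); an inequality such as $\mathrm{i}N_{i,j}\ge0$ includes the assertion that the number is real. $\mathrm{U}_n$ is the unitary group and $\mathfrak{u}_n$ the Lie algebra of skew-Hermitian $n\times n$ matrices. $\mathcal{O}_\lambda=\{g(\mathrm{i}\,\mathrm{Diag}(\lambda))g^{-1}:g\in\mathrm{U}_n\}$. $\mathrm{U}_n^{>0}$ (resp. $\mathrm{U}_n^{\ge 0}$) is the set of $g\in\mathrm{U}_n$ all of whose left-justified minors (row set $I$, column set $\{1,\dots,|I|\}$) are positive (resp. nonnegative) real numbers; $\mathcal{O}_\lambda^{>0}=\{g(\mathrm{i}\,\mathrm{Diag}(\lambda))g^{-1}:g\in\mathrm{U}_n^{>0}\}$, and $\mathcal{O}_\lambda^{\ge 0}$ is its closure, equal to $\{g(\mathrm{i}\,\mathrm{Diag}(\lambda))g^{-1}:g\in\mathrm{U}_n^{\ge 0}\}$. Let $\kappa(L,M)=2n\,\mathrm{tr}(LM)-2\,\mathrm{tr}(L)\mathrm{tr}(M)$ and $\mathrm{ad}_L(X)=[L,X]=LX-XL$. The tangent space of $\mathcal{O}_\lambda$ at $L$ is $\{[L,X]:X\in\mathfrak{u}_n\}$. For $X\in\mathfrak{u}_n$ write $X=X^L+X_L$ with $X^L\in\mathrm{im}(\mathrm{ad}_L)$, $X_L\in\ker(\mathrm{ad}_L)$ (uniquely). The metrics on $\mathcal{O}_\lambda$ are: normal, $\langle[L,X],[L,Y]\rangle_{\mathrm{normal}}=-\kappa(X^L,Y^L)$;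 induced, $\langle[L,X],[L,Y]\rangle_{\mathrm{induced}}=-\kappa([L,X],[L,Y])$; Kähler, $\langle[L,X],[L,Y]\rangle_{\mathrm{K\ddot ahler}}=\langle\sqrt{-\mathrm{ad}_L^2}\,([L,X]),[L,Y]\rangle_{\mathrm{normal}}$, with $\sqrt{-\mathrm{ad}_L^2}$ the positive square root. For the present $\lambda$ the three metrics agree up to positive constant factors. The gradient flow with respect to $N$ is $\dot L(t)=\mathrm{grad}(H)(L(t))$ with $H(M)=\kappa(M,N)$ (steepest ascent), defined for all $t\in\mathbb{R}$. A flow on $\mathcal{O}_\lambda$ weakly preserves positivity if $L(t)\in\mathcal{O}_\lambda^{\ge0}$ for all $L(0)\in\mathcal{O}_\lambda^{\ge0}$ and $t\ge0$; it strictly preserves positivity if $L(t)\in\mathcal{O}_\lambda^{>0}$ for all $L(0)\in\mathcal{O}_\lambda^{\ge 0}$ and $t>0$. *)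

theory Defs
  imports
    "Jordan_Normal_Form.Schur_Decomposition"
    "Jordan_Normal_Form.DL_Submatrix"
    "HOL-Number_Theory.Cong"
begin

(* Matrix indices run over {0..<n} instead of {1..n}. The order on complex numbers is that of
   HOL-Library.Complex_Order: 0 <= z means that z is real and nonnegative, and likewise for 0 < z. *)

definition unitary_group :: "nat \<Rightarrow> complex mat set" where
  "unitary_group n = {g \<in> carrier_mat n n. g * mat_adjoint g = 1\<^sub>m n \<and> mat_adjoint g * g = 1\<^sub>m n}"

definition skew_hermitian :: "nat \<Rightarrow> complex mat set" where
  "skew_hermitian n = {X \<in> carrier_mat n n. mat_adjoint X = - X}"

definition left_justified_minor :: "complex mat \<Rightarrow> nat set \<Rightarrow> complex" where
  "left_justified_minor g I = det (submatrix g I {0..<card I})"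

definition unitary_pos :: "nat \<Rightarrow> complex mat set" where
  "unitary_pos n = {g \<in> unitary_group n. \<forall>I \<subseteq> {0..<n}. 0 < left_justified_minor g I}"

(* For unitary g the adjoint is the inverse, so this is g (i Diag(lam)) g^{-1}.
   Only the values lam 0, ..., lam (n - 1) matter. *)
definition conj_diag :: "nat \<Rightarrow> (nat \<Rightarrow> real) \<Rightarrow> complex mat \<Rightarrow> complex mat" where
  "conj_diag n lam g = g * mat_diag n (\<lambda>i. \<i> * complex_of_real (lam i)) * mat_adjoint g"

definition adjoint_orbit :: "nat \<Rightarrow> (nat \<Rightarrow> real) \<Rightarrow> complex mat set" where
  "adjoint_orbit n lam = conj_diag n lam ` unitary_group n"

definition orbit_pos :: "nat \<Rightarrow> (nat \<Rightarrow> real) \<Rightarrow> complex mat set" where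
  "orbit_pos n lam = conj_diag n lam ` unitary_pos n"

(* The type of matrices of arbitrary dimension carries no topology; closure, limits and
   derivatives in the space of n x n matrices are taken entrywise. *)
definition mat_closure :: "nat \<Rightarrow> complex mat set \<Rightarrow> complex mat set" where
  "mat_closure n S = {A \<in> carrier_mat n n. \<exists>B. (\<forall>m::nat. B m \<in> S) \<and>
     (\<forall>i<n. \<forall>j<n. (\<lambda>m. B m $$ (i, j)) \<longlonglongrightarrow> A $$ (i, j))}"

definition has_mat_derivative ::
  "nat \<Rightarrow> (real \<Rightarrow> complex mat) \<Rightarrow> complex mat \<Rightarrow> real \<Rightarrow> bool" where
  "has_mat_derivative n L D t \<longleftrightarrow>
     (\<forall>i<n. \<forall>j<n. ((\<lambda>s. L s $$ (i, j)) has_vector_derivative D $$ (i, j)) (at t))"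

definition orbit_nonneg :: "nat \<Rightarrow> (nat \<Rightarrow> real) \<Rightarrow> complex mat set" where
  "orbit_nonneg n lam = mat_closure n (orbit_pos n lam)"

definition mat_trace :: "complex mat \<Rightarrow> complex" where
  "mat_trace A = (\<Sum>i<dim_row A. A $$ (i, i))"

definition kappa :: "nat \<Rightarrow> complex mat \<Rightarrow> complex mat \<Rightarrow> complex" where
  "kappa n L M = 2 * of_nat n * mat_trace (L * M) - 2 * mat_trace L * mat_trace M"

definition ad :: "complex mat \<Rightarrow> complex mat \<Rightarrow> complex mat" where
  "ad L X = L * X - X * L"

(* Simultaneously the image of ad L on the skew-Hermitian matrices and the tangent space at L
   of the orbit of L. *)
definition tangent_space :: "nat \<Rightarrow> complex mat \<Rightarrow> complex mat set" where
  "tangent_space n L = ad L ` skew_hermitian n"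

(* The component X^L in the decomposition X = X^L + X_L with X^L in the image and X_L in the
   kernel of ad L. *)
definition im_part :: "nat \<Rightarrow> complex mat \<Rightarrow> complex mat \<Rightarrow> complex mat" where
  "im_part n L X = (THE Z. Z \<in> tangent_space n L \<and> ad L (X - Z) = 0\<^sub>m n n)"

(* Some X with V = [L, X]; X is determined up to the kernel of ad L, so that X^L depends
   only on V. *)
definition ad_preimage :: "nat \<Rightarrow> complex mat \<Rightarrow> complex mat \<Rightarrow> complex mat" where
  "ad_preimage n L V = (SOME X. X \<in> skew_hermitian n \<and> ad L X = V)"

(* The metrics are evaluated on tangent vectors V, W at L, on which they are real-valued. *)
definition normal_metric :: "nat \<Rightarrow> complex mat \<Rightarrow> complex mat \<Rightarrow> complex mat \<Rightarrow> complex" where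
  "normal_metric n L V W =
     - kappa n (im_part n L (ad_preimage n L V)) (im_part n L (ad_preimage n L W))"

definition induced_metric :: "nat \<Rightarrow> complex mat \<Rightarrow> complex mat \<Rightarrow> complex mat \<Rightarrow> complex" where
  "induced_metric n L V W = - kappa n V W"

(* S is a positive (self-adjoint) real-linear square root of -(ad L)^2 on the image of ad L,
   with respect to the inner product -kappa. *)
definition is_positive_sqrt_neg_ad_sq ::
  "nat \<Rightarrow> complex mat \<Rightarrow> (complex mat \<Rightarrow> complex mat) \<Rightarrow> bool" where
  "is_positive_sqrt_neg_ad_sq n L S \<longleftrightarrow>
     (\<forall>V \<in> tangent_space n L. S V \<in> tangent_space n L) \<and>
     (\<forall>V \<in> tangent_space n L. \<forall>W \<in> tangent_space n L. S (V + W) = S V + S W) \<and>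
     (\<forall>c::real. \<forall>V \<in> tangent_space n L.
        S (complex_of_real c \<cdot>\<^sub>m V) = complex_of_real c \<cdot>\<^sub>m S V) \<and>
     (\<forall>V \<in> tangent_space n L. \<forall>W \<in> tangent_space n L. kappa n (S V) W = kappa n V (S W)) \<and>
     (\<forall>V \<in> tangent_space n L. 0 \<le> - kappa n (S V) V) \<and>
     (\<forall>V \<in> tangent_space n L. S (S V) = - ad L (ad L V))"

(* Unique on the tangent space; arbitrary elsewhere, hence SOME instead of THE. *)
definition sqrt_neg_ad_sq :: "nat \<Rightarrow> complex mat \<Rightarrow> complex mat \<Rightarrow> complex mat" where
  "sqrt_neg_ad_sq n L = (SOME S. is_positive_sqrt_neg_ad_sq n L S)"

definition kaehler_metric :: "nat \<Rightarrow> complex mat \<Rightarrow> complex mat \<Rightarrow> complex mat \<Rightarrow> complex" where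
  "kaehler_metric n L V W = normal_metric n L (sqrt_neg_ad_sq n L V) W"

(* V is the gradient at L, with respect to the metric g, of the restriction of H to the orbit.
   H is given on all n x n matrices, so its differential along a tangent vector W is the
   derivative along the line L + s W. *)
definition is_gradient ::
  "nat \<Rightarrow> (complex mat \<Rightarrow> complex mat \<Rightarrow> complex mat \<Rightarrow> complex) \<Rightarrow> (complex mat \<Rightarrow> complex) \<Rightarrow>
   complex mat \<Rightarrow> complex mat \<Rightarrow> bool" where
  "is_gradient n g H L V \<longleftrightarrow> V \<in> tangent_space n L \<and>
     (\<forall>W \<in> tangent_space n L.
        ((\<lambda>s. H (L + complex_of_real s \<cdot>\<^sub>m W)) has_vector_derivative g L V W) (at 0))"

definition gradient_curve ::
  "nat \<Rightarrow> (nat \<Rightarrow> real) \<Rightarrow> (complex mat \<Rightarrow> complex mat \<Rightarrow> complex mat \<Rightarrow> complex) \<Rightarrow> complex mat \<Rightarrow>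
   (real \<Rightarrow> complex mat) \<Rightarrow> bool" where
  "gradient_curve n lam g N L \<longleftrightarrow>
     (\<forall>t. L t \<in> adjoint_orbit n lam \<and>
        (\<exists>V. is_gradient n g (\<lambda>M. kappa n M N) (L t) V \<and> has_mat_derivative n L V t))"

definition weakly_preserves_positivity ::
  "nat \<Rightarrow> (nat \<Rightarrow> real) \<Rightarrow> (complex mat \<Rightarrow> complex mat \<Rightarrow> complex mat \<Rightarrow> complex) \<Rightarrow> complex mat \<Rightarrow>
   bool" where
  "weakly_preserves_positivity n lam g N \<longleftrightarrow>
     (\<forall>L. gradient_curve n lam g N L \<and> L 0 \<in> orbit_nonneg n lam \<longrightarrow>
        (\<forall>t\<ge>0. L t \<in> orbit_nonneg n lam))"

definition strictly_preserves_positivity ::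
  "nat \<Rightarrow> (nat \<Rightarrow> real) \<Rightarrow> (complex mat \<Rightarrow> complex mat \<Rightarrow> complex mat \<Rightarrow> complex) \<Rightarrow> complex mat \<Rightarrow>
   bool" where
  "strictly_preserves_positivity n lam g N \<longleftrightarrow>
     (\<forall>L. gradient_curve n lam g N L \<and> L 0 \<in> orbit_nonneg n lam \<longrightarrow>
        (\<forall>t>0. L t \<in> orbit_pos n lam))"

(* Shifting both indices by one changes i + j - 1 into i + j + 1 and leaves i - j unchanged. *)
definition positivity_condition :: "nat \<Rightarrow> nat \<Rightarrow> complex mat \<Rightarrow> bool" where
  "positivity_condition n k N \<longleftrightarrow>
     (k = 1 \<longrightarrow> (\<forall>i<n. \<forall>j<n. i \<noteq> j \<longrightarrow> 0 \<le> \<i> * N $$ (i, j))) \<and>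
     (k = n - 1 \<longrightarrow> (\<forall>i<n. \<forall>j<n. i \<noteq> j \<longrightarrow> 0 \<le> (-1) ^ (i + j + 1) * \<i> * N $$ (i, j))) \<and>
     (2 \<le> k \<and> k \<le> n - 2 \<longrightarrow>
        (\<forall>i. i + 1 < n \<longrightarrow> 0 \<le> \<i> * N $$ (i, i + 1)) \<and>
        0 \<le> (-1) ^ (k - 1) * \<i> * N $$ (n - 1, 0) \<and>
        (\<forall>i<n. \<forall>j<n.
           \<not> [int i - int j = -1] (mod int n) \<and> \<not> [int i - int j = 0] (mod int n) \<and>
           \<not> [int i - int j = 1] (mod int n) \<longrightarrow> N $$ (i, j) = 0))"

(* The quantities whose nonnegativity is required for 2 <= k <= n - 2, indexed by {0..<n};
   the last one is the corner entry. *)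
definition cyclic_entry :: "nat \<Rightarrow> nat \<Rightarrow> complex mat \<Rightarrow> nat \<Rightarrow> complex" where
  "cyclic_entry n k N i =
     (if i + 1 < n then \<i> * N $$ (i, i + 1) else (-1) ^ (k - 1) * \<i> * N $$ (n - 1, 0))"

definition support_graph :: "nat \<Rightarrow> complex mat \<Rightarrow> nat set set" where
  "support_graph n N = {{i, j} | i j. i < n \<and> j < n \<and> i \<noteq> j \<and> N $$ (i, j) \<noteq> 0}"

definition graph_connected :: "nat set \<Rightarrow> nat set set \<Rightarrow> bool" where
  "graph_connected V E \<longleftrightarrow> (\<forall>u\<in>V. \<forall>v\<in>V. (u, v) \<in> {(a, b). {a, b} \<in> E}\<^sup>*)"

end

theory Submission
  imports "HOL-Analysis.Derivative" Defs
begin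

text \<open>A point of the orbit is \<open>\<i> (b 1 + c P)\<close> with \<open>P\<close> the orthogonal projection onto a
  \<open>k\<close>-dimensional subspace \<open>V\<close>, and on tangent vectors all three metrics are negative multiples of
  \<open>kappa\<close>. The gradient flow is therefore \<open>P' = A P + P A - 2 P A P\<close> with \<open>A\<close> a positive multiple
  of \<open>\<i> N\<close>, that is, \<open>V(t) = exp (t A) V(0)\<close>. The left-justified minors of size \<open>k\<close> (the Pluecker
  coordinates of \<open>V(t)\<close>) solve, up to a common factor, a linear system whose off-diagonal coefficients
  are the entries \<open>A i j\<close> with the signs of exchanging \<open>i\<close> for \<open>j\<close> in a \<open>k\<close>-subset. Such a system
  preserves nonnegativity exactly if these coefficients are nonnegative, which is the stated
  condition, and it makes everything positive at once exactly if \<open>k\<close> tokens on the support graph can be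
  moved from any position to any other one, which is the case exactly if that graph is connected.

  The points with positive coordinates are the positive part of the orbit: a subspace with positive
  coordinates can be completed to a flag all of whose subspaces have positive coordinates,
  and the orthonormalization of an adapted basis has positive left-justified minors.\<close>

section \<open>Minors in the leading columns\<close>

text \<open>Two obstacles shape the proof. An orbit point determines only a subspace, so the unitary
  representative \<open>h t\<close> along a gradient curve is picked separately for each time and
  need not even be continuous; its minors cannot be differentiated. They are compared with the
  minors of the differentiable matrix \<open>mexp A t * h 0\<close>, whose first \<open>k\<close>
  columns span the same subspace, and every sign condition on coordinates is stated up to one common
  nonzero complex factor. Moreover, both notions of preservation quantify over gradient curves and
  would hold vacuously if there were none. Necessity therefore requires curves through prescribed
  points; they come from the exponential and the inverse of a Gram matrix. The test points are the
  coordinate subspaces, where exactly one coordinate is nonzero: the derivative at time 0 of a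
  neighbouring coordinate is a single off-diagonal coefficient, and a disconnected graph keeps some
  coordinates at zero forever.\<close>

definition row_minor :: "complex mat \<Rightarrow> nat list \<Rightarrow> complex" where
  "row_minor M xs = det (mat (length xs) (length xs) (\<lambda>(a, b). M $$ (xs ! a, b)))"

abbreviation slist :: "nat set \<Rightarrow> nat list" where
  "slist \<equiv> sorted_list_of_set"

lemma slist_eqI:
  assumes "sorted_wrt (<) xs" "set xs = K"
  shows "slist K = xs"
  using assms by (metis List.finite_set set_sorted_list_of_set strict_sorted_equal
    strict_sorted_list_of_set)

text \<open>\<open>submatrix\<close> selects its rows through \<open>pick\<close>. Since
  \<open>pick I\<close> is strictly increasing with image \<open>I\<close>, it enumerates
  \<open>I\<close> as the sorted list does, so the minors of the definitions become minors along
  lists.\<close>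

lemma pick_eq_slist_nth:
  assumes "finite I" "a < card I"
  shows "pick I a = slist I ! a"
proof -
  let ?xs = "map (pick I) [0..<card I]"
  have s: "sorted_wrt (<) ?xs"
    by (auto simp: sorted_wrt_iff_nth_less intro!: pick_mono_le)
  have "inj_on (pick I) {0..<card I}"
    by (rule inj_onI) (metis atLeastLessThan_iff linorder_neqE_nat order_less_irrefl pick_mono_le)
  then have "card (pick I ` {0..<card I}) = card I"
    by (simp add: card_image)
  moreover have "pick I ` {0..<card I} \<subseteq> I"
    by (auto intro: pick_in_set_le)
  ultimately have "set ?xs = I"
    using assms(1) by (metis card_subset_eq list.set_map set_upt)
  with s have "slist I = ?xs" by (rule slist_eqI)
  then show ?thesis using assms(2) by simp
qed

lemma left_justified_minor_eq_row_minor: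
  assumes M: "M \<in> carrier_mat n n" and I: "I \<subseteq> {0..<n}"
  shows "left_justified_minor M I = row_minor M (slist I)"
proof -
  have fin: "finite I" using I finite_subset by blast
  have cI: "card I \<le> n" using card_mono[OF _ I] by simp
  have 1: "{i. i < dim_row M \<and> i \<in> I} = I" using I M by auto
  have 2: "{j. j < dim_col M \<and> j \<in> {0..<card I}} = {0..<card I}" using cI M by auto
  have "submatrix M I {0..<card I} =
      mat (length (slist I)) (length (slist I)) (\<lambda>(a, b). M $$ (slist I ! a, b))"
    unfolding submatrix_def 1 2 using fin
    by (intro eq_matI) (auto simp: pick_eq_slist_nth)
  then show ?thesis by (simp add: left_justified_minor_def row_minor_def)
qed

lemma row_minor_swap:
  "row_minor M (xs @ a # b # ys) = - row_minor M (xs @ b # a # ys)"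
proof -
  let ?zs = "xs @ b # a # ys" and ?ws = "xs @ a # b # ys"
  let ?n = "length ?zs"
  let ?A = "mat ?n ?n (\<lambda>(i, j). M $$ (?zs ! i, j))"
  have "swaprows (length xs) (Suc (length xs)) ?A = mat ?n ?n (\<lambda>(i, j). M $$ (?ws ! i, j))"
    by (rule eq_matI) (auto simp: nth_append nth_Cons split: nat.splits)
  moreover have "det (swaprows (length xs) (Suc (length xs)) ?A) = - det ?A"
    by (rule det_swaprows[of _ ?n]) auto
  ultimately show ?thesis by (simp add: row_minor_def)
qed

text \<open>Moving \<open>i\<close> behind \<open>ys\<close> takes \<open>length ys\<close> adjacent
  transpositions, each of which costs one sign.\<close>

lemma row_minor_move_last:
  "row_minor M (xs @ i # ys) = (-1) ^ length ys * row_minor M (xs @ ys @ [i])"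
proof (induction ys arbitrary: xs)
  case (Cons y ys)
  then show ?case
    using row_minor_swap[of M xs i y ys] Cons.IH[of "xs @ [y]"] by simp
qed simp

lemma row_minor_not_distinct:
  assumes "\<not> distinct xs"
  shows "row_minor M xs = 0"
proof -
  from assms obtain i j where "i < length xs" "j < length xs" "i \<noteq> j" "xs ! i = xs ! j"
    by (auto simp: distinct_conv_nth)
  then show ?thesis unfolding row_minor_def
    by (intro det_identical_rows[of _ "length xs" i j]) (auto simp: row_def)
qed

lemma slist_insert:
  assumes "finite K" "i \<notin> K"
  shows "slist (insert i K) = slist {x \<in> K. x < i} @ i # slist {x \<in> K. i < x}"
proof -
  have "sorted_wrt (<) (slist {x \<in> K. x < i} @ i # slist {x \<in> K. i < x})"
    using assms by (auto simp: sorted_wrt_append)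
  moreover have "set (slist {x \<in> K. x < i} @ i # slist {x \<in> K. i < x}) = insert i K"
    using assms by auto
  ultimately show ?thesis by (rule slist_eqI)
qed

lemma slist_split:
  assumes "finite K" "i \<notin> K"
  shows "slist K = slist {x \<in> K. x < i} @ slist {x \<in> K. i < x}"
proof -
  have "sorted_wrt (<) (slist {x \<in> K. x < i} @ slist {x \<in> K. i < x})"
    using assms by (auto simp: sorted_wrt_append)
  moreover have "set (slist {x \<in> K. x < i} @ slist {x \<in> K. i < x}) = K"
    using assms nat_neq_iff by auto
  ultimately show ?thesis by (rule slist_eqI)
qed

text \<open>The minor of a row set, with rows in increasing order. The list version stays in use
  because exchanging one row for another produces unsorted or repeated rows.\<close>

definition plucker :: "complex mat \<Rightarrow> nat set \<Rightarrow> complex" where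
  "plucker M I = row_minor M (slist I)"

text \<open>Sorting the appended row into its place passes exactly the elements of \<open>K\<close>
  larger than \<open>i\<close>; the exchange signs come from this count. A row already in
  \<open>K\<close> is repeated, which gives 0.\<close>

lemma row_minor_append_last:
  assumes "finite K"
  shows "row_minor M (slist K @ [i]) =
    (if i \<in> K then 0 else (-1) ^ card {x \<in> K. i < x} * plucker M (insert i K))"
proof (cases "i \<in> K")
  case True
  then show ?thesis using assms by (simp add: row_minor_not_distinct)
next
  case False
  have "plucker M (insert i K) = (-1) ^ card {x \<in> K. i < x} * row_minor M (slist K @ [i])"
    using assms False unfolding plucker_def slist_insert[OF assms False] slist_split[OF assms False]
    by (subst row_minor_move_last) simp
  then show ?thesis using False by (simp add: mult.assoc[symmetric] power_mult_distrib[symmetric])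
qed

lemma take_drop_remove1:
  "distinct xs \<Longrightarrow> r < length xs \<Longrightarrow> take r xs @ drop (Suc r) xs = remove1 (xs ! r) xs"
proof (induction xs arbitrary: r)
  case (Cons x xs)
  then show ?case by (cases r) auto
qed simp

text \<open>The row at position \<open>r\<close> among the \<open>m + 1\<close> sorted rows has
  \<open>m - r\<close> larger rows, and \<open>r + m\<close> has the same parity. The cofactor sign
  is thus a count of elements of \<open>K\<close> larger than \<open>i\<close>.\<close>

lemma plucker_laplace_last_column:
  assumes fin: "finite K" and card: "card K = Suc m"
  shows "plucker M K = (\<Sum>i\<in>K. (-1) ^ card {x \<in> K. i < x} * M $$ (i, m) * plucker M (K - {i}))"
proof -
  define xs where "xs = slist K"
  have xs: "length xs = Suc m" "distinct xs" "set xs = K" "sorted_wrt (<) xs"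
    using fin card by (auto simp: xs_def)
  let ?A = "mat (Suc m) (Suc m) (\<lambda>(a, b). M $$ (xs ! a, b))"
  have del: "det (mat_delete ?A r m) = plucker M (K - {xs ! r})" if "r < Suc m" for r
  proof -
    have "slist (K - {xs ! r}) = take r xs @ drop (Suc r) xs"
      using that xs fin by (simp add: take_drop_remove1 xs_def sorted_list_of_set_remove)
    then have "plucker M (K - {xs ! r}) = det (mat m m (\<lambda>(a, b). M $$ ((take r xs @ drop (Suc r) xs)
      ! a, b)))"
      using that xs by (simp add: plucker_def row_minor_def)
    moreover have "mat_delete ?A r m = mat m m (\<lambda>(a, b). M $$ ((take r xs @ drop (Suc r) xs) ! a, b))"
      using that xs by (intro eq_matI) (auto simp: mat_delete_def nth_append)
    ultimately show ?thesis by simp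
  qed
  have sgn: "(-1) ^ (r + m) = ((-1) ^ card {x \<in> K. xs ! r < x} :: complex)" if "r < Suc m" for r
  proof -
    have "{x \<in> K. xs ! r < x} = (\<lambda>a. xs ! a) ` {r<..<Suc m}"
    proof safe
      fix x assume "x \<in> K" "xs ! r < x"
      then obtain a where a: "a < Suc m" "x = xs ! a" using xs by (metis in_set_conv_nth)
      have "\<not> a \<le> r" using \<open>xs ! r < x\<close> a that xs
        by (metis leD le_neq_implies_less nat_less_le sorted_wrt_iff_nth_less)
      then show "x \<in> (!) xs ` {r<..<Suc m}" using a by auto
    qed (use xs in \<open>auto simp: sorted_wrt_iff_nth_less\<close>)
    moreover have "inj_on (\<lambda>a. xs ! a) {r<..<Suc m}"
      using xs by (auto simp: inj_on_def nth_eq_iff_index_eq)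
    ultimately have "card {x \<in> K. xs ! r < x} = m - r" by (simp add: card_image)
    moreover have "r + m = 2 * r + (m - r)" using that by simp
    ultimately have "(-1) ^ (r + m) = ((-1) ^ 2) ^ r * ((-1) ^ card {x \<in> K. xs ! r < x} :: complex)"
      by (simp only: power_add power_mult)
    then show ?thesis by simp
  qed
  have "plucker M K = det ?A" using xs by (simp add: plucker_def row_minor_def xs_def)
  also have "\<dots> = (\<Sum>r<Suc m. ?A $$ (r, m) * cofactor ?A r m)"
    by (rule laplace_expansion_column) auto
  also have "\<dots> = (\<Sum>r<Suc m. (-1) ^ card {x \<in> K. xs ! r < x} * M $$ (xs ! r, m) * plucker M (K - {xs
    ! r}))"
    using sgn del by (intro sum.cong) (auto simp: cofactor_def mult_ac)
  also have "\<dots> = (\<Sum>i\<in>K. (-1) ^ card {x \<in> K. i < x} * M $$ (i, m) * plucker M (K - {i}))"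
    by (rule sum.reindex_bij_betw[where h = "\<lambda>r. xs ! r" and S = "{..<Suc m}"])
      (use xs bij_betw_nth[of xs] in auto)
  finally show ?thesis .
qed

section \<open>Derivatives of minors along a linear differential equation\<close>

lemma has_vector_derivative_prod_field:
  fixes f :: "'i \<Rightarrow> real \<Rightarrow> complex"
  assumes "finite S" "\<And>i. i \<in> S \<Longrightarrow> (f i has_vector_derivative f' i) (at t)"
  shows "((\<lambda>s. \<Prod>i\<in>S. f i s) has_vector_derivative (\<Sum>i\<in>S. f' i * (\<Prod>j\<in>S - {i}. f j t))) (at t)"
  using assms
proof (induction S)
  case (insert a S)
  have "((\<lambda>s. f a s * (\<Prod>i\<in>S. f i s)) has_vector_derivative
      f a t * (\<Sum>i\<in>S. f' i * (\<Prod>j\<in>S - {i}. f j t)) + f' a * (\<Prod>i\<in>S. f i t)) (at t)"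
    using insert by (intro has_vector_derivative_mult) auto
  moreover have "f a t * (\<Sum>i\<in>S. f' i * (\<Prod>j\<in>S - {i}. f j t)) =
      (\<Sum>i\<in>S. f' i * (\<Prod>j\<in>insert a S - {i}. f j t))"
    unfolding sum_distrib_left
  proof (rule sum.cong)
    fix i assume "i \<in> S"
    then have "insert a S - {i} = insert a (S - {i})" using insert by auto
    then show "f a t * (f' i * (\<Prod>j\<in>S - {i}. f j t)) = f' i * (\<Prod>j\<in>insert a S - {i}. f j t)"
      using insert by (simp add: mult_ac)
  qed simp
  moreover have "insert a S - {a} = S" using insert by auto
  ultimately show ?case using insert by (simp add: add_ac)
qed simp

lemma row_minor_expand:
  "row_minor M xs = (\<Sum>p | p permutes {0..<length xs}. signof p * (\<Prod>a=0..<length xs. M $$ (xs ! a, p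
    a)))"
proof -
  have "row_minor M xs = (\<Sum>p | p permutes {0..<length xs}. signof p *
      (\<Prod>a=0..<length xs. mat (length xs) (length xs) (\<lambda>(a, b). M $$ (xs ! a, b)) $$ (a, p a)))"
    unfolding row_minor_def by (rule det_def') simp
  also have "\<dots> = (\<Sum>p | p permutes {0..<length xs}. signof p * (\<Prod>a=0..<length xs. M $$ (xs ! a, p a)))"
  proof (intro sum.cong prod.cong refl arg_cong2[of _ _ _ _ "(*)"])
    fix p a assume "p \<in> {p. p permutes {0..<length xs}}" "a \<in> {0..<length xs}"
    moreover from this have "p a \<in> {0..<length xs}" using permutes_in_image[of p "{0..<length xs}"
      a] by simp
    ultimately show "mat (length xs) (length xs) (\<lambda>(a, b). M $$ (xs ! a, b)) $$ (a, p a) = M $$ (xs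
      ! a, p a)" by simp
  qed
  finally show ?thesis .
qed

text \<open>By the Leibniz rule the derivative is the sum over \<open>r\<close> of the minors with
  row \<open>r\<close> differentiated, and row \<open>xs ! r\<close> of \<open>A * X t\<close> is
  the combination of the rows \<open>c\<close> of \<open>X t\<close> with coefficients
  \<open>A $$ (xs ! r, c)\<close>.\<close>

lemma row_minor_derivative:
  assumes X: "\<And>s. X s \<in> carrier_mat n n" and A: "A \<in> carrier_mat n n"
    and der: "has_mat_derivative n X (A * X t) t"
    and xs: "set xs \<subseteq> {0..<n}" "length xs \<le> n"
  shows "((\<lambda>s. row_minor (X s) xs) has_vector_derivative
    (\<Sum>r<length xs. \<Sum>c<n. A $$ (xs ! r, c) * row_minor (X t) (xs[r := c]))) (at t)"
proof -
  let ?k = "length xs" and ?P = "{p. p permutes {0..<length xs}}"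
  have d1: "((\<lambda>s. X s $$ (xs ! a, p a)) has_vector_derivative (A * X t) $$ (xs ! a, p a)) (at t)"
    if "a \<in> {0..<?k}" "p \<in> ?P" for a p
  proof -
    have "xs ! a < n" using that xs nth_mem[of a xs] by (auto simp del: nth_mem)
    moreover have "p a < ?k" using that permutes_in_image[of p "{0..<?k}" a] by simp
    then have "p a < n" using xs by simp
    ultimately show ?thesis using der by (simp add: has_mat_derivative_def)
  qed
  have "((\<lambda>s. \<Sum>p\<in>?P. signof p * (\<Prod>a=0..<?k. X s $$ (xs ! a, p a))) has_vector_derivative
      (\<Sum>p\<in>?P. signof p * (\<Sum>r\<in>{0..<?k}. (A * X t) $$ (xs ! r, p r) * (\<Prod>a\<in>{0..<?k} - {r}. X t $$ (xs !
        a, p a))))) (at t)"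
    by (intro has_vector_derivative_sum has_vector_derivative_mult_right
      has_vector_derivative_prod_field d1) auto
  moreover have "(\<Sum>p\<in>?P. signof p * (\<Sum>r\<in>{0..<?k}. (A * X t) $$ (xs ! r, p r) * (\<Prod>a\<in>{0..<?k} - {r}. X
    t $$ (xs ! a, p a))))
     = (\<Sum>r<?k. \<Sum>c<n. A $$ (xs ! r, c) * row_minor (X t) (xs[r := c]))"
  proof -
    have prod: "(\<Prod>a=0..<?k. X t $$ (xs[r := c] ! a, p a)) = X t $$ (c, p r) * (\<Prod>a\<in>{0..<?k} - {r}. X
      t $$ (xs ! a, p a))"
      if "r < ?k" for r c p
    proof -
      have "(\<Prod>a=0..<?k. X t $$ (xs[r := c] ! a, p a)) = X t $$ (xs[r := c] ! r, p r) * (\<Prod>a\<in>{0..<?k}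
        - {r}. X t $$ (xs[r := c] ! a, p a))"
        using that by (intro prod.remove) auto
      also have "(\<Prod>a\<in>{0..<?k} - {r}. X t $$ (xs[r := c] ! a, p a)) = (\<Prod>a\<in>{0..<?k} - {r}. X t $$ (xs
        ! a, p a))"
        by (intro prod.cong) auto
      finally show ?thesis using that by simp
    qed
    have ax: "(A * X t) $$ (xs ! r, p r) = (\<Sum>c<n. A $$ (xs ! r, c) * X t $$ (c, p r))" if "r < ?k"
      "p \<in> ?P" for r p
    proof -
      have "xs ! r < n" using that xs nth_mem[of r xs] by (auto simp del: nth_mem)
      moreover have "p r < ?k" using that permutes_in_image[of p "{0..<?k}" r] by simp
      then have "p r < n" using xs by simp
      ultimately show ?thesis using X[of t] A by (simp add: scalar_prod_def atLeast0LessThan)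
    qed
    have "(\<Sum>r<?k. \<Sum>c<n. A $$ (xs ! r, c) * row_minor (X t) (xs[r := c])) =
      (\<Sum>r<?k. \<Sum>c<n. \<Sum>p\<in>?P. A $$ (xs ! r, c) * (signof p * (X t $$ (c, p r) * (\<Prod>a\<in>{0..<?k} - {r}. X t
        $$ (xs ! a, p a)))))"
      by (intro sum.cong refl) (simp add: row_minor_expand sum_distrib_left prod)
    also have "\<dots> = (\<Sum>r<?k. \<Sum>p\<in>?P. \<Sum>c<n. A $$ (xs ! r, c) * (signof p * (X t $$ (c, p r) *
      (\<Prod>a\<in>{0..<?k} - {r}. X t $$ (xs ! a, p a)))))"
      by (intro sum.cong refl sum.swap)
    also have "\<dots> = (\<Sum>p\<in>?P. \<Sum>r<?k. \<Sum>c<n. A $$ (xs ! r, c) * (signof p * (X t $$ (c, p r) *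
      (\<Prod>a\<in>{0..<?k} - {r}. X t $$ (xs ! a, p a)))))"
      by (rule sum.swap)
    also have "\<dots> = (\<Sum>p\<in>?P. signof p * (\<Sum>r\<in>{0..<?k}. (A * X t) $$ (xs ! r, p r) * (\<Prod>a\<in>{0..<?k} - {r}.
      X t $$ (xs ! a, p a))))"
      unfolding atLeast0LessThan[symmetric] sum_distrib_left
      by (intro sum.cong refl) (simp add: ax atLeast0LessThan sum_distrib_left sum_distrib_right
        mult_ac)
    finally show ?thesis by simp
  qed
  ultimately show ?thesis by (simp add: row_minor_expand)
qed

text \<open>Replacing row \<open>i\<close> of the minor with rows \<open>K \<union> {i}\<close> by row \<open>j\<close> gives the minor with rows
  \<open>K \<union> {j}\<close>, up to the sign of sorting the rows.\<close>

definition exchange_sign :: "nat set \<Rightarrow> nat \<Rightarrow> nat \<Rightarrow> real" where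
  "exchange_sign K i j = (-1) ^ (card {x \<in> K. i < x} + card {x \<in> K. j < x})"

text \<open>The terms of the list version with \<open>c\<close> in \<open>I - {i}\<close> repeat a
  row and drop out. The value \<open>c = i\<close> stays in the range and contributes the diagonal
  entries of \<open>A\<close>.\<close>

lemma plucker_derivative:
  assumes X: "\<And>s. X s \<in> carrier_mat n n" and A: "A \<in> carrier_mat n n"
    and der: "has_mat_derivative n X (A * X t) t"
    and I: "I \<subseteq> {0..<n}"
  shows "((\<lambda>s. plucker (X s) I) has_vector_derivative
    (\<Sum>i\<in>I. \<Sum>c\<in>{0..<n} - (I - {i}). A $$ (i, c) * exchange_sign (I - {i}) i c * plucker (X t) (insert
      c (I - {i})))) (at t)"
proof -
  define xs where "xs = slist I"
  have fin: "finite I" using I finite_subset by blast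
  have xs: "distinct xs" "set xs = I" "length xs = card I" using fin by (auto simp: xs_def)
  have len: "length xs \<le> n" using xs card_mono[OF _ I] by simp
  have upd: "row_minor (X t) (xs[r := c]) =
      (if c \<in> I - {xs ! r} then 0 else exchange_sign (I - {xs ! r}) (xs ! r) c * plucker (X t)
        (insert c (I - {xs ! r})))"
    if r: "r < length xs" for r c
  proof -
    let ?i = "xs ! r" and ?K = "I - {xs ! r}"
    have i: "?i \<in> I" using r xs nth_mem by blast
    have K: "finite ?K" "?i \<notin> ?K" using fin by auto
    have "xs = slist {x \<in> ?K. x < ?i} @ ?i # slist {x \<in> ?K. ?i < x}"
      using slist_insert[OF K] i by (simp add: insert_absorb xs_def)
    moreover obtain us vs where uv: "us = slist {x \<in> ?K. x < ?i}" "vs = slist {x \<in> ?K. ?i < x}" by simp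
    ultimately have e: "xs = us @ ?i # vs" by simp
    have "length us = r"
    proof -
      have "(us @ ?i # vs) ! length us = ?i" by simp
      then have "xs ! length us = xs ! r" using e by simp
      moreover have "length us < length xs" using arg_cong[OF e, of length] by simp
      ultimately show ?thesis using r xs by (simp add: nth_eq_iff_index_eq)
    qed
    then have "xs[r := c] = us @ c # vs" using e by (metis list_update_length)
    then have "row_minor (X t) (xs[r := c]) = (-1) ^ length vs * row_minor (X t) ((us @ vs) @ [c])"
      by (simp add: row_minor_move_last)
    also have "us @ vs = slist ?K" using slist_split[OF K] uv by simp
    also have "length vs = card {x \<in> ?K. ?i < x}" using uv K by simp
    finally show ?thesis
      unfolding row_minor_append_last[OF K(1)] exchange_sign_def by (auto simp: power_add)
  qed
  have "(\<Sum>r<length xs. \<Sum>c<n. A $$ (xs ! r, c) * row_minor (X t) (xs[r := c])) =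
    (\<Sum>r<length xs. \<Sum>c<n. A $$ (xs ! r, c) * (if c \<in> I - {xs ! r} then 0 else exchange_sign (I - {xs
      ! r}) (xs ! r) c * plucker (X t) (insert c (I - {xs ! r}))))"
    using upd by (intro sum.cong refl) simp
  also have "\<dots> = (\<Sum>i\<in>I. \<Sum>c<n. A $$ (i, c) * (if c \<in> I - {i} then 0 else exchange_sign (I - {i}) i c
    * plucker (X t) (insert c (I - {i}))))"
    by (rule sum.reindex_bij_betw[where h = "\<lambda>r. xs ! r" and S = "{..<length xs}"])
      (use xs bij_betw_nth[of xs] in auto)
  also have "\<dots> = (\<Sum>i\<in>I. \<Sum>c\<in>{0..<n} - (I - {i}). A $$ (i, c) * exchange_sign (I - {i}) i c * plucker
    (X t) (insert c (I - {i})))"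
    by (intro sum.cong refl sum.mono_neutral_cong_right) auto
  finally show ?thesis
    using row_minor_derivative[OF X A der, of xs] len I xs by (simp add: plucker_def xs_def)
qed

section \<open>Linear systems of differential equations\<close>

text \<open>Gronwall's inequality: \<open>exp (- C * s) * f s\<close> is nonincreasing up to time
  \<open>T\<close>.\<close>

lemma nonpos_of_deriv_le:
  fixes f :: "real \<Rightarrow> real"
  assumes "0 \<le> T" "f 0 \<le> 0"
    and "\<And>s. 0 \<le> s \<Longrightarrow> s \<le> T \<Longrightarrow> (f has_real_derivative f' s) (at s)"
    and "\<And>s. 0 \<le> s \<Longrightarrow> s \<le> T \<Longrightarrow> f' s \<le> C * f s"
  shows "f T \<le> 0"
proof -
  have "exp (- C * T) * f T \<le> exp (- C * 0) * f 0"
  proof (rule DERIV_nonpos_imp_nonincreasing[OF assms(1)])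
    fix s assume s: "0 \<le> s" "s \<le> T"
    have "((\<lambda>s. exp (- C * s) * f s) has_real_derivative exp (- C * s) * (f' s - C * f s)) (at s)"
      by (rule derivative_eq_intros assms(3) s refl)+ (simp add: algebra_simps)
    moreover have "exp (- C * s) * (f' s - C * f s) \<le> 0"
      using assms(4)[OF s] by (simp add: mult_le_0_iff)
    ultimately show "\<exists>y. ((\<lambda>s. exp (- C * s) * f s) has_real_derivative y) (at s) \<and> y \<le> 0" by blast
  qed
  also have "\<dots> \<le> 0" using assms(2) by simp
  finally show ?thesis by (simp add: mult_le_0_iff)
qed

lemma sum_sum_squares:
  fixes a :: "'i \<Rightarrow> real"
  shows "(\<Sum>i\<in>S. \<Sum>j\<in>S. C * (a i + a j)) = 2 * C * real (card S) * (\<Sum>i\<in>S. a i)"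
  by (simp add: sum.distrib distrib_left sum_distrib_left[symmetric] sum_distrib_right[symmetric]
    mult_ac)

text \<open>Energy estimate: the squared norm \<open>f\<close> of the solution vanishes at 0 and has
  derivative at most \<open>2 * C * card S\<close> times itself. The coefficients may vary with time
  as long as they are bounded.\<close>

lemma linear_system_zero:
  fixes y :: "'i \<Rightarrow> real \<Rightarrow> complex"
  assumes "0 \<le> T"
    and der: "\<And>i s. i \<in> S \<Longrightarrow> 0 \<le> s \<Longrightarrow> s \<le> T \<Longrightarrow>
      (y i has_vector_derivative (\<Sum>j\<in>S. M s i j * y j s)) (at s)"
    and bound: "\<And>i j s. i \<in> S \<Longrightarrow> j \<in> S \<Longrightarrow> 0 \<le> s \<Longrightarrow> s \<le> T \<Longrightarrow> cmod (M s i j) \<le> C"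
    and zero: "\<And>i. i \<in> S \<Longrightarrow> y i 0 = 0"
    and fin: "finite S" and i: "i \<in> S"
  shows "y i T = 0"
proof -
  define f where "f s = (\<Sum>i\<in>S. (cmod (y i s))\<^sup>2)" for s
  define y' where "y' i s = (\<Sum>j\<in>S. M s i j * y j s)" for i s
  define f' where "f' s = (\<Sum>i\<in>S. 2 * (Re (y i s) * Re (y' i s) + Im (y i s) * Im (y' i s)))" for s
  have "f T \<le> 0"
  proof (rule nonpos_of_deriv_le[where f = f and f' = f' and C = "2 * C * real (card S)"])
    show "f 0 \<le> 0" using zero by (simp add: f_def)
    fix s assume s: "0 \<le> s" "s \<le> T"
    have "((\<lambda>s. (Re (y i s))\<^sup>2 + (Im (y i s))\<^sup>2) has_real_derivative
        2 * (Re (y i s) * Re (y' i s) + Im (y i s) * Im (y' i s))) (at s)" if "i \<in> S" for i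
    proof -
      have re: "((\<lambda>s. Re (y i s)) has_real_derivative Re (y' i s)) (at s)"
        and im: "((\<lambda>s. Im (y i s)) has_real_derivative Im (y' i s)) (at s)"
        using der[OF that s] by (auto simp: has_vector_derivative_complex_iff o_def y'_def)
      show ?thesis
        by (rule DERIV_cong[OF DERIV_add[OF DERIV_power[OF re, where n = 2] DERIV_power[OF im, where
          n = 2]]])
          (simp add: algebra_simps)
    qed
    then show "(f has_real_derivative f' s) (at s)"
      unfolding f_def f'_def cmod_power2 by (intro DERIV_sum)
    have "f' s \<le> (\<Sum>i\<in>S. \<Sum>j\<in>S. C * ((cmod (y i s))\<^sup>2 + (cmod (y j s))\<^sup>2))"
      unfolding f'_def
    proof (rule sum_mono)
      fix i assume i: "i \<in> S"
      have "Re (y i s) * Re (y' i s) + Im (y i s) * Im (y' i s) = Re (cnj (y i s) * y' i s)" by simp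
      also have "\<dots> \<le> cmod (cnj (y i s) * y' i s)" by (rule complex_Re_le_cmod)
      also have "\<dots> \<le> cmod (y i s) * (\<Sum>j\<in>S. C * cmod (y j s))"
        unfolding norm_mult complex_mod_cnj
      proof (rule mult_left_mono)
        show "cmod (y' i s) \<le> (\<Sum>j\<in>S. C * cmod (y j s))"
          unfolding y'_def using bound[OF i _ s]
          by (intro order_trans[OF norm_sum] sum_mono) (auto simp: norm_mult intro!: mult_right_mono)
      qed simp
      finally have "2 * (Re (y i s) * Re (y' i s) + Im (y i s) * Im (y' i s)) \<le>
          2 * (cmod (y i s) * (\<Sum>j\<in>S. C * cmod (y j s)))"
        by (rule mult_left_mono) simp
      also have "\<dots> = (\<Sum>j\<in>S. C * (2 * (cmod (y i s) * cmod (y j s))))"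
        by (simp add: sum_distrib_left mult_ac)
      also have "\<dots> \<le> (\<Sum>j\<in>S. C * ((cmod (y i s))\<^sup>2 + (cmod (y j s))\<^sup>2))"
      proof (intro sum_mono mult_left_mono)
        fix j assume "j \<in> S"
        show "2 * (cmod (y i s) * cmod (y j s)) \<le> (cmod (y i s))\<^sup>2 + (cmod (y j s))\<^sup>2"
          using sum_squares_bound[of "cmod (y i s)" "cmod (y j s)"] by simp
        show "0 \<le> C" using bound[OF i i s] norm_ge_zero order_trans by blast
      qed
      finally show "2 * (Re (y i s) * Re (y' i s) + Im (y i s) * Im (y' i s)) \<le>
        (\<Sum>j\<in>S. C * ((cmod (y i s))\<^sup>2 + (cmod (y j s))\<^sup>2))" .
    qed
    then show "f' s \<le> 2 * C * real (card S) * f s"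
      by (simp add: sum_sum_squares f_def)
  qed fact
  moreover have "0 \<le> f T" by (simp add: f_def sum_nonneg)
  ultimately have "f T = 0" by linarith
  then show ?thesis using fin i by (simp add: f_def sum_nonneg_eq_0_iff)
qed

text \<open>The negative part has a kink at 0, but its square is differentiable everywhere, so an
  energy built from negative parts can be differentiated.\<close>

lemma min_zero_square_derivative:
  "((\<lambda>x::real. (min x 0)\<^sup>2) has_real_derivative 2 * min x 0) (at x)"
proof -
  consider "x < 0" | "x = 0" | "0 < x" by linarith
  then show ?thesis
  proof cases
    case 1
    have "((\<lambda>x::real. x\<^sup>2) has_real_derivative 2 * min x 0) (at x)"
      using 1 by (auto intro!: derivative_eq_intros)
    moreover have "eventually (\<lambda>x::real. x\<^sup>2 = (min x 0)\<^sup>2) (nhds x)"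
      by (rule eventually_mono[OF eventually_nhds_in_open[of "{..<0}"]]) (use 1 in auto)
    ultimately show ?thesis by (subst (asm) DERIV_cong_ev) (use 1 in \<open>auto simp: min_def\<close>)
  next
    case 2
    have "((\<lambda>h::real. (min h 0)\<^sup>2 / h) \<longlongrightarrow> 0) (at 0)"
    proof (rule tendsto_norm_zero_cancel, rule tendsto_sandwich[of "\<lambda>_. 0" _ _ "\<lambda>h. \<bar>h\<bar>"])
      show "eventually (\<lambda>h::real. norm ((min h 0)\<^sup>2 / h) \<le> \<bar>h\<bar>) (at 0)"
        by (auto simp: min_def power2_eq_square abs_mult)
      show "((\<lambda>h::real. \<bar>h\<bar>) \<longlongrightarrow> 0) (at 0)" by (auto intro!: tendsto_eq_intros)
    qed auto
    then show ?thesis using 2 by (simp add: DERIV_def)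
  next
    case 3
    have "((\<lambda>x::real. 0) has_real_derivative 2 * min x 0) (at x)"
      using 3 by (auto intro!: derivative_eq_intros)
    moreover have "eventually (\<lambda>x::real. 0 = (min x 0)\<^sup>2) (nhds x)"
      by (rule eventually_mono[OF eventually_nhds_in_open[of "{0<..}"]]) (use 3 in auto)
    ultimately show ?thesis by (subst (asm) DERIV_cong_ev) (use 3 in \<open>auto simp: min_def\<close>)
  qed
qed

section \<open>Linear systems with nonnegative off-diagonal coefficients\<close>

text \<open>Metzler matrices have nonnegative off-diagonal entries and an arbitrary diagonal. Their
  linear flows are those that preserve the nonnegative orthant.\<close>

locale metzler_system =
  fixes S :: "'i set" and G :: "'i \<Rightarrow> 'i \<Rightarrow> real" and y :: "'i \<Rightarrow> real \<Rightarrow> real"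
  assumes fin: "finite S"
    and offdiag: "\<And>i j. i \<in> S \<Longrightarrow> j \<in> S \<Longrightarrow> i \<noteq> j \<Longrightarrow> 0 \<le> G i j"
    and der: "\<And>i s. i \<in> S \<Longrightarrow> 0 \<le> s \<Longrightarrow> (y i has_real_derivative (\<Sum>j\<in>S. G i j * y j s)) (at s)"
    and init: "\<And>i. i \<in> S \<Longrightarrow> 0 \<le> y i 0"
begin

text \<open>The energy of the negative parts \<open>u\<close> vanishes at 0 and obeys a Gronwall
  inequality, so it stays 0.\<close>

lemma nonneg:
  assumes t: "0 \<le> t" and i: "i \<in> S"
  shows "0 \<le> y i t"
proof -
  define u where "u i s = min (y i s) 0" for i s
  define C where "C = (\<Sum>i\<in>S. \<Sum>j\<in>S. \<bar>G i j\<bar>)"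
  have C: "\<bar>G i j\<bar> \<le> C" if "i \<in> S" "j \<in> S" for i j
  proof -
    have "\<bar>G i j\<bar> \<le> (\<Sum>j\<in>S. \<bar>G i j\<bar>)" using that fin by (intro member_le_sum) auto
    also have "\<dots> \<le> C" unfolding C_def using that fin
      by (intro member_le_sum[of i S "\<lambda>i. \<Sum>j\<in>S. \<bar>G i j\<bar>"]) (auto intro: sum_nonneg)
    finally show ?thesis .
  qed
  define f where "f s = (\<Sum>i\<in>S. (u i s)\<^sup>2)" for s
  define f' where "f' s = (\<Sum>i\<in>S. 2 * u i s * (\<Sum>j\<in>S. G i j * y j s))" for s
  have "f t \<le> 0"
  proof (rule nonpos_of_deriv_le[where f = f and f' = f' and C = "2 * C * real (card S)"])
    show "f 0 \<le> 0" using init by (simp add: f_def u_def)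
    fix s :: real assume s: "0 \<le> s"
    have "((\<lambda>s. (u i s)\<^sup>2) has_real_derivative 2 * u i s * (\<Sum>j\<in>S. G i j * y j s)) (at s)" if "i \<in> S"
      for i
      unfolding u_def using DERIV_chain2[OF min_zero_square_derivative der[OF that s]] by simp
    then show "(f has_real_derivative f' s) (at s)"
      unfolding f_def f'_def by (intro DERIV_sum)
    have "f' s \<le> (\<Sum>i\<in>S. \<Sum>j\<in>S. C * ((u i s)\<^sup>2 + (u j s)\<^sup>2))"
      unfolding f'_def sum_distrib_left
    proof (intro sum_mono)
      fix i j assume ij: "i \<in> S" "j \<in> S"
      have "u i s * (G i j * y j s) \<le> \<bar>G i j\<bar> * (\<bar>u i s\<bar> * \<bar>u j s\<bar>)"
      proof (cases "i = j")
        case True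
        have "u i s * y i s = \<bar>u i s\<bar> * \<bar>u i s\<bar>" by (auto simp: u_def min_def)
        then have "u i s * (G i j * y j s) = G i j * (\<bar>u i s\<bar> * \<bar>u j s\<bar>)"
          using True by (simp add: mult_ac)
        also have "\<dots> \<le> \<bar>G i j\<bar> * (\<bar>u i s\<bar> * \<bar>u j s\<bar>)" by (intro mult_right_mono) auto
        finally show ?thesis .
      next
        case False
        \<comment> \<open>Here the sign of \<open>G i j\<close> matters: a nonnegative
          \<open>y j s\<close> meets the nonpositive \<open>u i s\<close> and can only lower the
          energy, while a negative \<open>y j s\<close> equals \<open>u j s\<close>.\<close>
        have "u i s * y j s \<le> \<bar>u i s\<bar> * \<bar>u j s\<bar>"
        proof (cases "y j s \<ge> 0")
          case True
          then have "u i s * y j s \<le> 0" by (auto simp: u_def mult_le_0_iff)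
          then show ?thesis by (smt (verit) mult_nonneg_nonneg abs_ge_zero)
        qed (auto simp: u_def min_def mult_nonpos_nonneg)
        then show ?thesis using offdiag[OF ij False]
          using mult_left_mono[of "u i s * y j s" "\<bar>u i s\<bar> * \<bar>u j s\<bar>" "G i j"] by (simp add: mult_ac)
      qed
      also have "\<dots> \<le> C * (\<bar>u i s\<bar> * \<bar>u j s\<bar>)" by (intro mult_right_mono C ij) auto
      finally have "2 * (u i s * (G i j * y j s)) \<le> C * (2 * (\<bar>u i s\<bar> * \<bar>u j s\<bar>))" by simp
      also have "\<dots> \<le> C * ((u i s)\<^sup>2 + (u j s)\<^sup>2)"
        using sum_squares_bound[of "\<bar>u i s\<bar>" "\<bar>u j s\<bar>"] C[OF ij]
        by (intro mult_left_mono) (auto simp: mult.assoc)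
      finally show "2 * u i s * (G i j * y j s) \<le> C * ((u i s)\<^sup>2 + (u j s)\<^sup>2)" by simp
    qed
    then show "f' s \<le> 2 * C * real (card S) * f s"
      by (simp add: sum_sum_squares f_def)
  qed fact
  moreover have "0 \<le> f t" by (simp add: f_def sum_nonneg)
  ultimately have "f t = 0" by linarith
  then have "u i t = 0" using fin i by (simp add: f_def sum_nonneg_eq_0_iff)
  then show ?thesis by (auto simp: u_def min_def split: if_splits)
qed

text \<open>The integrating factor removes the diagonal coefficient, whose sign is unknown, and
  leaves a combination of the other components with nonnegative coefficients.\<close>

lemma scaled_derivative:
  assumes i: "i \<in> S" and s: "0 \<le> s"
  shows "((\<lambda>s. exp (- G i i * s) * y i s) has_real_derivative
    exp (- G i i * s) * (\<Sum>j\<in>S - {i}. G i j * y j s)) (at s)"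
proof -
  have "(\<Sum>j\<in>S. G i j * y j s) = G i i * y i s + (\<Sum>j\<in>S - {i}. G i j * y j s)"
    using fin i by (rule sum.remove)
  then show ?thesis
    by (auto intro!: derivative_eq_intros der[OF i s] simp: algebra_simps)
qed

lemma pos_of_pos:
  assumes i: "i \<in> S" "0 < y i 0" and t: "0 \<le> t"
  shows "0 < y i t"
proof -
  have "exp (- G i i * 0) * y i 0 \<le> exp (- G i i * t) * y i t"
  proof (rule DERIV_nonneg_imp_nondecreasing[OF t])
    fix s assume s: "0 \<le> s" "s \<le> t"
    have "0 \<le> exp (- G i i * s) * (\<Sum>j\<in>S - {i}. G i j * y j s)"
      using i nonneg[OF s(1)] offdiag by (intro mult_nonneg_nonneg sum_nonneg) auto
    then show "\<exists>y'. ((\<lambda>s. exp (- G i i * s) * y i s) has_real_derivative y') (at s) \<and> 0 \<le> y'"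
      using scaled_derivative[OF i(1) s(1)] by blast
  qed
  then have "0 < exp (- G i i * t) * y i t" using i(2) by simp
  then show ?thesis by (simp add: zero_less_mult_iff)
qed

text \<open>The positive component \<open>i\<close> makes the derivative of the rescaled
  \<open>y j\<close> strictly positive at positive times, so \<open>y j\<close> rises above its
  nonnegative initial value at once.\<close>

lemma pos_step:
  assumes ij: "i \<in> S" "j \<in> S" "i \<noteq> j" "0 < G j i"
    and pos: "\<And>t. 0 < t \<Longrightarrow> 0 < y i t" and t: "0 < t"
  shows "0 < y j t"
proof -
  have "exp (- G j j * 0) * y j 0 < exp (- G j j * t) * y j t"
  \<comment> \<open>At time 0 the component \<open>i\<close> may still vanish, so the derivative is
    known to be positive only on the open interval.\<close>
  proof (rule DERIV_pos_imp_increasing_open[OF t])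
    fix s assume s: "0 < s" "s < t"
    have "0 < (\<Sum>l\<in>S - {j}. G j l * y l s)"
      using ij pos[OF s(1)] fin nonneg[of s] offdiag s(1)
      by (intro sum_pos2[of _ i]) auto
    then have "0 < exp (- G j j * s) * (\<Sum>l\<in>S - {j}. G j l * y l s)" by simp
    then show "\<exists>y'. ((\<lambda>s. exp (- G j j * s) * y j s) has_real_derivative y') (at s) \<and> 0 < y'"
      using scaled_derivative[OF ij(2), of s] s(1) by force
  next
    show "continuous_on {0..t} (\<lambda>s. exp (- G j j * s) * y j s)"
      using scaled_derivative[OF ij(2)] by (intro DERIV_continuous_on) (auto intro: DERIV_subset)
  qed
  then have "0 < exp (- G j j * t) * y j t" using init[OF ij(2)] by simp
  then show ?thesis by (simp add: zero_less_mult_iff)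
qed

text \<open>A step from \<open>i\<close> to \<open>j\<close> means that \<open>y i\<close> feeds the
  derivative of \<open>y j\<close>, hence the order of indices in \<open>G j i\<close>. Each step
  carries positivity at all positive times, so the length of the path costs no time.\<close>

lemma pos_of_reachable:
  assumes "(i, j) \<in> {(i, j). i \<in> S \<and> j \<in> S \<and> i \<noteq> j \<and> 0 < G j i}\<^sup>*"
    and i: "i \<in> S" "0 < y i 0"
  shows "0 < t \<Longrightarrow> 0 < y j t"
  using assms(1)
proof (induction arbitrary: t)
  case base
  then show ?case using pos_of_pos[OF i] by simp
next
  case (step j l)
  then show ?case using pos_step[of j l t] by auto
qed

end

section \<open>Adjoints and entrywise derivatives\<close>

lemma mat_adjoint_dim [simp]:
  "dim_row (mat_adjoint A) = dim_col A" "dim_col (mat_adjoint A) = dim_row A"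
  by (auto simp: mat_adjoint_def mat_of_rows_def)

lemma mat_adjoint_carrier [simp]: "A \<in> carrier_mat n m \<Longrightarrow> mat_adjoint A \<in> carrier_mat m n"
  by (intro carrier_matI) auto

lemma mat_adjoint_index [simp]:
  fixes A :: "complex mat"
  shows "i < dim_col A \<Longrightarrow> j < dim_row A \<Longrightarrow> mat_adjoint A $$ (i, j) = cnj (A $$ (j, i))"
  by (auto simp: mat_adjoint_def mat_of_rows_index)

lemma mat_mult_entry:
  "A \<in> carrier_mat n m \<Longrightarrow> B \<in> carrier_mat m l \<Longrightarrow> i < n \<Longrightarrow> j < l \<Longrightarrow>
    (A * B) $$ (i, j) = (\<Sum>c<m. A $$ (i, c) * B $$ (c, j))"
  by (simp add: scalar_prod_def atLeast0LessThan)

lemma mat_adjoint_adjoint [simp]: "mat_adjoint (mat_adjoint A) = (A :: complex mat)"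
  by (rule eq_matI) auto

lemma mat_adjoint_mult:
  fixes A :: "complex mat"
  assumes A: "A \<in> carrier_mat n m" and B: "B \<in> carrier_mat m l"
  shows "mat_adjoint (A * B) = mat_adjoint B * mat_adjoint A"
proof (rule eq_matI)
  fix i j assume "i < dim_row (mat_adjoint B * mat_adjoint A)" "j < dim_col (mat_adjoint B *
    mat_adjoint A)"
  then have ij: "i < l" "j < n" using A B by auto
  have "mat_adjoint (A * B) $$ (i, j) = cnj ((A * B) $$ (j, i))" using ij A B by simp
  then show "mat_adjoint (A * B) $$ (i, j) = (mat_adjoint B * mat_adjoint A) $$ (i, j)"
    using ij A B
    by (simp add: mat_mult_entry[OF A B] mat_mult_entry[of "mat_adjoint B" l m "mat_adjoint A" n]
      mult.commute del: index_mult_mat(1))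
qed (use A B in auto)

lemma mat_adjoint_add:
  "dim_row A = dim_row B \<Longrightarrow> dim_col A = dim_col B \<Longrightarrow>
    mat_adjoint (A + B :: complex mat) = mat_adjoint A + mat_adjoint B"
  by (rule eq_matI) auto

lemma mat_adjoint_minus:
  "dim_row A = dim_row B \<Longrightarrow> dim_col A = dim_col B \<Longrightarrow>
    mat_adjoint (A - B :: complex mat) = mat_adjoint A - mat_adjoint B"
  by (rule eq_matI) auto

lemma mat_adjoint_smult: "mat_adjoint (c \<cdot>\<^sub>m A :: complex mat) = cnj c \<cdot>\<^sub>m mat_adjoint A"
  by (rule eq_matI) auto

lemma mat_adjoint_mat_diag:
  "mat_adjoint (mat_diag n f) = mat_diag n (\<lambda>i. cnj (f i) :: complex)"
  by (rule eq_matI) (auto simp: mat_diag_def)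

lemma mat_adjoint_one [simp]: "mat_adjoint (1\<^sub>m n :: complex mat) = 1\<^sub>m n"
  by (rule eq_matI) auto

lemma has_mat_derivativeD:
  "has_mat_derivative n X D t \<Longrightarrow> i < n \<Longrightarrow> j < n \<Longrightarrow>
    ((\<lambda>s. X s $$ (i, j)) has_vector_derivative D $$ (i, j)) (at t)"
  by (simp add: has_mat_derivative_def)

lemma has_mat_derivative_mult:
  assumes X: "\<And>s. X s \<in> carrier_mat n n" "X' \<in> carrier_mat n n" "has_mat_derivative n X X' t"
    and Y: "\<And>s. Y s \<in> carrier_mat n n" "Y' \<in> carrier_mat n n" "has_mat_derivative n Y Y' t"
  shows "has_mat_derivative n (\<lambda>s. X s * Y s) (X' * Y t + X t * Y') t"
  unfolding has_mat_derivative_def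
proof (intro allI impI)
  fix i j assume ij: "i < n" "j < n"
  have "((\<lambda>s. \<Sum>c<n. X s $$ (i, c) * Y s $$ (c, j)) has_vector_derivative
    (\<Sum>c<n. X t $$ (i, c) * Y' $$ (c, j) + X' $$ (i, c) * Y t $$ (c, j))) (at t)"
    using ij by (intro has_vector_derivative_sum has_vector_derivative_mult has_mat_derivativeD[OF
      X(3)] has_mat_derivativeD[OF Y(3)]) auto
  moreover have "(X' * Y t + X t * Y') $$ (i, j) = (X' * Y t) $$ (i, j) + (X t * Y') $$ (i, j)"
    using ij X(1)[of t] Y(2) by (intro index_add_mat) auto
  ultimately show "((\<lambda>s. (X s * Y s) $$ (i, j)) has_vector_derivative (X' * Y t + X t * Y') $$ (i,
    j)) (at t)"
    using ij X Y
    by (simp add: mat_mult_entry[OF X(1) Y(1)] mat_mult_entry[OF X(2) Y(1)] mat_mult_entry[OF X(1) Y(2)]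
        sum.distrib add.commute del: index_mult_mat(1))
qed

lemma has_mat_derivative_const: "has_mat_derivative n (\<lambda>s. C) (0\<^sub>m n n) t"
  by (simp add: has_mat_derivative_def)

lemma has_mat_derivative_const_mult:
  assumes "C \<in> carrier_mat n n" "\<And>s. X s \<in> carrier_mat n n" "X' \<in> carrier_mat n n"
    "has_mat_derivative n X X' t"
  shows "has_mat_derivative n (\<lambda>s. C * X s) (C * X') t"
  using has_mat_derivative_mult[of "\<lambda>_. C" n "0\<^sub>m n n" t X X'] assms
  by (simp add: has_mat_derivative_const left_add_zero_mat[of _ n n] left_mult_zero_mat[of _ n n])

lemma has_mat_derivative_mult_const:
  assumes "C \<in> carrier_mat n n" "\<And>s. X s \<in> carrier_mat n n" "X' \<in> carrier_mat n n"
    "has_mat_derivative n X X' t"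
  shows "has_mat_derivative n (\<lambda>s. X s * C) (X' * C) t"
  using has_mat_derivative_mult[of X n X' t "\<lambda>_. C" "0\<^sub>m n n"] assms
  by (simp add: has_mat_derivative_const right_add_zero_mat[of _ n n] right_mult_zero_mat[of _ n n])

lemma has_mat_derivative_add:
  assumes "X' \<in> carrier_mat n n" "has_mat_derivative n X X' t" "\<And>s. X s \<in> carrier_mat n n"
    and "Y' \<in> carrier_mat n n" "has_mat_derivative n Y Y' t" "\<And>s. Y s \<in> carrier_mat n n"
  shows "has_mat_derivative n (\<lambda>s. X s + Y s) (X' + Y') t"
  using assms(1,4) carrier_matD[OF assms(3)] carrier_matD[OF assms(6)]
  unfolding has_mat_derivative_def
  by (auto intro!: has_vector_derivative_add has_mat_derivativeD[OF assms(2)] has_mat_derivativeD[OF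
    assms(5)])

lemma has_mat_derivative_zero_const:
  assumes "\<And>t. has_mat_derivative n X (0\<^sub>m n n) t" "i < n" "j < n"
  shows "X s $$ (i, j) = X t $$ (i, j)"
proof -
  have "((\<lambda>s. Re (X s $$ (i, j))) has_real_derivative 0) (at t)"
       "((\<lambda>s. Im (X s $$ (i, j))) has_real_derivative 0) (at t)" for t
    using has_mat_derivativeD[OF assms(1)[of t] assms(2,3)] assms(2,3)
    by (auto simp: has_vector_derivative_complex_iff o_def)
  then show ?thesis
    by (intro complex_eqI DERIV_isconst_all[where f = "\<lambda>s. Re (X s $$ (i, j))"]
      DERIV_isconst_all[where f = "\<lambda>s. Im (X s $$ (i, j))"]) auto
qed

section \<open>The matrix exponential\<close>

text \<open>The exponential of \<open>t\<close> times \<open>A\<close>, entry by entry as a scalar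
  power series in \<open>t\<close>, so that the theory of power series applies to each
  entry.\<close>

definition mexp :: "complex mat \<Rightarrow> real \<Rightarrow> complex mat" where
  "mexp A t = mat (dim_row A) (dim_row A)
     (\<lambda>(i, j). \<Sum>m. (A ^\<^sub>m m) $$ (i, j) / fact m * complex_of_real t ^ m)"

lemma mexp_dim [simp]: "dim_row (mexp A t) = dim_row A" "dim_col (mexp A t) = dim_row A"
  by (auto simp: mexp_def)

lemma mexp_carrier [simp]: "A \<in> carrier_mat n n \<Longrightarrow> mexp A t \<in> carrier_mat n n"
  by (auto simp: mexp_def)

lemma mexp_entry:
  "A \<in> carrier_mat n n \<Longrightarrow> i < n \<Longrightarrow> j < n \<Longrightarrow>
    mexp A t $$ (i, j) = (\<Sum>m. (A ^\<^sub>m m) $$ (i, j) / fact m * complex_of_real t ^ m)"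
  by (auto simp: mexp_def)

lemma pow_mat_Suc_left:
  assumes "A \<in> carrier_mat n n"
  shows "A ^\<^sub>m Suc m = A * A ^\<^sub>m m"
proof (induction m)
  case (Suc m)
  have "A ^\<^sub>m Suc (Suc m) = (A * A ^\<^sub>m m) * A" using Suc by simp
  also have "\<dots> = A * (A ^\<^sub>m m * A)" using assms by (intro assoc_mult_mat) auto
  finally show ?case by simp
qed (use assms in auto)

lemma pow_mat_entry_bound:
  fixes A :: "complex mat"
  assumes A: "A \<in> carrier_mat n n" and C: "\<And>i j. i < n \<Longrightarrow> j < n \<Longrightarrow> cmod (A $$ (i, j)) \<le> C"
    and ij: "i < n" "j < n"
  shows "cmod ((A ^\<^sub>m m) $$ (i, j)) \<le> (real n * C) ^ m"
  using ij
proof (induction m arbitrary: i j)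
  case 0
  then show ?case using A by auto
next
  case (Suc m)
  have P: "A ^\<^sub>m m \<in> carrier_mat n n" using A by simp
  have C0: "0 \<le> C" using C[OF Suc.prems] norm_ge_zero order_trans by blast
  have "cmod ((A ^\<^sub>m Suc m) $$ (i, j)) = cmod (\<Sum>c<n. (A ^\<^sub>m m) $$ (i, c) * A $$ (c, j))"
    using mat_mult_entry[OF P A Suc.prems] by simp
  also have "\<dots> \<le> (\<Sum>c<n. (real n * C) ^ m * C)"
    using Suc C C0 by (intro order_trans[OF norm_sum] sum_mono) (auto simp: norm_mult intro!: mult_mono)
  also have "\<dots> = (real n * C) ^ Suc m" by simp
  finally show ?case .
qed

text \<open>The entries of \<open>A ^\<^sub>m m\<close> grow at most geometrically, so an
  exponential series dominates. The point \<open>z\<close> is complex because termwise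
  differentiation takes place in the complex plane.\<close>

lemma mexp_summable:
  fixes A :: "complex mat"
  assumes A: "A \<in> carrier_mat n n" and ij: "i < n" "j < n"
  shows "summable (\<lambda>m. (A ^\<^sub>m m) $$ (i, j) / fact m * z ^ m)"
proof -
  define C where "C = (\<Sum>i<n. \<Sum>j<n. cmod (A $$ (i, j) :: complex))"
  have C: "cmod (A $$ (i, j)) \<le> C" if "i < n" "j < n" for i j
  proof -
    have "cmod (A $$ (i, j)) \<le> (\<Sum>j<n. cmod (A $$ (i, j)))" using that by (intro member_le_sum) auto
    also have "\<dots> \<le> C" unfolding C_def using that
      by (intro member_le_sum[of i "{..<n}" "\<lambda>i. \<Sum>j<n. cmod (A $$ (i, j))"]) (auto intro: sum_nonneg)
    finally show ?thesis .
  qed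
  show ?thesis
  proof (rule summable_comparison_test'[where g = "\<lambda>m. inverse (fact m) * (real n * C * cmod z) ^ m"
    and N = 0])
    show "summable (\<lambda>m. inverse (fact m) * (real n * C * cmod z) ^ m)"
      by (rule summable_exp)
    fix m
    have "cmod ((A ^\<^sub>m m) $$ (i, j) / fact m * z ^ m) = cmod ((A ^\<^sub>m m) $$ (i, j)) / fact m * cmod z
      ^ m"
      by (simp add: norm_mult norm_divide norm_power)
    also have "\<dots> \<le> (real n * C) ^ m / fact m * cmod z ^ m"
      using pow_mat_entry_bound[OF A C ij, of m] by (simp add: mult_right_mono divide_right_mono)
    also have "\<dots> = inverse (fact m) * (real n * C * cmod z) ^ m"
      by (simp only: power_mult_distrib divide_inverse mult_ac)
    finally show "norm ((A ^\<^sub>m m) $$ (i, j) / fact m * z ^ m) \<le> inverse (fact m) * (real n * C *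
      cmod z) ^ m" .
  qed
qed

lemma suminf_sum_mult:
  fixes a :: "'i \<Rightarrow> complex"
  assumes "\<And>l. l \<in> S \<Longrightarrow> summable (b l)"
  shows "(\<Sum>m. \<Sum>l\<in>S. a l * b l m) = (\<Sum>l\<in>S. a l * suminf (b l))"
proof -
  have "(\<Sum>m. \<Sum>l\<in>S. a l * b l m) = (\<Sum>l\<in>S. \<Sum>m. a l * b l m)"
    by (intro suminf_sum summable_mult assms)
  also have "\<dots> = (\<Sum>l\<in>S. a l * suminf (b l))"
    by (intro sum.cong refl suminf_mult assms)
  finally show ?thesis .
qed

text \<open>Multiplication by \<open>A\<close> from either side shifts the coefficients by one
  power. The resulting series is also the termwise derivative, and its equality for both sides shows
  that the exponential commutes with \<open>A\<close>.\<close>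

lemma mexp_mult_left:
  assumes A: "A \<in> carrier_mat n n" and ij: "i < n" "j < n"
  shows "(A * mexp A t) $$ (i, j) = (\<Sum>m. (A ^\<^sub>m Suc m) $$ (i, j) / fact m * complex_of_real t ^ m)"
proof -
  have P: "A ^\<^sub>m m \<in> carrier_mat n n" for m using A by simp
  have "(A ^\<^sub>m Suc m) $$ (i, j) / fact m * complex_of_real t ^ m =
      (\<Sum>c<n. A $$ (i, c) * ((A ^\<^sub>m m) $$ (c, j) / fact m * complex_of_real t ^ m))" for m
    unfolding pow_mat_Suc_left[OF A] mat_mult_entry[OF A P ij] sum_divide_distrib sum_distrib_right
    by (intro sum.cong) auto
  then have "(\<Sum>m. (A ^\<^sub>m Suc m) $$ (i, j) / fact m * complex_of_real t ^ m) =
      (\<Sum>m. \<Sum>c<n. A $$ (i, c) * ((A ^\<^sub>m m) $$ (c, j) / fact m * complex_of_real t ^ m))"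
    by (rule suminf_cong)
  also have "\<dots> = (\<Sum>c<n. A $$ (i, c) * (\<Sum>m. (A ^\<^sub>m m) $$ (c, j) / fact m * complex_of_real t ^ m))"
    using ij by (intro suminf_sum_mult mexp_summable[OF A]) auto
  also have "\<dots> = (A * mexp A t) $$ (i, j)"
    unfolding mat_mult_entry[OF A mexp_carrier[OF A] ij]
    using ij A by (intro sum.cong) (auto simp: mexp_entry)
  finally show ?thesis by simp
qed

lemma mexp_mult_right:
  assumes A: "A \<in> carrier_mat n n" and ij: "i < n" "j < n"
  shows "(mexp A t * A) $$ (i, j) = (\<Sum>m. (A ^\<^sub>m Suc m) $$ (i, j) / fact m * complex_of_real t ^ m)"
proof -
  have P: "A ^\<^sub>m m \<in> carrier_mat n n" for m using A by simp
  have "(A ^\<^sub>m Suc m) $$ (i, j) / fact m * complex_of_real t ^ m =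
      (\<Sum>c<n. A $$ (c, j) * ((A ^\<^sub>m m) $$ (i, c) / fact m * complex_of_real t ^ m))" for m
    unfolding pow_mat.simps mat_mult_entry[OF P A ij] sum_divide_distrib sum_distrib_right
    by (intro sum.cong) auto
  then have "(\<Sum>m. (A ^\<^sub>m Suc m) $$ (i, j) / fact m * complex_of_real t ^ m) =
      (\<Sum>m. \<Sum>c<n. A $$ (c, j) * ((A ^\<^sub>m m) $$ (i, c) / fact m * complex_of_real t ^ m))"
    by (rule suminf_cong)
  also have "\<dots> = (\<Sum>c<n. A $$ (c, j) * (\<Sum>m. (A ^\<^sub>m m) $$ (i, c) / fact m * complex_of_real t ^ m))"
    using ij by (intro suminf_sum_mult mexp_summable[OF A]) auto
  also have "\<dots> = (mexp A t * A) $$ (i, j)"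
    unfolding mat_mult_entry[OF mexp_carrier[OF A] A ij]
    using ij A by (intro sum.cong) (auto simp: mexp_entry)
  finally show ?thesis by simp
qed

lemma mexp_commute:
  assumes A: "A \<in> carrier_mat n n"
  shows "mexp A t * A = A * mexp A t"
  using A mexp_mult_left[OF A] mexp_mult_right[OF A]
  by (intro eq_matI) (auto simp del: index_mult_mat(1))

lemma mexp_derivative:
  assumes A: "A \<in> carrier_mat n n"
  shows "has_mat_derivative n (mexp A) (A * mexp A t) t"
  unfolding has_mat_derivative_def
proof (intro allI impI)
  fix i j assume ij: "i < n" "j < n"
  define c where "c m = (A ^\<^sub>m m) $$ (i, j) / fact m" for m
  have "((\<lambda>z. \<Sum>m. c m * z ^ m) has_field_derivative (\<Sum>m. diffs c m * complex_of_real t ^ m)) (at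
    (complex_of_real t))"
    unfolding c_def by (rule termdiffs_strong_converges_everywhere) (rule mexp_summable[OF A ij])
  moreover have "diffs c m = (A ^\<^sub>m Suc m) $$ (i, j) / fact m" for m
    by (simp add: diffs_def c_def divide_simps del: pow_mat.simps of_nat_Suc)
  ultimately have "((\<lambda>s. \<Sum>m. c m * complex_of_real s ^ m) has_vector_derivative (A * mexp A t) $$
    (i, j)) (at t)"
    using has_vector_derivative_real_field[of "\<lambda>z. \<Sum>m. c m * z ^ m"]
    by (simp add: mexp_mult_left[OF A ij] del: index_mult_mat(1) pow_mat.simps)
  then show "((\<lambda>s. mexp A s $$ (i, j)) has_vector_derivative (A * mexp A t) $$ (i, j)) (at t)"
    using ij A by (simp add: mexp_entry c_def del: index_mult_mat(1))
qed

lemma mexp_zero: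
  assumes A: "A \<in> carrier_mat n n"
  shows "mexp A 0 = 1\<^sub>m n"
proof (rule eq_matI)
  fix i j assume ij: "i < dim_row (1\<^sub>m n)" "j < dim_col (1\<^sub>m n)"
  have "mexp A 0 $$ (i, j) = (\<Sum>m. (A ^\<^sub>m m) $$ (i, j) / fact m * 0 ^ m)" using ij A by (simp add:
    mexp_entry)
  also have "\<dots> = (A ^\<^sub>m 0) $$ (i, j) / fact 0" by (rule powser_zero)
  finally show "mexp A 0 $$ (i, j) = 1\<^sub>m n $$ (i, j)" using A by simp
qed (use mexp_carrier[OF A, of 0] in auto)

text \<open>Makes the adjoint of the moving frame \<open>mexp A t * g\<close> equal to
  \<open>mat_adjoint g * mexp A t\<close>, which can be differentiated like the frame
  itself.\<close>

lemma mexp_hermitian: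
  assumes A: "A \<in> carrier_mat n n" and H: "mat_adjoint A = A"
  shows "mat_adjoint (mexp A t) = mexp A t"
proof (rule eq_matI)
  have P: "A ^\<^sub>m m \<in> carrier_mat n n" for m using A by simp
  have pow: "mat_adjoint (A ^\<^sub>m m) = A ^\<^sub>m m" for m
  proof (induction m)
    case (Suc m)
    have "mat_adjoint (A ^\<^sub>m Suc m) = mat_adjoint A * mat_adjoint (A ^\<^sub>m m)"
      using mat_adjoint_mult[OF P A, of m] by simp
    then show ?case using Suc H pow_mat_Suc_left[OF A, of m] by simp
  qed (use A in auto)
  fix i j assume "i < dim_row (mexp A t)" "j < dim_col (mexp A t)"
  then have ij: "i < n" "j < n" using mexp_carrier[OF A, of t] by auto
  have "mat_adjoint (mexp A t) $$ (i, j) = cnj (\<Sum>m. (A ^\<^sub>m m) $$ (j, i) / fact m * complex_of_real t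
    ^ m)"
    using ij A by (simp add: mexp_entry)
  also have "\<dots> = (\<Sum>m. cnj ((A ^\<^sub>m m) $$ (j, i) / fact m * complex_of_real t ^ m))"
    using bounded_linear.suminf[OF bounded_linear_cnj mexp_summable[OF A ij(2,1)]] by simp
  also have "\<dots> = (\<Sum>m. (A ^\<^sub>m m) $$ (i, j) / fact m * complex_of_real t ^ m)"
  proof (rule suminf_cong)
    fix m
    have "cnj ((A ^\<^sub>m m) $$ (j, i)) = (A ^\<^sub>m m) $$ (i, j)"
      using mat_adjoint_index[of i "A ^\<^sub>m m" j] ij carrier_matD[OF P[of m]] pow[of m] by simp
    then show "cnj ((A ^\<^sub>m m) $$ (j, i) / fact m * complex_of_real t ^ m) = (A ^\<^sub>m m) $$ (i, j) /
      fact m * complex_of_real t ^ m"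
      by simp
  qed
  finally show "mat_adjoint (mexp A t) $$ (i, j) = mexp A t $$ (i, j)" using ij A by (simp add:
    mexp_entry)
qed (use mexp_carrier[OF A, of t] in auto)

text \<open>The product is constant in time: its derivative is
  \<open>- A * E * F + E * A * F\<close> with \<open>E = mexp A (- s)\<close> and
  \<open>F = mexp A s\<close>, which vanishes because \<open>E\<close> commutes with
  \<open>A\<close>.\<close>

lemma mexp_minus_mult:
  assumes A: "A \<in> carrier_mat n n"
  shows "mexp A (- t) * mexp A t = 1\<^sub>m n"
proof (rule eq_matI)
  let ?F = "\<lambda>s. mexp A (- s) * mexp A s"
  note E = mexp_carrier[OF A]
  have "has_mat_derivative n ?F (0\<^sub>m n n) s" for s
  proof -
    have d1: "has_mat_derivative n (\<lambda>s. mexp A (- s)) (- (A * mexp A (- s))) s"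
      unfolding has_mat_derivative_def
    proof (intro allI impI)
      fix i j assume ij: "i < n" "j < n"
      have "((\<lambda>s. mexp A (- s) $$ (i, j)) has_vector_derivative (-1) *\<^sub>R (A * mexp A (- s)) $$ (i,
        j)) (at s)"
        using vector_diff_chain_at[of uminus "-1" s "\<lambda>s. mexp A s $$ (i, j)", OF _
          has_mat_derivativeD[OF mexp_derivative[OF A] ij]]
          has_vector_derivative_minus[OF has_vector_derivative_id[of "at s"]]
        by (simp add: o_def del: index_mult_mat(1))
      then show "((\<lambda>s. mexp A (- s) $$ (i, j)) has_vector_derivative (- (A * mexp A (- s))) $$ (i,
        j)) (at s)"
        using ij A by (simp del: index_mult_mat(1))
    qed
    have "has_mat_derivative n ?F (- (A * mexp A (- s)) * mexp A s + mexp A (- s) * (A * mexp A s)) s"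
      by (rule has_mat_derivative_mult[OF E _ d1 E _ mexp_derivative[OF A]]) (use A E in auto)
    also have "- (A * mexp A (- s)) * mexp A s + mexp A (- s) * (A * mexp A s) = 0\<^sub>m n n"
    proof -
      have "mexp A (- s) * (A * mexp A s) = (A * mexp A (- s)) * mexp A s"
        using assoc_mult_mat[OF E A E, of "- s" s] mexp_commute[OF A, of "- s"] by simp
      moreover have "- (A * mexp A (- s)) * mexp A s = - ((A * mexp A (- s)) * mexp A s)"
        by (rule uminus_mult_left_mat) (use A in auto)
      have "- X + X = 0\<^sub>m n n" if "X \<in> carrier_mat n n" for X :: "complex mat"
        using that by (intro eq_matI) auto
      then have "- (A * mexp A (- s) * mexp A s) + A * mexp A (- s) * mexp A s = 0\<^sub>m n n"
        using mult_carrier_mat[OF mult_carrier_mat[OF A E] E] by simp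
      ultimately show ?thesis by simp
    qed
    finally show ?thesis .
  qed
  then have "?F t $$ (i, j) = ?F 0 $$ (i, j)" if "i < n" "j < n" for i j
    using has_mat_derivative_zero_const[of n ?F i j t 0] that by blast
  moreover have "?F 0 = 1\<^sub>m n" using mexp_zero[OF A] by simp
  ultimately show "\<And>i j. i < dim_row (1\<^sub>m n) \<Longrightarrow> j < dim_col (1\<^sub>m n) \<Longrightarrow> ?F t $$ (i, j) = 1\<^sub>m n $$ (i, j)"
    by simp
qed (use A in auto)

section \<open>Derivative of the inverse\<close>

text \<open>A determinant is a polynomial in its entries. Existence of the derivative is all that
  the next lemma asks for, since there the value follows from an identity.\<close>

lemma det_differentiable:
  assumes "\<And>i j. i < m \<Longrightarrow> j < m \<Longrightarrow> \<exists>d. ((\<lambda>s. f s i j) has_vector_derivative d) (at t)"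
  shows "\<exists>d::complex. ((\<lambda>s. det (mat m m (\<lambda>(i, j). f s i j))) has_vector_derivative d) (at t)"
proof -
  obtain f' where f': "\<And>i j. i < m \<Longrightarrow> j < m \<Longrightarrow> ((\<lambda>s. f s i j) has_vector_derivative f' i j) (at t)"
    using assms by metis
  have prod: "\<exists>d. ((\<lambda>s. \<Prod>i\<in>T. f s i (p i)) has_vector_derivative d) (at t)"
    if "T \<subseteq> {0..<m}" "p permutes {0..<m}" for T p
  proof -
    have "finite T" using that finite_subset by blast
    then show ?thesis using that(1)
    proof induction
      case empty
      then show ?case by (auto intro: exI[of _ 0])
    next
      case (insert a T)
      then obtain d where "((\<lambda>s. \<Prod>i\<in>T. f s i (p i)) has_vector_derivative d) (at t)" by auto
      moreover have "a < m" using insert by auto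
      moreover from this have "p a < m" using that(2) permutes_in_image[of p "{0..<m}" a] by simp
      ultimately show ?case using insert has_vector_derivative_mult[OF f'] by fastforce
    qed
  qed
  then obtain d where d: "\<And>p. p permutes {0..<m} \<Longrightarrow> ((\<lambda>s. \<Prod>i\<in>{0..<m}. f s i (p i))
    has_vector_derivative d p) (at t)"
    by (metis subset_refl)
  have det: "det (mat m m (\<lambda>(i, j). f s i j)) = (\<Sum>p | p permutes {0..<m}. signof p * (\<Prod>i\<in>{0..<m}. f
    s i (p i)))" for s
    by (subst det_def'[of _ m]) (auto intro!: sum.cong prod.cong simp: permutes_in_image[of _
      "{0..<m}", simplified])
  show ?thesis unfolding det
    by (intro exI[of _ "\<Sum>p | p permutes {0..<m}. signof p * d p"] has_vector_derivative_sum
      has_vector_derivative_mult_right d) simp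
qed

text \<open>Cramer's rule writes each entry of the inverse as a quotient of determinants, which
  gives differentiability. Differentiating \<open>W s * M s = 1\<^sub>m n\<close> then determines
  the derivative.\<close>

lemma inverse_mat_derivative:
  assumes M: "\<And>s. M s \<in> carrier_mat n n" "M' \<in> carrier_mat n n" "has_mat_derivative n M M' t"
    and W: "\<And>s. W s \<in> carrier_mat n n" "\<And>s. W s * M s = 1\<^sub>m n" "\<And>s. M s * W s = 1\<^sub>m n"
  shows "has_mat_derivative n W (- (W t * M' * W t)) t"
proof -
  have det: "det (M s) \<noteq> 0" for s
    using det_mult[OF W(1) M(1), of s s] W(2)[of s] by auto
  have W_eq: "W s $$ (i, j) = cofactor (M s) j i / det (M s)" if ij: "i < n" "j < n" for s i j
  proof -
    have "adj_mat (M s) = (adj_mat (M s) * M s) * W s"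
      using adj_mat(1)[OF M(1)] M(1) W(1) W(3)[of s] by (simp add: assoc_mult_mat[of _ n n _ n _ n]
        right_mult_one_mat[of _ n n])
    also have "\<dots> = det (M s) \<cdot>\<^sub>m W s"
      using adj_mat(3)[OF M(1)] W(1)[of s] by (simp add: mult_smult_assoc_mat[of _ n n _ n]
        left_mult_one_mat[of _ n n])
    finally have "adj_mat (M s) $$ (i, j) = det (M s) * W s $$ (i, j)"
      using ij W(1)[of s] by simp
    then show ?thesis using ij M(1)[of s] det[of s] by (simp add: adj_mat_def field_simps)
  qed
  have dM: "\<exists>d. ((\<lambda>s. M s $$ (i, j)) has_vector_derivative d) (at t)" if "i < n" "j < n" for i j
    using has_mat_derivativeD[OF M(3) that] by blast
  have "\<exists>d. ((\<lambda>s. W s $$ (i, j)) has_vector_derivative d) (at t)" if ij: "i < n" "j < n" for i j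
  proof -
    have eq1: "det (M s) = det (mat n n (\<lambda>(i, j). M s $$ (i, j)))" for s
      using M(1)[of s] by (intro arg_cong[where f = det] eq_matI) auto
    have "\<exists>d. ((\<lambda>s. det (M s)) has_vector_derivative d) (at t)"
      unfolding eq1 by (rule det_differentiable) (rule dM)
    then obtain d1 where d1: "((\<lambda>s. det (M s)) has_vector_derivative d1) (at t)" by blast
    have eq2: "mat_delete (M s) j i = mat (n - 1) (n - 1)
        (\<lambda>(a, b). M s $$ (if a < j then a else Suc a, if b < i then b else Suc b))" for s
      using M(1)[of s] by (simp add: mat_delete_def)
    have "\<exists>d. ((\<lambda>s. det (mat_delete (M s) j i)) has_vector_derivative d) (at t)"
      unfolding eq2 by (rule det_differentiable) (auto intro!: dM)
    then obtain d2 where d2: "((\<lambda>s. det (mat_delete (M s) j i)) has_vector_derivative d2) (at t)" by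
      blast
    have "(\<lambda>s. (-1) ^ (j + i) * (det (mat_delete (M s) j i) * inverse (det (M s)))) differentiable
      (at t)"
      using differentiableI_vector[OF d1] differentiableI_vector[OF d2] det
      by (intro differentiable_mult differentiable_inverse differentiable_const) auto
    then have "\<exists>d. ((\<lambda>s. (-1) ^ (j + i) * (det (mat_delete (M s) j i) * inverse (det (M s))))
      has_vector_derivative d) (at t)"
      by (blast dest: vector_derivative_works[THEN iffD1])
    then show ?thesis using ij by (simp add: W_eq cofactor_def divide_inverse mult.assoc)
  qed
  then obtain D where D: "\<And>i j. i < n \<Longrightarrow> j < n \<Longrightarrow> ((\<lambda>s. W s $$ (i, j)) has_vector_derivative D i j)
    (at t)"
    by metis
  define W' where "W' = mat n n (\<lambda>(i, j). D i j)"
  have W': "W' \<in> carrier_mat n n" "has_mat_derivative n W W' t"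
    using D by (auto simp: W'_def has_mat_derivative_def)
  have "has_mat_derivative n (\<lambda>s. W s * M s) (W' * M t + W t * M') t"
    by (rule has_mat_derivative_mult[OF W(1) W' M])
  then have "(W' * M t + W t * M') $$ (i, j) = 0" if "i < n" "j < n" for i j
    unfolding W(2)
    using vector_derivative_unique_at[OF has_mat_derivativeD has_vector_derivative_const] that by blast
  then have "W' * M t + W t * M' = 0\<^sub>m n n"
    using W'(1) W(1)[of t] M(1)[of t] M(2) by (intro eq_matI) (auto simp del: index_add_mat(1))
  then have "(W' * M t + W t * M') * W t = 0\<^sub>m n n" using W(1) by (simp add: left_mult_zero_mat[of _
    n n])
  moreover have "(W' * M t + W t * M') * W t = W' + W t * M' * W t"
    using W' W(1)[of t] M(1)[of t] M(2) W(3)[of t]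
    by (simp add: add_mult_distrib_mat[of _ n n _ _ n] assoc_mult_mat[of _ n n _ n _ n]
      right_mult_one_mat[of _ n n])
  ultimately have e: "W' + W t * M' * W t = 0\<^sub>m n n" by simp
  have "W' = - (W t * M' * W t)"
  proof (rule eq_matI)
    fix i j assume "i < dim_row (- (W t * M' * W t))" "j < dim_col (- (W t * M' * W t))"
    then have ij: "i < n" "j < n" using W(1)[of t] by auto
    have "(W' + W t * M' * W t) $$ (i, j) = 0" using e ij by simp
    then show "W' $$ (i, j) = (- (W t * M' * W t)) $$ (i, j)"
      using ij W(1)[of t] W'(1) M(2) by (simp add: add_eq_0_iff del: index_mult_mat(1))
  qed (use W(1)[of t] W'(1) in auto)
  then show ?thesis using W'(2) by simp
qed

section \<open>Unitary matrices and projections\<close>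

text \<open>With \<open>n\<close> fixed, the laws of matrix algebra are instantiated to square
  matrices, so that simplification discharges their dimension conditions. Identities are expanded by
  \<open>sq_simps\<close> and then compared entry by entry.\<close>

locale square_matrices = fixes n :: nat
begin

lemma sq_closed [simp]:
  "A \<in> carrier_mat n n \<Longrightarrow> B \<in> carrier_mat n n \<Longrightarrow> A * B \<in> carrier_mat n n"
  "A \<in> carrier_mat n n \<Longrightarrow> B \<in> carrier_mat n n \<Longrightarrow> A - B \<in> carrier_mat n n"
  by auto

lemmas sq_simps =
  assoc_mult_mat[of _ n n _ n _ n]
  add_mult_distrib_mat[of _ n n _ _ n] mult_add_distrib_mat[of _ n n _ n _]
  minus_mult_distrib_mat[of _ n n _ _ n] mult_minus_distrib_mat[of _ n n _ n _]
  mult_smult_assoc_mat[of _ n n _ n] mult_smult_distrib[of _ n n _ n]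
  left_mult_one_mat[of _ n n] right_mult_one_mat[of _ n n]

lemma sq_eqI:
  assumes "A \<in> carrier_mat n n" "B \<in> carrier_mat n n"
    and "\<And>i j. i < n \<Longrightarrow> j < n \<Longrightarrow> A $$ (i, j) = B $$ (i, j)"
  shows "A = B"
  using assms by (intro eq_matI) auto

lemma sq_index:
  "A \<in> carrier_mat n n \<Longrightarrow> B \<in> carrier_mat n n \<Longrightarrow> i < n \<Longrightarrow> j < n \<Longrightarrow> (A + B) $$ (i, j) = A $$ (i, j) + B
    $$ (i, j)"
  "A \<in> carrier_mat n n \<Longrightarrow> B \<in> carrier_mat n n \<Longrightarrow> i < n \<Longrightarrow> j < n \<Longrightarrow> (A - B) $$ (i, j) = A $$ (i, j) - B
    $$ (i, j)"
  "A \<in> carrier_mat n n \<Longrightarrow> i < n \<Longrightarrow> j < n \<Longrightarrow> (c \<cdot>\<^sub>m A) $$ (i, j) = c * A $$ (i, j)"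
  "A \<in> carrier_mat n n \<Longrightarrow> i < n \<Longrightarrow> j < n \<Longrightarrow> (- A) $$ (i, j) = - A $$ (i, j)"
  by auto

end

lemma unitary_groupD:
  assumes "g \<in> unitary_group n"
  shows "g \<in> carrier_mat n n" "g * mat_adjoint g = 1\<^sub>m n" "mat_adjoint g * g = 1\<^sub>m n"
  using assms by (auto simp: unitary_group_def)

lemma unitary_groupI:
  assumes "g \<in> carrier_mat n n" "mat_adjoint g * g = 1\<^sub>m n"
  shows "g \<in> unitary_group n"
  using assms mat_mult_left_right_inverse[of "mat_adjoint g" n g] by (auto simp: unitary_group_def)

lemma unitary_group_mult:
  assumes g: "g \<in> unitary_group n" and h: "h \<in> unitary_group n"
  shows "g * h \<in> unitary_group n"
proof -
  interpret square_matrices n .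
  note [simp] = unitary_groupD(1)[OF g] unitary_groupD(1)[OF h]
  show ?thesis
  proof (rule unitary_groupI)
    have "mat_adjoint g * (g * h) = h"
      using assoc_mult_mat[of "mat_adjoint g" n n g n h n] unitary_groupD(3)[OF g] by (simp add:
        sq_simps(8))
    then show "mat_adjoint (g * h) * (g * h) = 1\<^sub>m n"
      using unitary_groupD(3)[OF h] by (simp add: mat_adjoint_mult[of _ n n _ n] sq_simps)
  qed simp
qed

text \<open>Multiplication by it from the right keeps the first \<open>k\<close> columns and clears
  the others. The frame of \<open>k\<close> columns is thus represented by the square matrix
  \<open>g * kproj n k\<close>, and no rectangular matrices occur.\<close>

definition kproj :: "nat \<Rightarrow> nat \<Rightarrow> complex mat" where
  "kproj n k = mat_diag n (\<lambda>i. if i < k then 1 else 0)"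

definition subspace_proj :: "nat \<Rightarrow> nat \<Rightarrow> complex mat \<Rightarrow> complex mat" where
  "subspace_proj n k g = g * kproj n k * mat_adjoint g"

lemma kproj_simps [simp]:
  "kproj n k \<in> carrier_mat n n" "mat_adjoint (kproj n k) = kproj n k" "kproj n k * kproj n k = kproj
    n k"
  by (auto simp: kproj_def mat_adjoint_mat_diag if_distrib cong: if_cong)

lemma kproj_mult_left: "X \<in> carrier_mat n n \<Longrightarrow> kproj n k * (kproj n k * X) = kproj n k * X"
  by (simp add: assoc_mult_mat[of _ n n _ n _ n, symmetric])

lemma mult_kproj_index:
  "M \<in> carrier_mat n n \<Longrightarrow> i < n \<Longrightarrow> j < n \<Longrightarrow> (M * kproj n k) $$ (i, j) = (if j < k then M $$ (i, j) else 0)"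
  by (simp add: kproj_def mat_diag_mult_right[of _ n])

lemma kproj_mult_index:
  "M \<in> carrier_mat n n \<Longrightarrow> i < n \<Longrightarrow> j < n \<Longrightarrow> (kproj n k * M) $$ (i, j) = (if i < k then M $$ (i, j) else 0)"
  by (simp add: kproj_def mat_diag_mult_left[of _ n])

lemma subspace_proj_entry:
  assumes g: "g \<in> carrier_mat n n" and k: "k \<le> n" and ij: "i < n" "j < n"
  shows "subspace_proj n k g $$ (i, j) = (\<Sum>l<k. g $$ (i, l) * cnj (g $$ (j, l)))"
proof -
  have "subspace_proj n k g $$ (i, j) = (\<Sum>l<n. (if l < k then g $$ (i, l) else 0) * cnj (g $$ (j, l)))"
    unfolding subspace_proj_def using g ij
    by (subst mat_mult_entry[of _ n n _ n]) (auto simp: mult_kproj_index simp del: index_mult_mat(1)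
      intro!: sum.cong)
  also have "\<dots> = (\<Sum>l<k. g $$ (i, l) * cnj (g $$ (j, l)))"
    using k by (intro sum.mono_neutral_cong_right) auto
  finally show ?thesis .
qed

lemma subspace_proj_facts:
  assumes g: "g \<in> unitary_group n"
  shows "subspace_proj n k g \<in> carrier_mat n n"
    "mat_adjoint (subspace_proj n k g) = subspace_proj n k g"
    "subspace_proj n k g * subspace_proj n k g = subspace_proj n k g"
    "subspace_proj n k g * (g * kproj n k) = g * kproj n k"
proof -
  interpret square_matrices n .
  note g' [simp] = unitary_groupD(1)[OF g]
  show "subspace_proj n k g \<in> carrier_mat n n" by (simp add: subspace_proj_def)
  show "mat_adjoint (subspace_proj n k g) = subspace_proj n k g"
    by (simp add: subspace_proj_def mat_adjoint_mult[of _ n n _ n] sq_simps)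
  have gg: "mat_adjoint g * (g * X) = X" if "X \<in> carrier_mat n n" for X
    using that assoc_mult_mat[of "mat_adjoint g" n n g n X n] unitary_groupD(3)[OF g] by (simp add:
      sq_simps(8))
  show *: "subspace_proj n k g * (g * kproj n k) = g * kproj n k"
    by (simp add: subspace_proj_def sq_simps gg)
  show "subspace_proj n k g * subspace_proj n k g = subspace_proj n k g"
    by (simp add: subspace_proj_def sq_simps gg kproj_mult_left)
qed

section \<open>Multiplicativity of left-justified minors\<close>

lemma plucker_eq_det:
  assumes "finite I"
  shows "plucker M I = det (mat (card I) (card I) (\<lambda>(a, b). M $$ (slist I ! a, b)))"
  using assms by (simp add: plucker_def row_minor_def)

lemma slist_nth_less: "I \<subseteq> {0..<n} \<Longrightarrow> a < card I \<Longrightarrow> slist I ! a < n"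
  using nth_mem[of a "slist I"] finite_subset[of I "{0..<n}"] by auto

text \<open>Under \<open>block\<close> the first \<open>m\<close> columns of \<open>M * C\<close>
  are combinations of the first \<open>m\<close> columns of \<open>M\<close>, so all minors of size
  \<open>m\<close> are multiplied by the same determinant.\<close>

lemma plucker_mult_block:
  assumes M: "M \<in> carrier_mat n n" and C: "C \<in> carrier_mat n n" and I: "I \<subseteq> {0..<n}" "card I = m"
    and block: "\<And>c b. m \<le> c \<Longrightarrow> c < n \<Longrightarrow> b < m \<Longrightarrow> C $$ (c, b) = 0"
  shows "plucker (M * C) I = plucker M I * det (mat m m (\<lambda>(a, b). C $$ (a, b)))"
proof -
  have fin: "finite I" using I finite_subset by blast
  have m: "m \<le> n" using I card_mono[OF _ I(1)] by simp
  let ?X = "mat m m (\<lambda>(a, b). M $$ (slist I ! a, b))" and ?Y = "mat m m (\<lambda>(a, b). C $$ (a, b))"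
  have "mat m m (\<lambda>(a, b). (M * C) $$ (slist I ! a, b)) = ?X * ?Y"
  proof (rule eq_matI)
    fix a b assume "a < dim_row (?X * ?Y)" "b < dim_col (?X * ?Y)"
    then have ab: "a < m" "b < m" by auto
    have "(M * C) $$ (slist I ! a, b) = (\<Sum>c<n. M $$ (slist I ! a, c) * C $$ (c, b))"
      using ab m I slist_nth_less[OF I(1)] by (intro mat_mult_entry[OF M C]) auto
    also have "\<dots> = (\<Sum>c<m. M $$ (slist I ! a, c) * C $$ (c, b))"
      using m ab block by (intro sum.mono_neutral_right) auto
    also have "\<dots> = (?X * ?Y) $$ (a, b)"
      using ab by (subst mat_mult_entry[of _ m m _ m]) auto
    finally show "mat m m (\<lambda>(a, b). (M * C) $$ (slist I ! a, b)) $$ (a, b) = (?X * ?Y) $$ (a, b)"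
      using ab by simp
  qed auto
  then show ?thesis using fin I det_mult[of ?X m ?Y] by (simp add: plucker_eq_det)
qed

lemma plucker_cong:
  assumes "I \<subseteq> {0..<n}" "\<And>i j. i < n \<Longrightarrow> j < card I \<Longrightarrow> M $$ (i, j) = M' $$ (i, j)"
  shows "plucker M I = plucker M' I"
proof -
  have fin: "finite I" using assms finite_subset by blast
  show ?thesis unfolding plucker_eq_det[OF fin]
    using assms(2) slist_nth_less[OF assms(1)] by (intro arg_cong[where f = det] eq_matI) auto
qed

text \<open>An invertible upper triangular factor meets the block condition for every size
  \<open>m\<close> at once, so it preserves a whole flag.\<close>

lemma upper_triangular_block:
  fixes R :: "complex mat"
  assumes R: "R \<in> carrier_mat n n" "upper_triangular R" and diag: "\<And>i. i < n \<Longrightarrow> R $$ (i, i) \<noteq> 0" and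
    m: "m \<le> n"
  shows "m \<le> c \<Longrightarrow> c < n \<Longrightarrow> b < m \<Longrightarrow> R $$ (c, b) = 0"
    "det (mat m m (\<lambda>(a, b). R $$ (a, b))) \<noteq> 0"
proof -
  show "m \<le> c \<Longrightarrow> c < n \<Longrightarrow> b < m \<Longrightarrow> R $$ (c, b) = 0" using R upper_triangularD[OF R(2), of b c] by auto
  have "det (mat m m (\<lambda>(a, b). R $$ (a, b))) = prod_list (diag_mat (mat m m (\<lambda>(a, b). R $$ (a, b))))"
    by (rule det_upper_triangular[of _ m]) (use R m in \<open>auto simp: upper_triangular_def\<close>)
  also have "\<dots> \<noteq> 0" using diag m by (auto simp: prod_list_zero_iff diag_mat_def)
  finally show "det (mat m m (\<lambda>(a, b). R $$ (a, b))) \<noteq> 0" .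
qed

section \<open>Orthonormalization\<close>

text \<open>Gram-Schmidt with one column per induction step, recorded as right multiplication by an
  upper triangular matrix. The columns from \<open>m\<close> on are still arbitrary.\<close>

lemma qr_step:
  fixes M :: "complex mat"
  assumes M: "M \<in> carrier_mat n n" "det M \<noteq> 0" and m: "m \<le> n"
  shows "\<exists>R \<in> carrier_mat n n. upper_triangular R \<and> (\<forall>i<n. R $$ (i, i) \<noteq> 0) \<and>
    (\<forall>a<m. \<forall>b<m. (\<Sum>i<n. cnj ((M * R) $$ (i, a)) * (M * R) $$ (i, b)) = (if a = b then 1 else 0))"
  using m
proof (induction m)
  case 0
  show ?case by (intro bexI[of _ "1\<^sub>m n"]) (auto simp: upper_triangular_def)
next
  case (Suc m)
  from Suc.IH[OF Suc_leD[OF Suc.prems]]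
  obtain R where R: "R \<in> carrier_mat n n" "upper_triangular R" and diag: "\<forall>i<n. R $$ (i, i) \<noteq> 0"
    and orth': "\<forall>a<m. \<forall>b<m. (\<Sum>i<n. cnj ((M * R) $$ (i, a)) * (M * R) $$ (i, b)) = (if a = b then 1
      else 0)"
    by blast
  note R = R diag[rule_format] and orth = orth'[rule_format]
  define Q where "Q = M * R"
  have Q: "Q \<in> carrier_mat n n" using M R by (simp add: Q_def)
  have mn: "m < n" using Suc.prems by simp
  have "prod_list (diag_mat R) \<noteq> 0" using R by (auto simp: prod_list_zero_iff diag_mat_def)
  then have detQ: "det Q \<noteq> 0"
    using det_mult[OF M(1) R(1)] M det_upper_triangular[OF R(2,1)] by (simp add: Q_def)
  \<comment> \<open>Column \<open>m\<close> minus its components along the orthonormal columns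
    before it gives \<open>v\<close>; the coefficients of this combination in the columns of
    \<open>Q\<close> are \<open>c\<close>.\<close>
  define p where "p a = (\<Sum>i<n. cnj (Q $$ (i, a)) * Q $$ (i, m))" for a
  define c where "c a = (if a < m then - p a else if a = m then 1 else 0)" for a
  define v where "v i = (\<Sum>a<n. Q $$ (i, a) * c a)" for i
  have v_eq: "v i = Q $$ (i, m) - (\<Sum>a<m. p a * Q $$ (i, a))" for i
  proof -
    have "v i = (\<Sum>a<Suc m. Q $$ (i, a) * c a)" unfolding v_def
      using mn by (intro sum.mono_neutral_right) (auto simp: c_def)
    then show ?thesis by (simp add: c_def sum_negf mult.commute)
  qed
  \<comment> \<open>A vanishing combination would contradict the invertibility of \<open>Q\<close>,
    because \<open>c\<close> has the entry 1 at \<open>m\<close>.\<close>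
  have nz: "\<exists>i<n. v i \<noteq> 0"
  proof (rule ccontr)
    assume "\<not> (\<exists>i<n. v i \<noteq> 0)"
    then have "Q *\<^sub>v vec n c = 0\<^sub>v n"
      using Q by (intro eq_vecI) (auto simp: v_def scalar_prod_def atLeast0LessThan)
    moreover have "vec n c \<noteq> 0\<^sub>v n"
    proof
      assume "vec n c = 0\<^sub>v n"
      then have "vec_index (vec n c) m = vec_index (0\<^sub>v n) m" by simp
      then show False using mn by (simp add: c_def)
    qed
    moreover have "vec n c \<in> carrier_vec n" by simp
    ultimately show False using detQ det_0_iff_vec_prod_zero_field[OF Q] by blast
  qed
  define s where "s = sqrt (\<Sum>i<n. (cmod (v i))\<^sup>2)"
  have s_sq: "s\<^sup>2 = (\<Sum>i<n. (cmod (v i))\<^sup>2)" by (simp add: s_def sum_nonneg)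
  have "0 < (\<Sum>i<n. (cmod (v i))\<^sup>2)"
    using nz by (auto intro!: sum_pos2 simp: zero_less_power2)
  then have s: "0 < s" by (simp add: s_def)
  \<comment> \<open>An elementary triangular matrix: it changes only column \<open>m\<close> of
    \<open>Q\<close>, which becomes \<open>v\<close> divided by its length \<open>s\<close>.\<close>
  define T where "T = mat n n (\<lambda>(a, b). if b = m then c a / complex_of_real s else if a = b then 1
    else 0)"
  have T: "T \<in> carrier_mat n n" by (simp add: T_def)
  have QT: "(Q * T) $$ (i, b) = (if b = m then v i / complex_of_real s else Q $$ (i, b))" if "i < n"
    "b < n" for i b
  proof -
    have "(Q * T) $$ (i, b) = (\<Sum>a<n. Q $$ (i, a) * T $$ (a, b))" by (rule mat_mult_entry[OF Q T that])
    also have "\<dots> = (\<Sum>a<n. if b = m then Q $$ (i, a) * c a / complex_of_real s else if a = b then Q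
      $$ (i, a) else 0)"
      using that by (intro sum.cong) (auto simp: T_def)
    finally show ?thesis using that by (simp add: v_def sum_divide_distrib)
  qed
  have MRT: "M * (R * T) = Q * T" using assoc_mult_mat[OF M(1) R(1) T] by (simp add: Q_def)
  have RT_diag: "(R * T) $$ (i, i) \<noteq> 0" and RT_upper: "\<And>j. j < i \<Longrightarrow> (R * T) $$ (i, j) = 0" if i: "i <
    n" for i
  proof -
    have e: "(R * T) $$ (i, j) = (\<Sum>a<n. R $$ (i, a) * T $$ (a, j))" if "j < n" for j
      by (rule mat_mult_entry[OF R(1) T i that])
    have z: "R $$ (i, a) = 0" if "a < i" for a using upper_triangularD[OF R(2) that] R(1) i by auto
    have zT: "T $$ (a, j) = 0" if "j < a" "a < n" for a j using that by (auto simp: T_def c_def)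
    have "(\<Sum>a<n. R $$ (i, a) * T $$ (a, i)) = (\<Sum>a\<in>{i}. R $$ (i, a) * T $$ (a, i))"
      using i z zT by (intro sum.mono_neutral_right) (auto simp: nat_neq_iff)
    then show "(R * T) $$ (i, i) \<noteq> 0" using e[OF i] R(3)[OF i] i s by (simp add: T_def c_def)
    fix j assume j: "j < i"
    have "(\<Sum>a<n. R $$ (i, a) * T $$ (a, j)) = 0"
    proof (intro sum.neutral ballI)
      fix a assume "a \<in> {..<n}"
      then show "R $$ (i, a) * T $$ (a, j) = 0" using z[of a] zT[of j a] j by (cases "a < i") auto
    qed
    then show "(R * T) $$ (i, j) = 0" using e[of j] i j by simp
  qed
  have pv: "(\<Sum>i<n. cnj (Q $$ (i, a)) * v i) = 0" if a: "a < m" for a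
  proof -
    have "(\<Sum>i<n. cnj (Q $$ (i, a)) * v i) = p a - (\<Sum>i<n. \<Sum>b<m. p b * (cnj (Q $$ (i, a)) * Q $$ (i, b)))"
      by (simp add: v_eq p_def right_diff_distrib sum_subtractf sum_distrib_left mult_ac)
    also have "(\<Sum>i<n. \<Sum>b<m. p b * (cnj (Q $$ (i, a)) * Q $$ (i, b))) = (\<Sum>b<m. p b * (\<Sum>i<n. cnj (Q $$
      (i, a)) * Q $$ (i, b)))"
      by (subst sum.swap) (simp add: sum_distrib_left)
    also have "\<dots> = (\<Sum>b<m. if a = b then p b else 0)"
      using orth[OF a] by (intro sum.cong) (auto simp: Q_def)
    finally show ?thesis using a by simp
  qed
  have vv: "(\<Sum>i<n. cnj (v i) * v i) = complex_of_real (s\<^sup>2)"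
    unfolding s_sq of_real_sum complex_norm_square by (intro sum.cong refl mult.commute)
  show ?case
  proof (intro bexI[of _ "R * T"] conjI allI impI)
    show "R * T \<in> carrier_mat n n" using R T by simp
    show "upper_triangular (R * T)" using RT_upper R T by (auto simp: upper_triangular_def simp del:
      index_mult_mat(1))
    show "(R * T) $$ (i, i) \<noteq> 0" if "i < n" for i using RT_diag[OF that] .
    fix a b assume ab: "a < Suc m" "b < Suc m"
    have "(\<Sum>i<n. cnj ((Q * T) $$ (i, a)) * (Q * T) $$ (i, b)) = (if a = b then 1 else 0)"
    proof -
      consider "a < m" "b < m" | "a < m" "b = m" | "a = m" "b < m" | "a = m" "b = m" using ab by
        linarith
      then show ?thesis
      proof cases
        case 1
        then show ?thesis using orth[OF 1] QT mn by (simp add: Q_def del: index_mult_mat(1))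
      next
        case 2
        then have "(\<Sum>i<n. cnj ((Q * T) $$ (i, a)) * (Q * T) $$ (i, b)) = (\<Sum>i<n. cnj (Q $$ (i, a)) *
          v i) / complex_of_real s"
          unfolding sum_divide_distrib using QT mn by (intro sum.cong) (auto simp del:
            index_mult_mat(1))
        then show ?thesis using pv 2 by simp
      next
        case 3
        then have "(\<Sum>i<n. cnj ((Q * T) $$ (i, a)) * (Q * T) $$ (i, b)) = cnj (\<Sum>i<n. cnj (Q $$ (i,
          b)) * v i) / complex_of_real s"
          unfolding cnj_sum sum_divide_distrib using QT mn by (intro sum.cong) (auto simp del:
            index_mult_mat(1))
        then show ?thesis using pv 3 by simp
      next
        case 4
        then have "(\<Sum>i<n. cnj ((Q * T) $$ (i, a)) * (Q * T) $$ (i, b)) = (\<Sum>i<n. cnj (v i) * v i) /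
          complex_of_real (s\<^sup>2)"
          unfolding sum_divide_distrib using QT mn by (intro sum.cong) (auto simp: power2_eq_square
            simp del: index_mult_mat(1))
        then show ?thesis using vv 4 s by simp
      qed
    qed
    then show "(\<Sum>i<n. cnj ((M * (R * T)) $$ (i, a)) * (M * (R * T)) $$ (i, b)) = (if a = b then 1
      else 0)"
      unfolding MRT .
  qed
qed

lemma qr_decomposition:
  fixes M :: "complex mat"
  assumes M: "M \<in> carrier_mat n n" "det M \<noteq> 0"
  obtains R where "R \<in> carrier_mat n n" "upper_triangular R" "\<And>i. i < n \<Longrightarrow> R $$ (i, i) \<noteq> 0"
    "M * R \<in> unitary_group n"
proof -
  obtain R where R: "R \<in> carrier_mat n n" "upper_triangular R" "\<forall>i<n. R $$ (i, i) \<noteq> 0"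
    and orth: "\<forall>a<n. \<forall>b<n. (\<Sum>i<n. cnj ((M * R) $$ (i, a)) * (M * R) $$ (i, b)) = (if a = b then 1
      else 0)"
    using qr_step[OF M order_refl] by blast
  have MR: "M * R \<in> carrier_mat n n" using M R by simp
  have "mat_adjoint (M * R) * (M * R) = 1\<^sub>m n"
  proof (rule eq_matI)
    fix a b assume "a < dim_row (1\<^sub>m n)" "b < dim_col (1\<^sub>m n)"
    then have ab: "a < n" "b < n" by auto
    show "(mat_adjoint (M * R) * (M * R)) $$ (a, b) = 1\<^sub>m n $$ (a, b)"
      using orth ab MR carrier_matD[OF MR]
      by (subst mat_mult_entry[OF mat_adjoint_carrier[OF MR] MR ab]) (auto simp del: index_mult_mat(1))
  qed (use M R in auto)
  then have "M * R \<in> unitary_group n" by (rule unitary_groupI[OF MR])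
  then show ?thesis using that R by blast
qed

section \<open>Extending a positive subspace to a positive flag\<close>

text \<open>A change of basis of the subspace multiplies all coordinates by one determinant.
  Allowing the common factor \<open>w\<close> makes positivity a property of the subspace.\<close>

definition plucker_pos :: "nat \<Rightarrow> nat \<Rightarrow> complex mat \<Rightarrow> bool" where
  "plucker_pos n m M \<longleftrightarrow> (\<exists>w. w \<noteq> 0 \<and> (\<forall>I. I \<subseteq> {0..<n} \<and> card I = m \<longrightarrow> 0 < w * plucker M I))"

text \<open>Once the lowest power \<open>x ^ e r\<close> has been factored out, only the term
  \<open>r\<close> survives as \<open>x\<close> tends to 0 from above.\<close>

lemma tendsto_leading_coeff:
  fixes c :: "'i \<Rightarrow> 'a::real_normed_field"
  assumes "finite T" "r \<in> T" "\<And>i. i \<in> T \<Longrightarrow> i \<noteq> r \<Longrightarrow> e r < e i"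
  shows "((\<lambda>x. \<Sum>i\<in>T. c i * of_real x ^ (e i - e r)) \<longlongrightarrow> c r) (at_right (0::real))"
proof -
  have "((\<lambda>x. \<Sum>i\<in>T. c i * of_real x ^ (e i - e r)) \<longlongrightarrow> (\<Sum>i\<in>T. c i * of_real 0 ^ (e i - e r)))
    (at_right (0::real))"
    by (intro tendsto_intros)
  \<comment> \<open>The term \<open>r\<close> is kept because \<open>0 ^ 0 = 1\<close>.\<close>
  also have "(\<Sum>i\<in>T. c i * of_real 0 ^ (e i - e r)) = (\<Sum>i\<in>{r}. c i)"
  proof (rule sum.mono_neutral_cong_right)
    show "\<forall>i\<in>T - {r}. c i * of_real 0 ^ (e i - e r) = 0"
    proof
      fix i assume "i \<in> T - {r}"
      then have "e r < e i" using assms(3) by simp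
      then show "c i * of_real 0 ^ (e i - e r) = 0" by simp
    qed
  qed (use assms in auto)
  finally show ?thesis by simp
qed

lemma sum_factor_leading:
  fixes c :: "'i \<Rightarrow> 'a::real_normed_field"
  assumes "\<And>i. i \<in> T \<Longrightarrow> i \<noteq> r \<Longrightarrow> e r < (e i :: nat)"
  shows "(\<Sum>i\<in>T. c i * x ^ e i) = x ^ e r * (\<Sum>i\<in>T. c i * x ^ (e i - e r))"
  unfolding sum_distrib_left
proof (rule sum.cong)
  fix i assume "i \<in> T"
  then have "e i = e r + (e i - e r)" using assms[of i] by (cases "i = r") auto
  then show "c i * x ^ e i = x ^ e r * (c i * x ^ (e i - e r))"
    by (metis mult.left_commute power_add)
qed simp

lemma eventually_leading_pos:
  fixes c :: "'i \<Rightarrow> real"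
  assumes "finite T" "r \<in> T" "\<And>i. i \<in> T \<Longrightarrow> i \<noteq> r \<Longrightarrow> e r < e i" and "0 < c r"
  shows "eventually (\<lambda>x. 0 < (\<Sum>i\<in>T. c i * x ^ e i)) (at_right (0::real))"
proof -
  have "eventually (\<lambda>x. 0 < (\<Sum>i\<in>T. c i * x ^ (e i - e r))) (at_right (0::real))"
    using order_tendstoD(1)[OF tendsto_leading_coeff[of T r e c, OF assms(1-3)] assms(4)] by simp
  moreover have "eventually (\<lambda>x::real. 0 < x) (at_right 0)" by (rule eventually_at_right_less)
  ultimately show ?thesis
  proof eventually_elim
    case (elim x)
    then show ?case by (subst sum_factor_leading[of T r e c, OF assms(3)]) auto
  qed
qed

lemma eventually_leading_nonzero:
  fixes c :: "'i \<Rightarrow> complex"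
  assumes "finite T" "r \<in> T" "\<And>i. i \<in> T \<Longrightarrow> i \<noteq> r \<Longrightarrow> e r < e i" and "c r \<noteq> 0"
  shows "eventually (\<lambda>x. (\<Sum>i\<in>T. c i * complex_of_real x ^ e i) \<noteq> 0) (at_right (0::real))"
proof -
  have "eventually (\<lambda>x. (\<Sum>i\<in>T. c i * complex_of_real x ^ (e i - e r)) \<noteq> 0) (at_right (0::real))"
    by (rule tendsto_imp_eventually_ne[OF tendsto_leading_coeff[of T r e c, OF assms(1-3)] assms(4)])
  moreover have "eventually (\<lambda>x::real. 0 < x) (at_right 0)" by (rule eventually_at_right_less)
  ultimately show ?thesis
  proof eventually_elim
    case (elim x)
    then show ?case by (subst sum_factor_leading[of T r e c, OF assms(3)]) auto
  qed
qed

lemma complex_pos_iff: "0 < z \<longleftrightarrow> z = complex_of_real (Re z) \<and> 0 < Re z"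
  by (auto simp: less_complex_def complex_eq_iff)

lemma plucker_pos_cong:
  assumes "\<And>i j. i < n \<Longrightarrow> j < m \<Longrightarrow> M $$ (i, j) = M' $$ (i, j)"
  shows "plucker_pos n m M \<longleftrightarrow> plucker_pos n m M'"
proof -
  have "plucker M I = plucker M' I" if "I \<subseteq> {0..<n}" "card I = m" for I
    using assms that by (intro plucker_cong) auto
  then show ?thesis unfolding plucker_pos_def by metis
qed

lemma plucker_pos_mult:
  assumes M: "M \<in> carrier_mat n n" and C: "C \<in> carrier_mat n n"
    and block: "\<And>c b. m \<le> c \<Longrightarrow> c < n \<Longrightarrow> b < m \<Longrightarrow> C $$ (c, b) = 0"
    and det: "det (mat m m (\<lambda>(a, b). C $$ (a, b))) \<noteq> 0" and pos: "plucker_pos n m M"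
  shows "plucker_pos n m (M * C)"
proof -
  let ?d = "det (mat m m (\<lambda>(a, b). C $$ (a, b)))"
  obtain w where w: "w \<noteq> 0" "\<And>I. I \<subseteq> {0..<n} \<Longrightarrow> card I = m \<Longrightarrow> 0 < w * plucker M I"
    using pos by (auto simp: plucker_pos_def)
  have "0 < (w / ?d) * plucker (M * C) I" if "I \<subseteq> {0..<n}" "card I = m" for I
  proof -
    have "(w / ?d) * plucker (M * C) I = w * plucker M I"
      using plucker_mult_block[OF M C that block] det by simp
    then show ?thesis using w(2)[OF that] by simp
  qed
  moreover have "w / ?d \<noteq> 0" using w det by simp
  ultimately show ?thesis unfolding plucker_pos_def by blast
qed

text \<open>The new column is (x^(n-1), ..., x, 1): for small x the Laplace expansion of a minor along it
  is dominated by the term of the largest row index, which has sign +1.\<close>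

lemma plucker_pos_extend:
  assumes M: "M \<in> carrier_mat n n" and m: "m < n" and pos: "plucker_pos n m M"
  shows "\<exists>M' \<in> carrier_mat n n. (\<forall>i<n. \<forall>j<m. M' $$ (i, j) = M $$ (i, j)) \<and> plucker_pos n (Suc m) M'"
proof -
  obtain w where w: "w \<noteq> 0" "\<And>I. I \<subseteq> {0..<n} \<Longrightarrow> card I = m \<Longrightarrow> 0 < w * plucker M I"
    using pos by (auto simp: plucker_pos_def)
  define P where "P I = Re (w * plucker M I)" for I
  have P: "w * plucker M I = complex_of_real (P I)" "0 < P I" if "I \<subseteq> {0..<n}" "card I = m" for I
    using w(2)[OF that] by (simp_all add: P_def complex_pos_iff)
  define F where "F = {K. K \<subseteq> {0..<n} \<and> card K = Suc m}"
  have "finite F" unfolding F_def by (rule finite_subset[of _ "Pow {0..<n}"]) auto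
  \<comment> \<open>The Laplace expansion of the extended minor of \<open>K\<close>, times
    \<open>w\<close>: a real polynomial in the parameter of the new column.\<close>
  define f where "f K x = (\<Sum>i\<in>K. ((-1) ^ card {x \<in> K. i < x} * P (K - {i})) * x ^ (n - 1 - i))" for
    K and x :: real
  have "eventually (\<lambda>x. 0 < f K x) (at_right 0)" if K: "K \<in> F" for K
  proof -
    have fin: "finite K" "K \<noteq> {}" using K by (auto simp: F_def intro: finite_subset)
    have Max: "Max K \<in> K" "\<And>i. i \<in> K \<Longrightarrow> i \<le> Max K" using fin by auto
    have "K - {Max K} \<subseteq> {0..<n}" "card (K - {Max K}) = m" using K Max fin by (auto simp: F_def)
    then have "0 < P (K - {Max K})" by (rule P)
    moreover have e: "{x \<in> K. Max K < x} = {}" using Max by force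
    ultimately have c: "0 < (-1) ^ card {x \<in> K. Max K < x} * P (K - {Max K})" unfolding e by simp
    show ?thesis unfolding f_def
    proof (rule eventually_leading_pos[where r = "Max K"])
      fix i assume i: "i \<in> K" "i \<noteq> Max K"
      then have "i < Max K" using Max(2)[of i] by simp
      moreover have "Max K < n" using K Max by (auto simp: F_def)
      ultimately show "n - 1 - Max K < n - 1 - i" by simp
    qed (use fin Max c in auto)
  qed
  \<comment> \<open>There are finitely many row sets \<open>K\<close>, so one small \<open>x\<close>
    serves all of them.\<close>
  then have "eventually (\<lambda>x. \<forall>K\<in>F. 0 < f K x) (at_right 0)"
    using \<open>finite F\<close> by (simp add: eventually_ball_finite)
  then obtain x where x: "\<And>K. K \<in> F \<Longrightarrow> 0 < f K x"
    using eventually_happens[of _ "at_right (0::real)"] trivial_limit_at_right_real by blast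
  define M' where "M' = mat n n (\<lambda>(i, j). if j = m then complex_of_real x ^ (n - 1 - i) else M $$
    (i, j))"
  have "0 < w * plucker M' K" if "K \<subseteq> {0..<n}" "card K = Suc m" for K
  proof -
    have fin: "finite K" using that finite_subset by blast
    have "w * plucker M' K = (\<Sum>i\<in>K. w * ((-1) ^ card {x \<in> K. i < x} * M' $$ (i, m) * plucker M' (K -
      {i})))"
      using plucker_laplace_last_column[OF fin that(2), of M'] by (simp add: sum_distrib_left)
    also have "\<dots> = (\<Sum>i\<in>K. complex_of_real ((-1) ^ card {x \<in> K. i < x} * P (K - {i}) * x ^ (n - 1 - i)))"
    proof (rule sum.cong)
      fix i assume i: "i \<in> K"
      have sub: "K - {i} \<subseteq> {0..<n}" "card (K - {i}) = m" using that i fin by auto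
      have "plucker M' (K - {i}) = plucker M (K - {i})"
        by (rule plucker_cong[OF sub(1)]) (use sub m in \<open>auto simp: M'_def\<close>)
      moreover have "M' $$ (i, m) = complex_of_real x ^ (n - 1 - i)" using i that m by (auto simp:
        M'_def)
      ultimately show "w * ((-1) ^ card {x \<in> K. i < x} * M' $$ (i, m) * plucker M' (K - {i})) =
          complex_of_real ((-1) ^ card {x \<in> K. i < x} * P (K - {i}) * x ^ (n - 1 - i))"
        using P(1)[OF sub] by (simp add: mult_ac)
    qed simp
    finally have "w * plucker M' K = complex_of_real (f K x)" by (simp add: f_def)
    then show ?thesis using x[of K] that by (simp add: F_def less_complex_def)
  qed
  then have "plucker_pos n (Suc m) M'" using w(1) unfolding plucker_pos_def by blast
  moreover have "M' \<in> carrier_mat n n" "\<forall>i<n. \<forall>j<m. M' $$ (i, j) = M $$ (i, j)"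
    using m by (auto simp: M'_def)
  ultimately show ?thesis by blast
qed

text \<open>The cofactor of column \<open>j\<close> when one more row is appended to
  \<open>xs\<close>. It does not depend on the appended row, so a linear functional of that row can
  be pulled through the expansion.\<close>

definition last_row_cofactor :: "complex mat \<Rightarrow> nat list \<Rightarrow> nat \<Rightarrow> complex" where
  "last_row_cofactor M xs j = (-1) ^ (length xs + j) *
    det (mat (length xs) (length xs) (\<lambda>(a, b). M $$ (xs ! a, if b < j then b else Suc b)))"

lemma row_minor_laplace_last_row:
  "row_minor M (xs @ [i]) = (\<Sum>j<Suc (length xs). M $$ (i, j) * last_row_cofactor M xs j)"
proof -
  let ?l = "length xs"
  let ?A = "mat (Suc ?l) (Suc ?l) (\<lambda>(a, b). M $$ ((xs @ [i]) ! a, b))"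
  have "row_minor M (xs @ [i]) = det ?A" by (simp add: row_minor_def)
  also have "\<dots> = (\<Sum>j<Suc ?l. ?A $$ (?l, j) * cofactor ?A ?l j)"
    by (rule laplace_expansion_row) auto
  also have "\<dots> = (\<Sum>j<Suc ?l. M $$ (i, j) * last_row_cofactor M xs j)"
  proof (rule sum.cong)
    fix j assume j: "j \<in> {..<Suc ?l}"
    have "mat_delete ?A ?l j = mat ?l ?l (\<lambda>(a, b). M $$ (xs ! a, if b < j then b else Suc b))"
      by (rule eq_matI) (auto simp: mat_delete_def nth_append)
    then show "?A $$ (?l, j) * cofactor ?A ?l j = M $$ (i, j) * last_row_cofactor M xs j"
      using j by (simp add: cofactor_def last_row_cofactor_def)
  qed simp
  finally show ?thesis .
qed

lemma last_row_cofactor_last: "last_row_cofactor M xs (length xs) = row_minor M xs"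
proof -
  have "mat (length xs) (length xs) (\<lambda>(a, b). M $$ (xs ! a, if b < length xs then b else Suc b)) =
      mat (length xs) (length xs) (\<lambda>(a, b). M $$ (xs ! a, b))"
    by (rule eq_matI) auto
  then show ?thesis by (simp add: last_row_cofactor_def row_minor_def)
qed

text \<open>Inside the span of the first l + 1 columns we pass to the hyperplane on which the functional
  (1, -x, x^2, -x^3, ...) vanishes. For small x its Pluecker coordinate of K is dominated by the
  coordinate of K together with the least index missing from K.\<close>

lemma plucker_pos_restrict:
  assumes M: "M \<in> carrier_mat n n" and l: "Suc l \<le> n" and pos: "plucker_pos n (Suc l) M"
  shows "\<exists>C \<in> carrier_mat n n. plucker_pos n l (M * C) \<and>
    (\<forall>m. Suc l \<le> m \<and> m \<le> n \<longrightarrow> (\<forall>c b. m \<le> c \<and> c < n \<and> b < m \<longrightarrow> C $$ (c, b) = 0) \<and>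
      det (mat m m (\<lambda>(a, b). C $$ (a, b))) \<noteq> 0)"
proof -
  obtain w where w: "w \<noteq> 0" "\<And>I. I \<subseteq> {0..<n} \<Longrightarrow> card I = Suc l \<Longrightarrow> 0 < w * plucker M I"
    using pos by (auto simp: plucker_pos_def)
  define P where "P I = Re (w * plucker M I)" for I
  have P: "w * plucker M I = complex_of_real (P I)" "0 < P I" if "I \<subseteq> {0..<n}" "card I = Suc l" for I
    using w(2)[OF that] by (simp_all add: P_def complex_pos_iff)
  define F where "F = {K. K \<subseteq> {0..<n} \<and> card K = l}"
  have "finite F" unfolding F_def by (rule finite_subset[of _ "Pow {0..<n}"]) auto
  \<comment> \<open>The sign collects \<open>(-1) ^ i\<close> from the functional, the sign of
    sorting \<open>i\<close> into \<open>K\<close>, and \<open>(-1) ^ l\<close>, which makes the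
    leading term positive.\<close>
  define f where "f K x = (\<Sum>i\<in>{0..<n} - K. ((-1) ^ (i + card {x \<in> K. i < x} + l) * P (insert i K)) *
    x ^ i)" for K and x :: real
  have ev1: "eventually (\<lambda>x. 0 < f K x) (at_right 0)" if K: "K \<in> F" for K
  proof -
    have fin: "finite K" using K by (auto simp: F_def intro: finite_subset)
    have ne: "{0..<n} - K \<noteq> {}"
    proof
      assume "{0..<n} - K = {}"
      then have "K = {0..<n}" using K by (auto simp: F_def)
      then show False using K l by (auto simp: F_def)
    qed
    define i0 where "i0 = Min ({0..<n} - K)"
    have i0: "i0 \<in> {0..<n} - K" "\<And>i. i \<in> {0..<n} - K \<Longrightarrow> i0 \<le> i"
      using ne by (auto simp: i0_def simp del: Diff_iff intro: Min_in)
    \<comment> \<open>Every index below the least missing one, \<open>i0\<close>, lies in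
      \<open>K\<close>. Hence \<open>l\<close> is \<open>i0\<close> plus the number of elements of
      \<open>K\<close> above \<open>i0\<close>, and the exponent of the leading sign is
      even.\<close>
    have "K = {0..<i0} \<union> {x \<in> K. i0 < x}"
    proof
      show "K \<subseteq> {0..<i0} \<union> {x \<in> K. i0 < x}" using i0(1) by (auto simp: nat_neq_iff) (metis
        linorder_neqE_nat)
      show "{0..<i0} \<union> {x \<in> K. i0 < x} \<subseteq> K"
      proof
        fix x assume "x \<in> {0..<i0} \<union> {x \<in> K. i0 < x}"
        then show "x \<in> K" using i0(1) i0(2)[of x] by (cases "x \<in> K") auto
      qed
    qed
    then have "card K = card {0..<i0} + card {x \<in> K. i0 < x}"
      using fin by (metis (no_types, lifting) card_Un_disjoint disjoint_iff finite_Un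
        atLeastLessThan_iff mem_Collect_eq not_less_iff_gr_or_eq)
    then have cK: "l = i0 + card {x \<in> K. i0 < x}" using K by (simp add: F_def)
    have "(-1::real) ^ (i0 + card {x \<in> K. i0 < x} + l) = 1" unfolding cK[symmetric] by simp
    moreover have "0 < P (insert i0 K)" using i0 K fin by (intro P) (auto simp: F_def)
    ultimately have c: "0 < (-1) ^ (i0 + card {x \<in> K. i0 < x} + l) * P (insert i0 K)" by simp
    show ?thesis unfolding f_def
    proof (rule eventually_leading_pos[where r = i0])
      fix i assume "i \<in> {0..<n} - K" "i \<noteq> i0"
      then show "i0 < i" using i0(2)[of i] by simp
    qed (use i0 c in auto)
  qed
  \<comment> \<open>The value of the functional on column \<open>l\<close>. It has to be nonzero, as
    multiples of column \<open>l\<close> correct the columns before it.\<close>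
  define r where "r x = (\<Sum>i\<in>{0..<n}. ((-1) ^ i * M $$ (i, l)) * complex_of_real x ^ i)" for x :: real
  have ev2: "eventually (\<lambda>x. r x \<noteq> 0) (at_right 0)"
  proof -
    let ?T = "{i \<in> {0..<n}. M $$ (i, l) \<noteq> 0}"
    \<comment> \<open>If column \<open>l\<close> vanished, so would the minor on the rows
      \<open>{0..<Suc l}\<close>.\<close>
    have ne: "?T \<noteq> {}"
    proof
      assume e: "?T = {}"
      have "plucker M {0..<Suc l} = 0"
        using plucker_laplace_last_column[of "{0..<Suc l}" l M] e l by auto
      then show False using w(2)[of "{0..<Suc l}"] l by simp
    qed
    have "(\<Sum>i\<in>?T. ((-1) ^ i * M $$ (i, l)) * complex_of_real x ^ i) = r x" for x :: real
      unfolding r_def by (rule sum.mono_neutral_left) auto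
    moreover have "eventually (\<lambda>x. (\<Sum>i\<in>?T. ((-1) ^ i * M $$ (i, l)) * complex_of_real x ^ i) \<noteq> 0)
      (at_right (0::real))"
    proof (rule eventually_leading_nonzero[where r = "Min ?T"])
      show "Min ?T \<in> ?T" using ne by (intro Min_in) auto
      then show "(-1) ^ Min ?T * M $$ (Min ?T, l) \<noteq> 0" by simp
      fix i assume "i \<in> ?T" "i \<noteq> Min ?T"
      moreover from this have "Min ?T \<le> i" by (intro Min_le) auto
      ultimately show "Min ?T < i" using le_neq_implies_less by metis
    qed simp
    ultimately show ?thesis by simp
  qed
  have "eventually (\<lambda>x. \<forall>K\<in>F. 0 < f K x) (at_right 0)"
    using ev1 \<open>finite F\<close> by (simp add: eventually_ball_finite)
  then have "eventually (\<lambda>x. (\<forall>K\<in>F. 0 < f K x) \<and> r x \<noteq> 0) (at_right 0)"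
    using ev2 by (rule eventually_conj)
  then obtain x where x: "\<And>K. K \<in> F \<Longrightarrow> 0 < f K x" "r x \<noteq> 0"
    using eventually_happens[of _ "at_right (0::real)"] trivial_limit_at_right_real by blast
  define \<phi> where "\<phi> i = (-1) ^ i * complex_of_real x ^ i" for i
  define q where "q j = (\<Sum>i<n. \<phi> i * M $$ (i, j)) / r x" for j
  have rx: "r x = (\<Sum>i<n. \<phi> i * M $$ (i, l))" by (simp add: r_def \<phi>_def atLeast0LessThan mult_ac)
  \<comment> \<open>Subtracts from each column \<open>b < l\<close> the multiple of column
    \<open>l\<close> that makes the functional vanish on it. The matrix is unit lower triangular, so
    its leading blocks have determinant 1.\<close>
  define C where "C = mat n n (\<lambda>(a, b). if a = b then 1 else if a = l \<and> b < l then - q b else 0)"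
  have C: "C \<in> carrier_mat n n" by (simp add: C_def)
  have block: "C $$ (c, b) = 0" if "Suc l \<le> m" "m \<le> c" "c < n" "b < m" for m c b
    using that by (auto simp: C_def)
  have det: "det (mat m m (\<lambda>(a, b). C $$ (a, b))) = 1" if "Suc l \<le> m" "m \<le> n" for m
  proof -
    have "diag_mat (mat m m (\<lambda>(a, b). C $$ (a, b))) = map (\<lambda>_. 1) [0..<m]"
      using that by (auto simp: diag_mat_def C_def)
    then show ?thesis
      by (subst det_lower_triangular[of m]) (use that in \<open>auto simp: C_def map_replicate_const\<close>)
  qed
  define N where "N = M * C"
  have N_entry: "N $$ (i, j) = (if j < l then M $$ (i, j) - q j * M $$ (i, l) else M $$ (i, j))" if
    ij: "i < n" "j < n" for i j
  proof -
    have "N $$ (i, j) = (\<Sum>c<n. M $$ (i, c) * C $$ (c, j))" unfolding N_def by (rule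
      mat_mult_entry[OF M C ij])
    also have "\<dots> = (\<Sum>c<n. (if c = j then M $$ (i, c) else 0) + (if c = l \<and> j < l then - q j * M $$
      (i, c) else 0))"
      using ij by (intro sum.cong) (auto simp: C_def)
    also have "\<dots> = (if j < l then M $$ (i, j) - q j * M $$ (i, l) else M $$ (i, j))"
      using ij l by (auto simp: sum.distrib)
    finally show ?thesis .
  qed
  have phiN: "(\<Sum>i<n. \<phi> i * N $$ (i, j)) = (if j < l then 0 else r x)" if j: "j < Suc l" for j
  proof (cases "j < l")
    case True
    have "(\<Sum>i<n. \<phi> i * N $$ (i, j)) = (\<Sum>i<n. \<phi> i * M $$ (i, j)) - q j * (\<Sum>i<n. \<phi> i * M $$ (i, l))"
      using True l by (simp add: N_entry sum_subtractf sum_distrib_left algebra_simps)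
    also have "\<dots> = 0" using x(2) by (simp add: q_def rx[symmetric])
    finally show ?thesis using True by simp
  next
    case False
    then have "j = l" using j by simp
    then show ?thesis using l by (simp add: N_entry rx)
  qed
  have "0 < (w * (-1) ^ l * r x) * plucker N K" if K: "K \<subseteq> {0..<n}" "card K = l" for K
  proof -
    have fin: "finite K" using K finite_subset by blast
    have len: "length (slist K) = l" using fin K by simp
    \<comment> \<open>Expanding along the appended row, the functional kills the columns below
      \<open>l\<close> and takes the value \<open>r x\<close> on column \<open>l\<close>, whose
      cofactor is the minor of \<open>K\<close>. Sorting the appended row instead expresses the same
      sum by coordinates of size \<open>Suc l\<close>.\<close>
    have "(\<Sum>i<n. \<phi> i * row_minor N (slist K @ [i])) =
        (\<Sum>i<n. \<Sum>j<Suc l. (\<phi> i * N $$ (i, j)) * last_row_cofactor N (slist K) j)"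
      unfolding row_minor_laplace_last_row len by (simp add: sum_distrib_left mult_ac del:
        sum.lessThan_Suc)
    also have "\<dots> = (\<Sum>j<Suc l. (\<Sum>i<n. \<phi> i * N $$ (i, j)) * last_row_cofactor N (slist K) j)"
      by (subst sum.swap) (simp add: sum_distrib_right del: sum.lessThan_Suc)
    also have "\<dots> = (\<Sum>j<Suc l. (if j < l then 0 else r x) * last_row_cofactor N (slist K) j)"
      using phiN by (intro sum.cong) auto
    also have "\<dots> = r x * last_row_cofactor N (slist K) l" by simp
    also have "\<dots> = r x * plucker N K"
      using last_row_cofactor_last[of N "slist K"] len by (simp add: plucker_def)
    finally have "(w * (-1) ^ l * r x) * plucker N K = (w * (-1) ^ l) * (\<Sum>i<n. \<phi> i * row_minor N
      (slist K @ [i]))"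
      by simp
    also have "\<dots> = (\<Sum>i<n. w * (-1) ^ l * \<phi> i * row_minor N (slist K @ [i]))"
      by (simp add: sum_distrib_left mult_ac)
    also have "\<dots> = (\<Sum>i\<in>{0..<n} - K. complex_of_real ((-1) ^ (i + card {x \<in> K. i < x} + l) * P
      (insert i K) * x ^ i))"
    proof (rule sum.mono_neutral_cong_right)
      show "\<forall>i\<in>{..<n} - ({0..<n} - K). w * (-1) ^ l * \<phi> i * row_minor N (slist K @ [i]) = 0"
        using fin by (auto simp: row_minor_append_last)
      fix i assume i: "i \<in> {0..<n} - K"
      then have sub: "insert i K \<subseteq> {0..<n}" "card (insert i K) = Suc l" using K fin by auto
      have "plucker N (insert i K) = plucker M (insert i K)"
        unfolding N_def using plucker_mult_block[OF M C sub block[of "Suc l"]] det[of "Suc l"] l by simp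
      then show "w * (-1) ^ l * \<phi> i * row_minor N (slist K @ [i]) =
          complex_of_real ((-1) ^ (i + card {x \<in> K. i < x} + l) * P (insert i K) * x ^ i)"
        using i fin P(1)[OF sub] by (simp add: row_minor_append_last \<phi>_def power_add mult_ac)
    qed auto
    also have "\<dots> = complex_of_real (f K x)" by (simp add: f_def)
    finally show ?thesis using x(1)[of K] K by (simp add: F_def less_complex_def)
  qed
  moreover have "w * (-1) ^ l * r x \<noteq> 0" using w(1) x(2) by simp
  ultimately have "plucker_pos n l (M * C)" unfolding plucker_pos_def N_def by blast
  then show ?thesis using C block det by (intro bexI[of _ C]) auto
qed

text \<open>The dimension goes down from \<open>k\<close> one step at a time. Each correcting matrix
  has invertible leading blocks, with zeros below, at all sizes above the new one, so coordinates
  already positive remain so up to a common factor.\<close>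

lemma plucker_pos_restrict_all:
  assumes g: "g \<in> carrier_mat n n" and k: "k \<le> n" and pos: "plucker_pos n k g" and "j \<le> k"
  shows "\<exists>C \<in> carrier_mat n n. (\<forall>m. k - j \<le> m \<and> m \<le> k \<longrightarrow> plucker_pos n m (g * C)) \<and>
    (\<forall>c b. k \<le> c \<and> c < n \<and> b < k \<longrightarrow> C $$ (c, b) = 0)"
  using \<open>j \<le> k\<close>
proof (induction j)
  case 0
  show ?case using g k pos by (intro bexI[of _ "1\<^sub>m n"]) auto
next
  case (Suc j)
  then obtain C where C: "C \<in> carrier_mat n n" "\<And>m. k - j \<le> m \<Longrightarrow> m \<le> k \<Longrightarrow> plucker_pos n m (g * C)"
    "\<And>c b. k \<le> c \<Longrightarrow> c < n \<Longrightarrow> b < k \<Longrightarrow> C $$ (c, b) = 0" by force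
  define l where "l = k - Suc j"
  have l: "Suc l = k - j" "Suc l \<le> k" using Suc.prems by (auto simp: l_def)
  have gC: "g * C \<in> carrier_mat n n" using g C by simp
  have "plucker_pos n (Suc l) (g * C)" using C(2)[of "Suc l"] l by simp
  from plucker_pos_restrict[OF gC _ this] l k
  obtain D where D: "D \<in> carrier_mat n n" "plucker_pos n l (g * C * D)"
    and D': "\<forall>m. Suc l \<le> m \<and> m \<le> n \<longrightarrow> (\<forall>c b. m \<le> c \<and> c < n \<and> b < m \<longrightarrow> D $$ (c, b) = 0) \<and>
      det (mat m m (\<lambda>(a, b). D $$ (a, b))) \<noteq> 0"
    by (meson order_trans)
  have D2: "\<And>m. Suc l \<le> m \<Longrightarrow> m \<le> n \<Longrightarrow> det (mat m m (\<lambda>(a, b). D $$ (a, b))) \<noteq> 0"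
      "\<And>m c b. Suc l \<le> m \<Longrightarrow> m \<le> n \<Longrightarrow> m \<le> c \<Longrightarrow> c < n \<Longrightarrow> b < m \<Longrightarrow> D $$ (c, b) = 0"
    using D' by blast+
  have e: "g * (C * D) = g * C * D" using assoc_mult_mat[OF g C(1) D(1)] by simp
  show ?case
  proof (intro bexI[of _ "C * D"] conjI allI impI)
    show "C * D \<in> carrier_mat n n" using C D by simp
    fix m assume m: "k - Suc j \<le> m \<and> m \<le> k"
    show "plucker_pos n m (g * (C * D))"
    proof (cases "m = l")
      case True then show ?thesis using D e by simp
    next
      case False
      then have "Suc l \<le> m" using m by (simp add: l_def)
      then show ?thesis unfolding e using m l k D2
        by (intro plucker_pos_mult[OF gC D(1)] C(2)) auto
    qed
  next
    fix c b assume cb: "k \<le> c \<and> c < n \<and> b < k"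
    have "(C * D) $$ (c, b) = (\<Sum>a<n. C $$ (c, a) * D $$ (a, b))"
      using cb k by (intro mat_mult_entry[OF C(1) D(1)]) auto
    also have "\<dots> = 0"
    proof (rule sum.neutral, rule ballI)
      fix a assume "a \<in> {..<n}"
      then show "C $$ (c, a) * D $$ (a, b) = 0"
        using C(3)[of c a] D2(2)[of k a b] cb l k by (cases "a < k") auto
    qed
    finally show "(C * D) $$ (c, b) = 0" .
  qed
qed

text \<open>Each new column is placed behind the ones already arranged, which leaves the smaller
  minors untouched.\<close>

lemma plucker_pos_extend_all:
  assumes M: "M \<in> carrier_mat n n" and k: "k + j \<le> n" and pos: "\<And>m. m \<le> k \<Longrightarrow> plucker_pos n m M"
  shows "\<exists>M' \<in> carrier_mat n n. (\<forall>i<n. \<forall>b<k. M' $$ (i, b) = M $$ (i, b)) \<and> (\<forall>m \<le> k + j. plucker_pos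
    n m M')"
  using k
proof (induction j)
  case 0
  then show ?case using M pos by auto
next
  case (Suc j)
  then obtain M1 where M1: "M1 \<in> carrier_mat n n" "\<forall>i<n. \<forall>b<k. M1 $$ (i, b) = M $$ (i, b)"
    "\<And>m. m \<le> k + j \<Longrightarrow> plucker_pos n m M1" by force
  obtain M2 where M2: "M2 \<in> carrier_mat n n" "\<forall>i<n. \<forall>b<k + j. M2 $$ (i, b) = M1 $$ (i, b)"
    "plucker_pos n (Suc (k + j)) M2"
    using plucker_pos_extend[OF M1(1), of "k + j"] M1(3)[of "k + j"] Suc.prems by auto
  have "plucker_pos n m M2" if "m \<le> k + j" for m
    using plucker_pos_cong[of n m M1 M2] M1(3)[OF that] M2(2) that by auto
  then have "\<forall>m \<le> k + Suc j. plucker_pos n m M2" using M2(3) by (auto simp: le_Suc_eq)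
  then show ?case using M1 M2 by (intro bexI[of _ M2]) auto
qed

lemma plucker_full: "M \<in> carrier_mat n n \<Longrightarrow> plucker M {0..<n} = det M"
  by (subst plucker_eq_det) (auto intro!: arg_cong[where f = det])

section \<open>The positive part of the orbit\<close>

lemma kproj_dim [simp]: "dim_row (kproj n k) = n" "dim_col (kproj n k) = n"
  using carrier_matD[OF kproj_simps(1)] by auto

text \<open>The block condition says that \<open>C\<close> maps the span of the first
  \<open>k\<close> coordinate vectors into itself.\<close>

lemma block_mult_kproj:
  assumes C: "C \<in> carrier_mat n n" and block: "\<And>c b. k \<le> c \<Longrightarrow> c < n \<Longrightarrow> b < k \<Longrightarrow> C $$ (c, b) = 0"
  shows "C * kproj n k = kproj n k * (C * kproj n k)"
proof -
  have CK: "C * kproj n k \<in> carrier_mat n n" using C mult_carrier_mat kproj_simps(1) by blast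
  show ?thesis using C CK carrier_matD[OF CK] carrier_matD[OF kproj_simps(1)[of n k]] block
    by (intro eq_matI) (auto simp: mult_kproj_index[OF C] kproj_mult_index[OF CK] not_less simp del:
      index_mult_mat(1))
qed

text \<open>The hypothesis places the first \<open>k\<close> columns of \<open>h\<close> in the span
  of those of \<open>g\<close>, and equal dimension forces equal spans. \<open>Y\<close> is the
  transition matrix between the two orthonormal frames.\<close>

lemma subspace_proj_eqI:
  assumes g: "g \<in> unitary_group n" and h: "h \<in> unitary_group n" and Z: "Z \<in> carrier_mat n n"
    and hg: "h * kproj n k = g * (kproj n k * (Z * kproj n k))"
  shows "subspace_proj n k h = subspace_proj n k g"
proof -
  interpret square_matrices n .
  let ?K = "kproj n k"
  define Y where "Y = ?K * (Z * ?K)"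
  note [simp] = unitary_groupD(1)[OF g] unitary_groupD(1)[OF h] Z
  have Y [simp]: "Y \<in> carrier_mat n n" by (simp add: Y_def)
  have KY: "?K * Y = Y" by (simp add: Y_def kproj_mult_left)
  have YK: "Y * ?K = Y" by (simp add: Y_def sq_simps)
  have KYa: "?K * mat_adjoint Y = mat_adjoint Y" using YK mat_adjoint_mult[OF Y kproj_simps(1)[of n
    k]] by simp
  have YaK: "mat_adjoint Y * ?K = mat_adjoint Y" using KY mat_adjoint_mult[OF kproj_simps(1)[of n k]
    Y] by simp
  have gg: "mat_adjoint g * (g * X) = X" if "X \<in> carrier_mat n n" for X
    using that assoc_mult_mat[of "mat_adjoint g" n n g n X n] unitary_groupD(3)[OF g] by (simp add:
      sq_simps(8))
  have hh: "mat_adjoint h * (h * X) = X" if "X \<in> carrier_mat n n" for X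
    using that assoc_mult_mat[of "mat_adjoint h" n n h n X n] unitary_groupD(3)[OF h] by (simp add:
      sq_simps(8))
  have hK: "h * ?K = g * Y" using hg by (simp add: Y_def)
  have adj: "?K * mat_adjoint h = mat_adjoint Y * mat_adjoint g"
    using arg_cong[OF hK, of mat_adjoint] by (simp add: mat_adjoint_mult[of _ n n _ n])
  have YY: "mat_adjoint Y * Y = ?K"
  proof -
    have "mat_adjoint Y * Y = (mat_adjoint Y * mat_adjoint g) * (g * Y)" by (simp add: sq_simps gg)
    also have "\<dots> = (?K * mat_adjoint h) * (h * ?K)" by (simp only: adj hK)
    also have "\<dots> = ?K" by (simp add: sq_simps hh)
    finally show ?thesis .
  qed
  \<comment> \<open>Padding \<open>Y\<close> by the identity on the complementary coordinates
    produces a square matrix for which a left inverse is also a right inverse. This turns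
    \<open>mat_adjoint Y * Y = ?K\<close> into \<open>Y * mat_adjoint Y = ?K\<close>.\<close>
  define W where "W = Y + (1\<^sub>m n - ?K)"
  have W [simp]: "W \<in> carrier_mat n n" by (simp add: W_def)
  have Wa: "mat_adjoint W = mat_adjoint Y + (1\<^sub>m n - ?K)"
    using carrier_matD[OF Y] carrier_matD[OF kproj_simps(1)[of n k]] by (simp add: W_def
      mat_adjoint_add mat_adjoint_minus)
  have "mat_adjoint W * W = 1\<^sub>m n"
    unfolding Wa unfolding W_def
    by (simp add: sq_simps YY YaK KY) (rule sq_eqI; simp add: sq_index)
  then have "W * mat_adjoint W = 1\<^sub>m n"
    using mat_mult_left_right_inverse[of "mat_adjoint W" n W] by simp
  moreover have "W * mat_adjoint W = Y * mat_adjoint Y + (1\<^sub>m n - ?K)"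
    unfolding Wa unfolding W_def
    by (simp add: sq_simps YK KYa) (rule sq_eqI; simp add: sq_index)
  ultimately have e: "Y * mat_adjoint Y + (1\<^sub>m n - ?K) = 1\<^sub>m n" by simp
  have YYa: "Y * mat_adjoint Y = ?K"
  proof (rule sq_eqI)
    fix i j assume ij: "i < n" "j < n"
    have "(Y * mat_adjoint Y + (1\<^sub>m n - ?K)) $$ (i, j) = 1\<^sub>m n $$ (i, j)" using e by simp
    then show "(Y * mat_adjoint Y) $$ (i, j) = ?K $$ (i, j)" using ij by (simp add: sq_index del:
      index_mult_mat(1) index_one_mat(1))
  qed simp_all
  have "subspace_proj n k h = (h * ?K) * (?K * mat_adjoint h)"
    by (simp add: subspace_proj_def sq_simps kproj_mult_left)
  also have "\<dots> = g * (Y * (mat_adjoint Y * mat_adjoint g))" unfolding hK adj by (simp add: sq_simps)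
  also have "\<dots> = g * ((Y * mat_adjoint Y) * mat_adjoint g)" by (simp add: sq_simps)
  finally show ?thesis unfolding YYa by (simp add: subspace_proj_def sq_simps)
qed

text \<open>The case \<open>m = n\<close> shows that \<open>M\<close> is invertible, and the
  triangular factor of the orthonormalization preserves every subspace of the flag.\<close>

lemma unitary_of_plucker_pos:
  assumes M: "M \<in> carrier_mat n n" and pos: "\<And>m. m \<le> n \<Longrightarrow> plucker_pos n m M"
  shows "\<exists>R \<in> carrier_mat n n. upper_triangular R \<and> M * R \<in> unitary_group n \<and> (\<forall>m\<le>n. plucker_pos n m
    (M * R))"
proof -
  have "det M \<noteq> 0"
    using pos[of n] plucker_full[OF M] by (force simp: plucker_pos_def)
  then obtain R where R: "R \<in> carrier_mat n n" "upper_triangular R" "\<And>i. i < n \<Longrightarrow> R $$ (i, i) \<noteq> 0"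
    "M * R \<in> unitary_group n"
    using qr_decomposition[OF M] by blast
  have "plucker_pos n m (M * R)" if "m \<le> n" for m
    using upper_triangular_block[OF R(1,2,3) that] pos[OF that] by (intro plucker_pos_mult[OF M
      R(1)]) auto
  then show ?thesis using R by blast
qed

text \<open>Scaling the columns by phases multiplies the minors of size \<open>m\<close> by the
  product of the first \<open>m\<close> phases. Ratios of consecutive \<open>u\<close> telescope to
  \<open>u m\<close>, and modulus 1 keeps the matrix unitary.\<close>

lemma unitary_phases:
  assumes g: "g \<in> unitary_group n" and pos: "\<And>m. m \<le> n \<Longrightarrow> plucker_pos n m g"
  shows "\<exists>d. g * mat_diag n d \<in> unitary_pos n"
proof -
  note g' = unitary_groupD(1)[OF g]
  obtain w where w: "\<And>m. m \<le> n \<Longrightarrow> w m \<noteq> 0" "\<And>m I. m \<le> n \<Longrightarrow> I \<subseteq> {0..<n} \<Longrightarrow> card I = m \<Longrightarrow> 0 < w m *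
    plucker g I"
    using pos unfolding plucker_pos_def by metis
  \<comment> \<open>The empty minor is 1 and no column scaling affects it, hence the value 1 at
    \<open>m = 0\<close>.\<close>
  define u where "u m = (if m = 0 then 1 else w m / complex_of_real (cmod (w m)))" for m
  have u: "cmod (u m) = 1" if "m \<le> n" for m using w(1)[OF that] by (simp add: u_def norm_divide)
  then have u0: "u m \<noteq> 0" if "m \<le> n" for m using that by force
  have upos: "0 < u m * plucker g I" if "m \<le> n" "I \<subseteq> {0..<n}" "card I = m" for m I
  proof (cases "m = 0")
    case True
    then have "I = {}" using that finite_subset[of I "{0..<n}"] by auto
    then show ?thesis using True by (simp add: u_def plucker_def row_minor_def det_dim_zero
      less_complex_def)
  next
    case False
    have "u m * plucker g I = (w m * plucker g I) / complex_of_real (cmod (w m))" using False by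
      (simp add: u_def)
    then show ?thesis using w(2)[OF that] w(1)[OF that(1)] by (simp add: less_complex_def)
  qed
  define d where "d j = u (Suc j) / u j" for j
  have d: "d j * cnj (d j) = 1" if "j < n" for j
  proof -
    have "cmod (d j) = 1" using u that by (simp add: d_def norm_divide)
    then show ?thesis by (simp add: complex_norm_square[symmetric])
  qed
  have prod: "(\<Prod>j<m. d j) = u m" if "m \<le> n" for m
    using that
  proof (induction m)
    case (Suc m)
    then show ?case using u0[of m] by (simp add: d_def)
  qed (simp add: u_def)
  have D: "mat_diag n d \<in> carrier_mat n n" by simp
  have "mat_diag n d \<in> unitary_group n"
  proof (rule unitary_groupI[OF D])
    show "mat_adjoint (mat_diag n d) * mat_diag n d = 1\<^sub>m n"
      unfolding mat_adjoint_mat_diag mat_diag_diag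
      using d by (intro eq_matI) (auto simp: mat_diag_def mult.commute)
  qed
  then have un: "g * mat_diag n d \<in> unitary_group n" using g by (rule unitary_group_mult[rotated])
  moreover have "0 < left_justified_minor (g * mat_diag n d) I" if I: "I \<subseteq> {0..<n}" for I
  proof -
    define m where "m = card I"
    have m: "m \<le> n" using card_mono[OF _ I] by (simp add: m_def)
    have det: "det (mat m m (\<lambda>(a, b). mat_diag n d $$ (a, b))) = u m"
    proof -
      have "mat m m (\<lambda>(a, b). mat_diag n d $$ (a, b)) = mat_diag m d"
        using m by (intro eq_matI) (auto simp: mat_diag_def)
      moreover have "det (mat_diag m d) = prod_list (diag_mat (mat_diag m d))"
        by (rule det_upper_triangular[of _ m]) (auto simp: upper_triangular_def mat_diag_def)
      moreover have "diag_mat (mat_diag m d) = map d [0..<m]" by (auto simp: diag_mat_def mat_diag_def)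
      ultimately show ?thesis using prod[OF m] by (simp add: prod.distinct_set_conv_list[symmetric]
        atLeast0LessThan)
    qed
    have "left_justified_minor (g * mat_diag n d) I = plucker (g * mat_diag n d) I"
      unfolding plucker_def by (rule left_justified_minor_eq_row_minor[OF unitary_groupD(1)[OF un] I])
    also have "\<dots> = plucker g I * u m"
      unfolding det[symmetric]
      by (rule plucker_mult_block[OF g' D I m_def[symmetric]]) (use m in \<open>auto simp: mat_diag_def\<close>)
    finally show ?thesis using upos[OF m I] by (simp add: m_def mult.commute)
  qed
  ultimately show ?thesis unfolding unitary_pos_def by blast
qed

section \<open>Minors of the projection\<close>

text \<open>A function of the projection alone, independent of the unitary representative and
  continuous in the entries. Signs of coordinates are read off an orbit point, or off a limit of
  orbit points, through it.\<close>

definition proj_minor :: "nat \<Rightarrow> complex mat \<Rightarrow> nat set \<Rightarrow> nat set \<Rightarrow> complex" where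
  "proj_minor k P I J = det (mat k k (\<lambda>(a, b). P $$ (slist I ! a, slist J ! b)))"

lemma cnj_det: "cnj (det A) = det (map_mat cnj A)"
proof -
  interpret comm_ring_hom cnj by unfold_locales auto
  show ?thesis by (rule hom_det[symmetric])
qed

text \<open>The projection is the frame of the first \<open>k\<close> columns times its adjoint, so
  the minor is a product of two determinants of size \<open>k\<close>.\<close>

lemma proj_minor_eq:
  assumes g: "g \<in> carrier_mat n n" and k: "k \<le> n"
    and I: "I \<subseteq> {0..<n}" "card I = k" and J: "J \<subseteq> {0..<n}" "card J = k"
  shows "proj_minor k (subspace_proj n k g) I J = plucker g I * cnj (plucker g J)"
proof -
  have fin: "finite I" "finite J" using I J finite_subset by blast+
  let ?X = "mat k k (\<lambda>(a, b). g $$ (slist I ! a, b))" and ?Y = "mat k k (\<lambda>(a, b). g $$ (slist J ! a,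
    b))"
  let ?Z = "transpose_mat (map_mat cnj ?Y)"
  have "mat k k (\<lambda>(a, b). subspace_proj n k g $$ (slist I ! a, slist J ! b)) = ?X * ?Z"
  proof (rule eq_matI)
    fix a b assume "a < dim_row (?X * ?Z)" "b < dim_col (?X * ?Z)"
    then have ab: "a < k" "b < k" by auto
    have "(?X * ?Z) $$ (a, b) = (\<Sum>l<k. ?X $$ (a, l) * ?Z $$ (l, b))"
      by (rule mat_mult_entry[of _ k k _ k]) (use ab in auto)
    also have "\<dots> = (\<Sum>l<k. g $$ (slist I ! a, l) * cnj (g $$ (slist J ! b, l)))"
      using ab by (intro sum.cong) auto
    also have "\<dots> = subspace_proj n k g $$ (slist I ! a, slist J ! b)"
      using slist_nth_less[OF I(1), of a] slist_nth_less[OF J(1), of b] I(2) J(2) ab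
      by (intro subspace_proj_entry[OF g k, symmetric]) auto
    finally show "mat k k (\<lambda>(a, b). subspace_proj n k g $$ (slist I ! a, slist J ! b)) $$ (a, b) =
      (?X * ?Z) $$ (a, b)"
      using ab by simp
  qed auto
  then have "proj_minor k (subspace_proj n k g) I J = det ?X * det ?Z"
    unfolding proj_minor_def by (simp add: det_mult[of ?X k ?Z])
  also have "det ?Z = cnj (det ?Y)" unfolding cnj_det by (rule det_transpose[of _ k]) auto
  finally show ?thesis unfolding plucker_eq_det[OF fin(1)] plucker_eq_det[OF fin(2)] I J .
qed

lemma tendsto_det:
  assumes "\<And>i j. i < m \<Longrightarrow> j < m \<Longrightarrow> ((\<lambda>s. f s i j) \<longlongrightarrow> l i j) F"
  shows "((\<lambda>s. det (mat m m (\<lambda>(i, j). f s i j :: complex))) \<longlongrightarrow> det (mat m m (\<lambda>(i, j). l i j))) F"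
proof -
  have det: "det (mat m m (\<lambda>(i, j). f i j)) = (\<Sum>p | p permutes {0..<m}. signof p * (\<Prod>i\<in>{0..<m}. f i
    (p i)))"
    for f :: "nat \<Rightarrow> nat \<Rightarrow> complex"
    by (subst det_def'[of _ m]) (auto intro!: sum.cong prod.cong simp: permutes_in_image[of _
      "{0..<m}", simplified])
  have "p i < m" if "p permutes {0..<m}" "i < m" for p i
    using permutes_in_image[OF that(1), of i] that(2) by simp
  then show ?thesis unfolding det
    by (intro tendsto_sum tendsto_mult tendsto_const tendsto_prod assms) auto
qed

text \<open>If all minors of size \<open>m\<close> vanish, Laplace expansion makes all larger ones
  vanish, up to the determinant.\<close>

lemma exists_plucker_nonzero:
  assumes M: "M \<in> carrier_mat n n" "det M \<noteq> 0" and m: "m \<le> n"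
  shows "\<exists>I. I \<subseteq> {0..<n} \<and> card I = m \<and> plucker M I \<noteq> 0"
proof (rule ccontr)
  assume "\<not> ?thesis"
  then have z: "plucker M I = 0" if "I \<subseteq> {0..<n}" "card I = m" for I using that by blast
  have "plucker M I = 0" if "I \<subseteq> {0..<n}" "card I = m + j" for I j
    using that
  proof (induction j arbitrary: I)
    case 0 then show ?case using z by simp
  next
    case (Suc j)
    have fin: "finite I" using Suc.prems finite_subset by blast
    have "plucker M (I - {i}) = 0" if "i \<in> I" for i
      using Suc.prems that fin by (intro Suc.IH) auto
    then show ?case using plucker_laplace_last_column[OF fin, of "m + j" M] Suc.prems by simp
  qed
  from this[of "{0..<n}" "n - m"] show False using plucker_full[OF M(1)] M m by simp
qed

lemma det_unitary:
  assumes "g \<in> unitary_group n"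
  shows "det g \<noteq> 0"
  using det_mult[of g n "mat_adjoint g"] unitary_groupD[OF assms] by auto

text \<open>Without \<open>w \<noteq> 0\<close> every matrix would qualify.\<close>

definition plucker_nonneg :: "nat \<Rightarrow> nat \<Rightarrow> complex mat \<Rightarrow> bool" where
  "plucker_nonneg n m M \<longleftrightarrow> (\<exists>w. w \<noteq> 0 \<and> (\<forall>I. I \<subseteq> {0..<n} \<and> card I = m \<longrightarrow> 0 \<le> w * plucker M I))"

locale two_eigenvalues =
  fixes n k :: nat and lam :: "nat \<Rightarrow> real"
  assumes k1: "1 \<le> k" and kn: "k \<le> n - 1"
    and lam_low: "\<forall>i<k. lam i = lam 0"
    and lam_gap: "lam (k - 1) > lam k"
    and lam_high: "\<forall>i. k \<le> i \<and> i < n \<longrightarrow> lam i = lam k"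
begin

sublocale square_matrices n .

definition gap :: real where "gap = lam 0 - lam k"

lemma gap_pos: "0 < gap"
  using lam_gap lam_low[rule_format, of "k - 1"] k1 by (simp add: gap_def)

lemma k_less: "k < n" "k \<le> n" "0 < n" using k1 kn by auto

lemma conj_diag_eq:
  assumes g: "g \<in> unitary_group n"
  shows "conj_diag n lam g = (\<i> * lam k) \<cdot>\<^sub>m 1\<^sub>m n + (\<i> * gap) \<cdot>\<^sub>m subspace_proj n k g"
proof -
  note [simp] = unitary_groupD(1)[OF g]
  have "mat_diag n (\<lambda>i. \<i> * complex_of_real (lam i)) = (\<i> * lam k) \<cdot>\<^sub>m 1\<^sub>m n + (\<i> * gap) \<cdot>\<^sub>m kproj n k"
  proof (rule sq_eqI)
    fix i j assume ij: "i < n" "j < n"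
    have "lam i = lam 0" if "i < k" using lam_low that by blast
    moreover have "lam i = lam k" if "\<not> i < k" using lam_high[rule_format, of i] that ij by simp
    ultimately show "mat_diag n (\<lambda>i. \<i> * complex_of_real (lam i)) $$ (i, j) = ((\<i> * lam k) \<cdot>\<^sub>m 1\<^sub>m n
      + (\<i> * gap) \<cdot>\<^sub>m kproj n k) $$ (i, j)"
      using ij by (cases "i < k") (auto simp: mat_diag_def kproj_def gap_def algebra_simps)
  qed auto
  then show ?thesis
    unfolding conj_diag_def subspace_proj_def
    by (simp add: sq_simps unitary_groupD(2)[OF g])
qed

lemma subspace_proj_of_conj_diag:
  assumes g: "g \<in> unitary_group n" and ij: "i < n" "j < n"
  shows "subspace_proj n k g $$ (i, j) = (conj_diag n lam g $$ (i, j) - \<i> * lam k * (if i = j then 1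
    else 0)) / (\<i> * gap)"
proof -
  note P = subspace_proj_facts(1)[OF g, of k]
  have "conj_diag n lam g $$ (i, j) = \<i> * lam k * (if i = j then 1 else 0) + \<i> * gap * subspace_proj
    n k g $$ (i, j)"
    unfolding conj_diag_eq[OF g] using ij P by (auto simp: sq_index)
  then show ?thesis using gap_pos by simp
qed

lemma conj_diag_cong_iff:
  assumes g: "g \<in> unitary_group n" and h: "h \<in> unitary_group n"
  shows "conj_diag n lam g = conj_diag n lam h \<longleftrightarrow> subspace_proj n k g = subspace_proj n k h"
proof
  assume "conj_diag n lam g = conj_diag n lam h"
  then show "subspace_proj n k g = subspace_proj n k h"
    using subspace_proj_of_conj_diag[OF g] subspace_proj_of_conj_diag[OF h]
      subspace_proj_facts(1)[OF g, of k] subspace_proj_facts(1)[OF h, of k]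
    by (intro sq_eqI) auto
qed (simp add: conj_diag_eq g h)

text \<open>A representative with all minors positive is found without moving the span of the first
  \<open>k\<close> columns: \<open>C\<close> arranges the smaller subspaces inside it,
  \<open>M\<close> adds the larger ones, \<open>R\<close> orthonormalizes and \<open>d\<close> fixes
  the phases.\<close>

lemma orbit_pos_of_plucker_pos:
  assumes g: "g \<in> unitary_group n" and pos: "plucker_pos n k g"
  shows "conj_diag n lam g \<in> orbit_pos n lam"
proof -
  note g' = unitary_groupD(1)[OF g]
  obtain C where C: "C \<in> carrier_mat n n" "\<And>m. m \<le> k \<Longrightarrow> plucker_pos n m (g * C)"
    "\<And>c b. k \<le> c \<Longrightarrow> c < n \<Longrightarrow> b < k \<Longrightarrow> C $$ (c, b) = 0"
    using plucker_pos_restrict_all[OF g' k_less(2) pos order_refl] by auto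
  have gC: "g * C \<in> carrier_mat n n" using g' C by simp
  obtain M where M: "M \<in> carrier_mat n n" "\<forall>i<n. \<forall>b<k. M $$ (i, b) = (g * C) $$ (i, b)" "\<And>m. m \<le> n \<Longrightarrow>
    plucker_pos n m M"
    using plucker_pos_extend_all[OF gC, of k "n - k"] C(2) k_less by auto
  obtain R where R: "R \<in> carrier_mat n n" "upper_triangular R" "M * R \<in> unitary_group n" "\<And>m. m \<le> n
    \<Longrightarrow> plucker_pos n m (M * R)"
    using unitary_of_plucker_pos[OF M(1,3)] by auto
  obtain d where d: "M * R * mat_diag n d \<in> unitary_pos n" using unitary_phases[OF R(3,4)] by blast
  define h where "h = M * R * mat_diag n d"
  have h: "h \<in> unitary_group n" using d by (simp add: h_def unitary_pos_def)
  define T where "T = R * mat_diag n d"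
  have T: "T \<in> carrier_mat n n" using R by (simp add: T_def)
  have "T $$ (c, b) = 0" if "k \<le> c" "c < n" "b < k" for c b
    using that R upper_triangularD[OF R(2), of b c] k_less by (simp add: T_def
      mat_diag_mult_right[of _ n])
  note TK = block_mult_kproj[OF T this, of k, simplified]
  note CK = block_mult_kproj[OF C(1) C(3), of k, simplified]
  let ?K = "kproj n k"
  \<comment> \<open>\<open>M\<close> and \<open>g * C\<close> agree in the first \<open>k\<close>
    columns, which are the ones that \<open>?K\<close> keeps.\<close>
  have MK: "M * ?K = g * (C * ?K)"
  proof -
    have "M * ?K = (g * C) * ?K"
      using M(1,2) gC by (intro sq_eqI) (auto simp: mult_kproj_index simp del: index_mult_mat(1))
    then show ?thesis using g' C by (simp add: sq_simps)
  qed
  have "h * ?K = M * (T * ?K)" using M R by (simp add: h_def T_def sq_simps)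
  also have "\<dots> = M * (?K * (T * ?K))" using TK by simp
  also have "\<dots> = (M * ?K) * (T * ?K)" using M T by (simp add: sq_simps)
  also have "\<dots> = g * ((C * ?K) * (T * ?K))" unfolding MK using g' C T by (simp add: sq_simps)
  also have "\<dots> = g * ((?K * (C * ?K)) * (T * ?K))" using CK by simp
  also have "\<dots> = g * (?K * ((C * ?K * T) * ?K))" using g' C T by (simp add: sq_simps)
  finally have "h * ?K = g * (?K * ((C * ?K * T) * ?K))" .
  then have "subspace_proj n k h = subspace_proj n k g"
    by (rule subspace_proj_eqI[OF g h, rotated]) (use C T in simp)
  then have "conj_diag n lam g = conj_diag n lam h" using conj_diag_cong_iff[OF g h] by simp
  then show ?thesis using d by (auto simp: orbit_pos_def h_def)
qed

text \<open>Products of a coordinate with a conjugate coordinate agree for \<open>g\<close> and for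
  the positive representative. The conjugate of the coordinate of \<open>{0..<k}\<close> can
  therefore be taken as the common factor.\<close>

lemma plucker_pos_of_orbit_pos:
  assumes g: "g \<in> unitary_group n" and L: "conj_diag n lam g \<in> orbit_pos n lam"
  shows "plucker_pos n k g"
proof -
  obtain h where h: "h \<in> unitary_pos n" "conj_diag n lam g = conj_diag n lam h"
    using L by (auto simp: orbit_pos_def)
  then have hu: "h \<in> unitary_group n" by (simp add: unitary_pos_def)
  have P: "subspace_proj n k g = subspace_proj n k h" using h(2) conj_diag_cong_iff[OF g hu] by simp
  have h_pos: "0 < plucker h I" if "I \<subseteq> {0..<n}" for I
    using h(1) that unfolding plucker_def left_justified_minor_eq_row_minor[OF unitary_groupD(1)[OF
      hu] that, symmetric]
    by (simp add: unitary_pos_def)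
  have eq: "plucker g I * cnj (plucker g J) = plucker h I * cnj (plucker h J)"
    if "I \<subseteq> {0..<n}" "card I = k" "J \<subseteq> {0..<n}" "card J = k" for I J
    using proj_minor_eq[OF unitary_groupD(1)[OF g] k_less(2) that] proj_minor_eq[OF
      unitary_groupD(1)[OF hu] k_less(2) that] P by simp
  let ?J = "{0..<k}"
  have J: "?J \<subseteq> {0..<n}" "card ?J = k" using k_less by auto
  have pos: "0 < cnj (plucker g ?J) * plucker g I" if I: "I \<subseteq> {0..<n}" "card I = k" for I
    using eq[OF I J] h_pos[OF I(1)] h_pos[OF J(1)] by (simp add: mult.commute less_complex_def)
  moreover have "cnj (plucker g ?J) \<noteq> 0" using pos[OF J] by auto
  ultimately show ?thesis unfolding plucker_pos_def by blast
qed

text \<open>Positive minors of the approximating projections become nonnegative in the limit. A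
  coordinate that is nonzero for \<open>g\<close> supplies the common factor.\<close>

lemma plucker_nonneg_of_orbit_nonneg:
  assumes g: "g \<in> unitary_group n" and L: "conj_diag n lam g \<in> orbit_nonneg n lam"
  shows "plucker_nonneg n k g"
proof -
  note g' = unitary_groupD(1)[OF g]
  obtain B where B: "\<And>m. B m \<in> orbit_pos n lam"
    "\<And>i j. i < n \<Longrightarrow> j < n \<Longrightarrow> (\<lambda>m. B m $$ (i, j)) \<longlonglongrightarrow> conj_diag n lam g $$ (i, j)"
    using L unfolding orbit_nonneg_def mat_closure_def by blast
  have "\<forall>m. \<exists>h. h \<in> unitary_pos n \<and> B m = conj_diag n lam h"
    using B(1) by (auto simp: orbit_pos_def)
  then obtain h where "\<forall>m. h m \<in> unitary_pos n \<and> B m = conj_diag n lam (h m)"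
    by (rule choice[THEN exE])
  then have h: "\<And>m. h m \<in> unitary_pos n" "\<And>m. B m = conj_diag n lam (h m)" by blast+
  have hu: "h m \<in> unitary_group n" for m using h(1)[of m] by (simp add: unitary_pos_def)
  have h_pos: "0 < plucker (h m) I" if "I \<subseteq> {0..<n}" for I m
    using h(1)[of m] that unfolding plucker_def left_justified_minor_eq_row_minor[OF
      unitary_groupD(1)[OF hu] that, symmetric]
    by (simp add: unitary_pos_def)
  have lim: "(\<lambda>m. subspace_proj n k (h m) $$ (i, j)) \<longlonglongrightarrow> subspace_proj n k g $$ (i, j)" if "i < n" "j
    < n" for i j
    unfolding subspace_proj_of_conj_diag[OF hu that] subspace_proj_of_conj_diag[OF g that]
      h(2)[symmetric]
    using gap_pos by (intro tendsto_intros B that) auto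
  have nonneg: "0 \<le> plucker g I * cnj (plucker g J)"
    if I: "I \<subseteq> {0..<n}" "card I = k" and J: "J \<subseteq> {0..<n}" "card J = k" for I J
  proof -
    have lim': "(\<lambda>m. proj_minor k (subspace_proj n k (h m)) I J) \<longlonglongrightarrow> proj_minor k (subspace_proj n k
      g) I J"
      unfolding proj_minor_def
      using slist_nth_less[OF I(1)] slist_nth_less[OF J(1)] I(2) J(2) by (intro tendsto_det lim) auto
    have pos: "0 < proj_minor k (subspace_proj n k (h m)) I J" for m
      unfolding proj_minor_eq[OF unitary_groupD(1)[OF hu] k_less(2) I J]
      using h_pos[OF I(1), of m] h_pos[OF J(1), of m] by (simp add: less_complex_def)
    have "0 \<le> Re (proj_minor k (subspace_proj n k g) I J)"
      by (rule LIMSEQ_le_const[OF tendsto_Re[OF lim']]) (use pos in \<open>auto simp: less_complex_def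
        less_imp_le\<close>)
    moreover have "(\<lambda>m. Im (proj_minor k (subspace_proj n k (h m)) I J)) \<longlonglongrightarrow> 0"
      using pos by (simp add: less_complex_def)
    then have "Im (proj_minor k (subspace_proj n k g) I J) = 0"
      using LIMSEQ_unique tendsto_Im[OF lim'] by blast
    ultimately show ?thesis
      unfolding proj_minor_eq[OF g' k_less(2) I J] by (simp add: less_eq_complex_def)
  qed
  obtain J where J: "J \<subseteq> {0..<n}" "card J = k" "plucker g J \<noteq> 0"
    using exists_plucker_nonzero[OF g' det_unitary[OF g] k_less(2)] by blast
  have "0 \<le> cnj (plucker g J) * plucker g I" if "I \<subseteq> {0..<n}" "card I = k" for I
    using nonneg[OF that J(1,2)] by (simp add: mult.commute)
  moreover have "cnj (plucker g J) \<noteq> 0" using J by simp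
  ultimately show ?thesis unfolding plucker_nonneg_def by blast
qed

end

lemma (in square_matrices) sq_uminus:
  fixes A B :: "complex mat"
  assumes "A \<in> carrier_mat n n" "B \<in> carrier_mat n n"
  shows "- A * B = - (A * B)" "A * - B = - (A * B)"
  using assms by auto

section \<open>The flow of a Hermitian matrix on projections\<close>

text \<open>The velocity at \<open>t = 0\<close> of the projection onto \<open>exp (t A) V\<close>, where \<open>P\<close> projects onto \<open>V\<close>.\<close>

definition flow_field :: "complex mat \<Rightarrow> complex mat \<Rightarrow> complex mat" where
  "flow_field A P = A * P + P * A - 2 \<cdot>\<^sub>m (P * (A * P))"

lemma unitary_entry_bound:
  assumes g: "g \<in> unitary_group n" and ij: "i < n" "j < n"
  shows "cmod (g $$ (i, j)) \<le> 1"
proof -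
  note g' = unitary_groupD(1)[OF g]
  have "(\<Sum>l<n. g $$ (i, l) * mat_adjoint g $$ (l, i)) = 1"
    using mat_mult_entry[of g n n "mat_adjoint g" n i i] unitary_groupD(2)[OF g] g' ij by simp
  then have "(\<Sum>l<n. g $$ (i, l) * cnj (g $$ (i, l))) = 1" using g' ij by simp
  then have "complex_of_real (\<Sum>l<n. (cmod (g $$ (i, l)))\<^sup>2) = 1"
    by (simp add: complex_norm_square del: of_real_power)
  then have "(\<Sum>l<n. (cmod (g $$ (i, l)))\<^sup>2) = 1" using of_real_eq_1_iff by blast
  moreover have "(cmod (g $$ (i, j)))\<^sup>2 \<le> (\<Sum>l<n. (cmod (g $$ (i, l)))\<^sup>2)"
    using ij by (intro member_le_sum) auto
  ultimately show ?thesis using power2_le_imp_le[of "cmod (g $$ (i, j))" 1] by simp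
qed

text \<open>Bounds the coefficients of the linear system in \<open>flow_transport\<close> uniformly
  in time, whatever representatives have been picked.\<close>

lemma subspace_proj_entry_bound:
  assumes g: "g \<in> unitary_group n" and k: "k \<le> n" and ij: "i < n" "j < n"
  shows "cmod (subspace_proj n k g $$ (i, j)) \<le> real k"
proof -
  have "cmod (subspace_proj n k g $$ (i, j)) \<le> (\<Sum>l<k. cmod (g $$ (i, l) * cnj (g $$ (j, l))))"
    unfolding subspace_proj_entry[OF unitary_groupD(1)[OF g] k ij] by (rule norm_sum)
  also have "\<dots> \<le> (\<Sum>l<k. 1)"
    using unitary_entry_bound[OF g] ij k by (intro sum_mono) (auto simp: norm_mult intro!: mult_le_one)
  finally show ?thesis by simp
qed

lemma has_mat_derivative_one_minus:
  assumes "\<And>s. P s \<in> carrier_mat n n" "P' \<in> carrier_mat n n" "has_mat_derivative n P P' t"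
  shows "has_mat_derivative n (\<lambda>s. 1\<^sub>m n - P s) (- P') t"
  unfolding has_mat_derivative_def
proof (intro allI impI)
  fix i j assume ij: "i < n" "j < n"
  have "((\<lambda>s. 1\<^sub>m n $$ (i, j) - P s $$ (i, j)) has_vector_derivative (0 - P' $$ (i, j))) (at t)"
    by (intro has_vector_derivative_diff has_vector_derivative_const has_mat_derivativeD[OF assms(3)
      ij])
  then show "((\<lambda>s. (1\<^sub>m n - P s) $$ (i, j)) has_vector_derivative (- P') $$ (i, j)) (at t)"
    using ij assms(2) carrier_matD[OF assms(1)] by simp
qed

text \<open>The columns of \<open>(1 - P(t)) exp (t A) V\<close> solve a linear system with initial value zero.\<close>

lemma flow_transport:
  assumes A: "A \<in> carrier_mat n n" and k: "k \<le> n" and h: "\<And>s. h s \<in> unitary_group n"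
    and der: "\<And>s. has_mat_derivative n (\<lambda>s. subspace_proj n k (h s)) (flow_field A (subspace_proj n
      k (h s))) s"
    and t: "0 \<le> t"
  shows "subspace_proj n k (h t) * (mexp A t * (h 0 * kproj n k)) = mexp A t * (h 0 * kproj n k)"
proof -
  interpret square_matrices n .
  define P where "P s = subspace_proj n k (h s)" for s
  define G where "G = h 0 * kproj n k"
  have P [simp]: "P s \<in> carrier_mat n n" for s unfolding P_def by (rule subspace_proj_facts(1)[OF h])
  have G [simp]: "G \<in> carrier_mat n n" using unitary_groupD(1)[OF h] by (simp add: G_def)
  note [simp] = A
  define Y where "Y s = (1\<^sub>m n - P s) * (mexp A s * G)" for s
  have Y [simp]: "Y s \<in> carrier_mat n n" for s by (simp add: Y_def)
  \<comment> \<open>With \<open>P = P s\<close>, the derivative of \<open>Y\<close> is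
    \<open>(A - P A - (A P + P A - 2 P A P)) (mexp A s * G)\<close>, and the first factor equals
    \<open>(A - 2 P A) (1 - P)\<close>.\<close>
  define M where "M s = A - 2 \<cdot>\<^sub>m (P s * A)" for s
  have M [simp]: "M s \<in> carrier_mat n n" for s by (simp add: M_def)
  have F: "flow_field A (P s) \<in> carrier_mat n n" for s by (simp add: flow_field_def)
  have dY: "has_mat_derivative n Y (M s * Y s) s" for s
  proof -
    have "has_mat_derivative n Y (- flow_field A (P s) * (mexp A s * G) + (1\<^sub>m n - P s) * ((A * mexp
      A s) * G)) s"
      unfolding Y_def
      by (intro has_mat_derivative_mult has_mat_derivative_one_minus has_mat_derivative_mult_const
        mexp_derivative)
        (use der F in \<open>auto simp: P_def[symmetric]\<close>)
    also have "- flow_field A (P s) * (mexp A s * G) + (1\<^sub>m n - P s) * ((A * mexp A s) * G) = M s * Y s"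
      unfolding flow_field_def Y_def M_def
      by (rule sq_eqI) (simp_all add: sq_simps sq_uminus sq_index algebra_simps del: index_mult_mat(1))
    finally show ?thesis .
  qed
  define B where "B = (\<Sum>i<n. \<Sum>j<n. cmod (A $$ (i, j)))"
  have B: "cmod (A $$ (i, j)) \<le> B" if "i < n" "j < n" for i j
  proof -
    have "cmod (A $$ (i, j)) \<le> (\<Sum>j<n. cmod (A $$ (i, j)))" using that by (intro member_le_sum) auto
    also have "\<dots> \<le> B" unfolding B_def using that
      by (intro member_le_sum[of i "{..<n}" "\<lambda>i. \<Sum>j<n. cmod (A $$ (i, j))"]) (auto intro: sum_nonneg)
    finally show ?thesis .
  qed
  have bound: "cmod (M s $$ (i, j)) \<le> B + 2 * (\<Sum>l<n. real k * B)" if ij: "i < n" "j < n" for s i j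
  proof -
    have "cmod ((P s * A) $$ (i, j)) \<le> (\<Sum>l<n. cmod (P s $$ (i, l) * A $$ (l, j)))"
      unfolding mat_mult_entry[OF P A ij] by (rule norm_sum)
    also have "\<dots> \<le> (\<Sum>l<n. real k * B)"
      using B ij subspace_proj_entry_bound[OF h k] unfolding P_def
      by (intro sum_mono) (auto simp: norm_mult intro!: mult_mono)
    finally have 1: "cmod ((P s * A) $$ (i, j)) \<le> (\<Sum>l<n. real k * B)" .
    have "M s $$ (i, j) = A $$ (i, j) - 2 * (P s * A) $$ (i, j)"
      unfolding M_def using ij by (simp add: sq_index del: index_mult_mat(1))
    then have "cmod (M s $$ (i, j)) \<le> cmod (A $$ (i, j)) + cmod (2 * (P s * A) $$ (i, j))"
      by (simp only: norm_triangle_ineq4)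
    then show ?thesis using 1 B[OF ij] by (simp add: norm_mult del: index_mult_mat(1))
  qed
  have "Y t $$ (i, j) = 0" if ij: "i < n" "j < n" for i j
  proof (rule linear_system_zero[where y = "\<lambda>i s. Y s $$ (i, j)" and S = "{..<n}" and M = "\<lambda>s i j. M
    s $$ (i, j)"])
    show "((\<lambda>s. Y s $$ (i, j)) has_vector_derivative (\<Sum>l<n. M s $$ (i, l) * Y s $$ (l, j))) (at s)"
      if "i \<in> {..<n}" for i s
      using has_mat_derivativeD[OF dY, of i j s] that ij mat_mult_entry[OF M Y, of i j s s] by simp
    have "P 0 * G = G" unfolding P_def G_def by (rule subspace_proj_facts(4)[OF h])
    then have "Y 0 = 0\<^sub>m n n"
      unfolding Y_def by (simp add: mexp_zero[OF A] sq_simps)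
    then show "Y 0 $$ (i, j) = 0" if "i \<in> {..<n}" for i using that ij by simp
  qed (use t ij bound in auto)
  then have "Y t = 0\<^sub>m n n" by (intro sq_eqI) auto
  then have e: "mexp A t * G - P t * (mexp A t * G) = 0\<^sub>m n n" by (simp add: Y_def sq_simps)
  show ?thesis unfolding P_def[symmetric] G_def[symmetric]
  proof (rule sq_eqI)
    fix i j assume ij: "i < n" "j < n"
    have "(mexp A t * G - P t * (mexp A t * G)) $$ (i, j) = 0" using e ij by simp
    then show "(P t * (mexp A t * G)) $$ (i, j) = (mexp A t * G) $$ (i, j)"
      using ij by (simp add: sq_index del: index_mult_mat(1))
  qed simp_all
qed

lemma det_mexp:
  assumes "A \<in> carrier_mat n n"
  shows "det (mexp A t) \<noteq> 0"
  using det_mult[of "mexp A (- t)" n "mexp A t"] mexp_minus_mult[OF assms, of t] assms by auto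

text \<open>The first \<open>k\<close> columns of \<open>mexp A t * h 0\<close> and of
  \<open>h t\<close> span the same subspace; \<open>c\<close> is the determinant of the change of
  basis, nonzero because an invertible matrix has a nonzero minor of size \<open>k\<close>.
  Questions about \<open>h t\<close> thereby turn into questions about a matrix that is
  differentiable in \<open>t\<close>.\<close>

lemma flow_transport_plucker:
  assumes A: "A \<in> carrier_mat n n" and k: "k \<le> n" and h: "\<And>s. h s \<in> unitary_group n"
    and der: "\<And>s. has_mat_derivative n (\<lambda>s. subspace_proj n k (h s)) (flow_field A (subspace_proj n
      k (h s))) s"
    and t: "0 \<le> t"
  shows "\<exists>c. c \<noteq> 0 \<and> (\<forall>I. I \<subseteq> {0..<n} \<and> card I = k \<longrightarrow> plucker (mexp A t * h 0) I = c * plucker (h t) I)"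
proof -
  interpret square_matrices n .
  let ?K = "kproj n k"
  note [simp] = A unitary_groupD(1)[OF h]
  define Z where "Z = ?K * (mat_adjoint (h t) * (mexp A t * (h 0 * ?K)))"
  have Z: "Z \<in> carrier_mat n n" by (simp add: Z_def)
  have e: "mexp A t * (h 0 * ?K) = h t * Z"
    using flow_transport[OF A k h der t] by (simp add: Z_def subspace_proj_def sq_simps)
  define c where "c = det (mat k k (\<lambda>(a, b). Z $$ (a, b)))"
  have Z_block: "Z $$ (c, b) = 0" if "k \<le> c" "c < n" "b < k" for c b
    unfolding Z_def by (subst kproj_mult_index) (use that k in auto)
  have eq: "plucker (mexp A t * h 0) I = c * plucker (h t) I" if I: "I \<subseteq> {0..<n}" "card I = k" for I
  proof -
    have "plucker (mexp A t * h 0) I = plucker ((mexp A t * h 0) * ?K) I"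
      using I k by (intro plucker_cong[OF I(1)]) (simp add: mult_kproj_index del: index_mult_mat(1))
    also have "(mexp A t * h 0) * ?K = h t * Z" using e by (simp add: sq_simps)
    also have "plucker (h t * Z) I = plucker (h t) I * c"
      unfolding c_def by (rule plucker_mult_block[OF _ Z I Z_block]) simp_all
    finally show ?thesis by simp
  qed
  have "det (mexp A t * h 0) \<noteq> 0"
    using det_mult[of "mexp A t" n "h 0"] det_mexp[OF A, of t] det_unitary[OF h, of 0] by simp
  then obtain I where "I \<subseteq> {0..<n}" "card I = k" "plucker (mexp A t * h 0) I \<noteq> 0"
    using exists_plucker_nonzero[of "mexp A t * h 0" n k] k by auto
  then have "c \<noteq> 0" using eq by auto
  then show ?thesis using eq by blast
qed

text \<open>The projection onto the column space of a frame \<open>F\<close> is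
  \<open>F * inverse (mat_adjoint F * F) * mat_adjoint F\<close>. Here \<open>W\<close> is the
  inverse Gram matrix of the first \<open>k\<close> columns, padded by the identity to size
  \<open>n\<close>. This expression can be differentiated in \<open>F\<close>, whereas the unitary
  \<open>h\<close> is only known to exist.\<close>

lemma flow_point:
  assumes F: "F \<in> carrier_mat n n" "det F \<noteq> 0"
  shows "\<exists>h W Z. h \<in> unitary_group n \<and> W \<in> carrier_mat n n \<and> Z \<in> carrier_mat n n \<and>
    h * kproj n k = F * (kproj n k * (Z * kproj n k)) \<and>
    W * (kproj n k * (mat_adjoint F * (F * kproj n k)) + (1\<^sub>m n - kproj n k)) = 1\<^sub>m n \<and>
    (kproj n k * (mat_adjoint F * (F * kproj n k)) + (1\<^sub>m n - kproj n k)) * W = 1\<^sub>m n \<and>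
    subspace_proj n k h = F * (kproj n k * (W * (kproj n k * mat_adjoint F)))"
proof -
  interpret square_matrices n .
  let ?K = "kproj n k"
  obtain R where R: "R \<in> carrier_mat n n" "upper_triangular R" "F * R \<in> unitary_group n"
    using qr_decomposition[OF F] by blast
  note [simp] = F(1) R(1)
  define h where "h = F * R"
  have h: "h \<in> unitary_group n" using R by (simp add: h_def)
  note [simp] = unitary_groupD(1)[OF h]
  have "R $$ (c, b) = 0" if "k \<le> c" "c < n" "b < k" for c b
    using upper_triangularD[OF R(2), of b c] that carrier_matD[OF R(1)] by simp
  note RK = block_mult_kproj[OF R(1) this, of k, simplified]
  define S where "S = ?K * (R * ?K)"
  have S [simp]: "S \<in> carrier_mat n n" by (simp add: S_def)
  have KS: "?K * S = S" by (simp add: S_def kproj_mult_left)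
  have SK: "S * ?K = S" by (simp add: S_def sq_simps)
  have KSa: "?K * mat_adjoint S = mat_adjoint S" using SK mat_adjoint_mult[OF S kproj_simps(1)[of n
    k]] by simp
  have SaK: "mat_adjoint S * ?K = mat_adjoint S" using KS mat_adjoint_mult[OF kproj_simps(1)[of n k]
    S] by simp
  have SaKx: "mat_adjoint S * (?K * X) = mat_adjoint S * X" if "X \<in> carrier_mat n n" for X
    using that SaK assoc_mult_mat[of "mat_adjoint S" n n ?K n X n] by simp
  have hK: "h * ?K = F * S" using RK by (simp add: h_def S_def sq_simps)
  have Kh: "?K * mat_adjoint h = mat_adjoint S * mat_adjoint F"
    using arg_cong[OF hK, of mat_adjoint] by (simp add: mat_adjoint_mult[of _ n n _ n])
  define N where "N = ?K * (mat_adjoint F * (F * ?K))"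
  have N [simp]: "N \<in> carrier_mat n n" by (simp add: N_def)
  have KN: "?K * N = N" by (simp add: N_def kproj_mult_left)
  have NK: "N * ?K = N" by (simp add: N_def sq_simps)
  have hh: "mat_adjoint h * (h * X) = X" if "X \<in> carrier_mat n n" for X
    using that assoc_mult_mat[of "mat_adjoint h" n n h n X n] unitary_groupD(3)[OF h] by (simp add:
      sq_simps(8))
  \<comment> \<open>Orthonormality of the columns of \<open>F * S\<close> reads
    \<open>mat_adjoint S * N * S = ?K\<close>, so \<open>X\<close> is a left inverse of
    \<open>S\<close> on the block.\<close>
  define X where "X = mat_adjoint S * N"
  have X [simp]: "X \<in> carrier_mat n n" by (simp add: X_def)
  have XS: "X * S = ?K"
  proof -
    have "X * S = (mat_adjoint S * mat_adjoint F) * (F * S)"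
      by (simp add: X_def N_def sq_simps KS SaKx)
    also have "\<dots> = (?K * mat_adjoint h) * (h * ?K)" by (simp only: hK Kh)
    also have "\<dots> = ?K" by (simp add: sq_simps hh)
    finally show ?thesis .
  qed
  have XK: "X * ?K = X" by (simp add: X_def sq_simps NK)
  have "(X + (1\<^sub>m n - ?K)) * (S + (1\<^sub>m n - ?K)) = 1\<^sub>m n"
    by (simp add: sq_simps XS XK KS) (rule sq_eqI; simp add: sq_index)
  then have "(S + (1\<^sub>m n - ?K)) * (X + (1\<^sub>m n - ?K)) = 1\<^sub>m n"
    using mat_mult_left_right_inverse[of "X + (1\<^sub>m n - ?K)" n "S + (1\<^sub>m n - ?K)"] by simp
  moreover have KX: "?K * X = X" using KSa assoc_mult_mat[of ?K n n "mat_adjoint S" n N n] by (simp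
    add: X_def)
  have "(S + (1\<^sub>m n - ?K)) * (X + (1\<^sub>m n - ?K)) = S * X + (1\<^sub>m n - ?K)"
    by (simp add: sq_simps SK KX) (rule sq_eqI; simp add: sq_index)
  ultimately have e: "S * X + (1\<^sub>m n - ?K) = 1\<^sub>m n" by simp
  have SX: "S * X = ?K"
  proof (rule sq_eqI)
    fix i j assume ij: "i < n" "j < n"
    have "(S * X + (1\<^sub>m n - ?K)) $$ (i, j) = 1\<^sub>m n $$ (i, j)" using e by simp
    then show "(S * X) $$ (i, j) = ?K $$ (i, j)" using ij by (simp add: sq_index del:
      index_mult_mat(1) index_one_mat(1))
  qed simp_all
  \<comment> \<open>The same identity makes \<open>S * mat_adjoint S\<close> the inverse of the Gram
    matrix \<open>N\<close> on the block.\<close>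
  define W where "W = S * mat_adjoint S + (1\<^sub>m n - ?K)"
  have W [simp]: "W \<in> carrier_mat n n" by (simp add: W_def)
  have WM: "W * (N + (1\<^sub>m n - ?K)) = 1\<^sub>m n"
    unfolding W_def using SX[unfolded X_def]
    by (simp add: sq_simps KN SaK) (rule sq_eqI; simp add: sq_index)
  then have MW: "(N + (1\<^sub>m n - ?K)) * W = 1\<^sub>m n"
    using mat_mult_left_right_inverse[of W n "N + (1\<^sub>m n - ?K)"] by simp
  have KWK: "?K * (W * ?K) = S * mat_adjoint S"
  proof -
    have "?K * (S * mat_adjoint S) = S * mat_adjoint S"
      using KS assoc_mult_mat[of ?K n n S n "mat_adjoint S" n] by simp
    then show ?thesis unfolding W_def
      by (simp add: sq_simps SaK) (rule sq_eqI; simp add: sq_index)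
  qed
  have "subspace_proj n k h = (h * ?K) * (?K * mat_adjoint h)"
    by (simp add: subspace_proj_def sq_simps kproj_mult_left)
  also have "\<dots> = F * ((S * mat_adjoint S) * mat_adjoint F)" unfolding hK Kh by (simp add: sq_simps)
  also have "\<dots> = F * (?K * (W * (?K * mat_adjoint F)))" unfolding KWK[symmetric] by (simp add: sq_simps)
  finally show ?thesis
    using h W WM MW hK R(1) unfolding N_def S_def by blast
qed

text \<open>The frame \<open>F t = mexp A t * g\<close> is differentiable, hence so is its
  projection in Gram matrix form. The representatives \<open>h t\<close> are picked pointwise and no
  regularity is claimed for them.\<close>

lemma flow_exists:
  assumes A: "A \<in> carrier_mat n n" "mat_adjoint A = A" and g: "g \<in> unitary_group n"
  shows "\<exists>h. h 0 = g \<and> (\<forall>t. h t \<in> unitary_group n) \<and>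
    (\<forall>t. has_mat_derivative n (\<lambda>s. subspace_proj n k (h s)) (flow_field A (subspace_proj n k (h t))) t)"
proof -
  interpret square_matrices n .
  let ?K = "kproj n k"
  note [simp] = A(1) unitary_groupD(1)[OF g]
  define F where "F t = mexp A t * g" for t
  have F [simp]: "F t \<in> carrier_mat n n" for t by (simp add: F_def)
  have Fa: "mat_adjoint (F t) = mat_adjoint g * mexp A t" for t
    by (simp add: F_def mat_adjoint_mult[of _ n n _ n] mexp_hermitian[OF A])
  have detF: "det (F t) \<noteq> 0" for t
    unfolding F_def using det_mult[of "mexp A t" n g] det_mexp[OF A(1), of t] det_unitary[OF g] by simp
  define M where "M t = ?K * (mat_adjoint (F t) * (F t * ?K)) + (1\<^sub>m n - ?K)" for t
  have M [simp]: "M t \<in> carrier_mat n n" for t by (simp add: M_def)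
  \<comment> \<open>The three witnesses are packed into one tuple so that a single choice turns them
    into functions of \<open>t\<close>.\<close>
  have "\<forall>t. \<exists>x. fst x \<in> unitary_group n \<and> fst (snd x) \<in> carrier_mat n n \<and> snd (snd x) \<in> carrier_mat
    n n \<and>
    fst x * ?K = F t * (?K * (snd (snd x) * ?K)) \<and>
    fst (snd x) * M t = 1\<^sub>m n \<and> M t * fst (snd x) = 1\<^sub>m n \<and>
    subspace_proj n k (fst x) = F t * (?K * (fst (snd x) * (?K * mat_adjoint (F t))))"
    using flow_point[of "F _" n k, OF F detF] unfolding M_def by simp
  then obtain x where x: "\<forall>t. fst (x t) \<in> unitary_group n \<and> fst (snd (x t)) \<in> carrier_mat n n \<and> snd
    (snd (x t)) \<in> carrier_mat n n \<and>
    fst (x t) * ?K = F t * (?K * (snd (snd (x t)) * ?K)) \<and>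
    fst (snd (x t)) * M t = 1\<^sub>m n \<and> M t * fst (snd (x t)) = 1\<^sub>m n \<and>
    subspace_proj n k (fst (x t)) = F t * (?K * (fst (snd (x t)) * (?K * mat_adjoint (F t))))"
    by (rule choice[THEN exE])
  define h W Z where "h t = fst (x t)" and "W t = fst (snd (x t))" and "Z t = snd (snd (x t))" for t
  have h: "h t \<in> unitary_group n" and W [simp]: "W t \<in> carrier_mat n n" and Z: "Z t \<in> carrier_mat n n"
    and hK: "h t * ?K = F t * (?K * (Z t * ?K))" and WM: "W t * M t = 1\<^sub>m n" and MW: "M t * W t = 1\<^sub>m n"
    and P: "subspace_proj n k (h t) = F t * (?K * (W t * (?K * mat_adjoint (F t))))" for t
    using x unfolding h_def W_def Z_def by blast+
  have dF: "has_mat_derivative n F (A * F t) t" for t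
    using has_mat_derivative_mult_const[OF unitary_groupD(1)[OF g] _ _ mexp_derivative[OF A(1)], of t]
    by (simp add: F_def[abs_def] sq_simps)
  have dFa: "has_mat_derivative n (\<lambda>s. mat_adjoint (F s)) (mat_adjoint (F t) * A) t" for t
  proof -
    have "mat_adjoint g * (A * mexp A t) = mat_adjoint g * mexp A t * A"
      by (simp add: sq_simps mexp_commute[OF A(1), symmetric])
    then show ?thesis unfolding Fa
      using has_mat_derivative_const_mult[of "mat_adjoint g" n "mexp A" "A * mexp A t" t]
        mexp_derivative[OF A(1), of t]
      by simp
  qed
  have dM: "has_mat_derivative n M (?K * (mat_adjoint (F t) * A * (F t * ?K) + mat_adjoint (F t) *
    (A * F t * ?K)) + 0\<^sub>m n n) t" for t
    unfolding M_def
    by (intro has_mat_derivative_add has_mat_derivative_const has_mat_derivative_const_mult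
      has_mat_derivative_mult
        has_mat_derivative_mult_const dF dFa) simp_all
  define M' where "M' t = ?K * (mat_adjoint (F t) * A * (F t * ?K) + mat_adjoint (F t) * (A * F t *
    ?K)) + 0\<^sub>m n n" for t
  have M' [simp]: "M' t \<in> carrier_mat n n" for t by (simp add: M'_def)
  have dW: "has_mat_derivative n W (- (W t * M' t * W t)) t" for t
    by (rule inverse_mat_derivative[OF M M' dM[folded M'_def] W WM MW])
  have dP: "has_mat_derivative n (\<lambda>s. subspace_proj n k (h s)) (flow_field A (subspace_proj n k (h
    t))) t" for t
  proof -
    have "has_mat_derivative n (\<lambda>s. F s * (?K * (W s * (?K * mat_adjoint (F s)))))
      (A * F t * (?K * (W t * (?K * mat_adjoint (F t)))) +
        F t * (?K * ((- (W t * M' t * W t)) * (?K * mat_adjoint (F t)) + W t * (?K * (mat_adjoint (F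
          t) * A))))) t"
      by (intro has_mat_derivative_mult has_mat_derivative_const_mult dF dFa dW) simp_all
    \<comment> \<open>The two moving frames contribute \<open>A P\<close> and \<open>P A\<close>;
      the derivative of the inverse Gram matrix contributes \<open>- 2 P A P\<close>.\<close>
    also have "A * F t * (?K * (W t * (?K * mat_adjoint (F t)))) +
        F t * (?K * ((- (W t * M' t * W t)) * (?K * mat_adjoint (F t)) + W t * (?K * (mat_adjoint (F
          t) * A)))) =
        flow_field A (F t * (?K * (W t * (?K * mat_adjoint (F t)))))"
      unfolding flow_field_def M'_def
      by (rule sq_eqI) (simp_all add: sq_simps sq_uminus sq_index algebra_simps del: index_mult_mat(1))
    finally show ?thesis unfolding P .
  qed
  \<comment> \<open>The representative picked at time 0 spans the same subspace as \<open>g\<close>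
    but may differ from it, so it is replaced by \<open>g\<close>.\<close>
  define h' where "h' t = (if t = 0 then g else h t)" for t :: real
  have "F 0 = g" by (simp add: F_def mexp_zero[OF A(1)] sq_simps)
  then have "subspace_proj n k (h 0) = subspace_proj n k g"
    using hK[of 0] by (intro subspace_proj_eqI[OF g h Z]) simp
  then have Ph': "subspace_proj n k (h' t) = subspace_proj n k (h t)" for t by (simp add: h'_def)
  show ?thesis
    by (rule exI[of _ h']) (use h g dP in \<open>auto simp: Ph'\<close>, auto simp: h'_def)
qed

section \<open>The linear system for the minors\<close>

definition ksubsets :: "nat \<Rightarrow> nat \<Rightarrow> nat set set" where
  "ksubsets n k = {I. I \<subseteq> {0..<n} \<and> card I = k}"

lemma finite_ksubsets [simp]: "finite (ksubsets n k)"
  unfolding ksubsets_def by (rule finite_subset[of _ "Pow {0..<n}"]) auto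

lemma ksubsetsD: "I \<in> ksubsets n k \<Longrightarrow> I \<subseteq> {0..<n}" "I \<in> ksubsets n k \<Longrightarrow> card I = k"
  "I \<in> ksubsets n k \<Longrightarrow> finite I"
  by (auto simp: ksubsets_def intro: finite_subset)

lemma ksubsets_exchange:
  assumes "I \<in> ksubsets n k" "i \<in> I" "c < n" "c \<notin> I - {i}"
  shows "insert c (I - {i}) \<in> ksubsets n k"
proof -
  have "card (insert c (I - {i})) = Suc (card (I - {i}))"
    using assms ksubsetsD(3)[OF assms(1)] by (subst card_insert_disjoint) auto
  also have "\<dots> = card I" using assms ksubsetsD(3)[OF assms(1)] card.remove by metis
  finally show ?thesis using assms by (auto simp: ksubsets_def)
qed

text \<open>The matrix of the derivation of the k-th exterior power induced by A.\<close>

definition exchange_matrix :: "nat \<Rightarrow> complex mat \<Rightarrow> nat set \<Rightarrow> nat set \<Rightarrow> complex" where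
  "exchange_matrix n A I J = (\<Sum>i\<in>I. \<Sum>c\<in>{0..<n} - (I - {i}).
     if insert c (I - {i}) = J then A $$ (i, c) * exchange_sign (I - {i}) i c else 0)"

text \<open>\<open>K\<close> is the common part of the two \<open>k\<close>-sets
  \<open>insert i K\<close> and \<open>insert j K\<close>. The condition makes the off-diagonal
  coefficients of the system for the coordinates real and nonnegative.\<close>

definition exchange_nonneg :: "nat \<Rightarrow> nat \<Rightarrow> complex mat \<Rightarrow> bool" where
  "exchange_nonneg n k A \<longleftrightarrow> (\<forall>K i j. K \<subseteq> {0..<n} \<and> card K = k - 1 \<and> i < n \<and> j < n \<and> i \<notin> K \<and> j \<notin> K \<and> i
    \<noteq> j \<longrightarrow>
     0 \<le> A $$ (i, j) * exchange_sign K i j)"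

lemma exchange_derivative:
  assumes X: "\<And>s. X s \<in> carrier_mat n n" and A: "A \<in> carrier_mat n n"
    and der: "has_mat_derivative n X (A * X t) t" and I: "I \<in> ksubsets n k"
  shows "((\<lambda>s. plucker (X s) I) has_vector_derivative
    (\<Sum>J\<in>ksubsets n k. exchange_matrix n A I J * plucker (X t) J)) (at t)"
proof -
  have "(\<Sum>J\<in>ksubsets n k. exchange_matrix n A I J * plucker (X t) J) =
      (\<Sum>J\<in>ksubsets n k. \<Sum>i\<in>I. \<Sum>c\<in>{0..<n} - (I - {i}).
        if insert c (I - {i}) = J then A $$ (i, c) * exchange_sign (I - {i}) i c * plucker (X t) J
          else 0)"
    unfolding exchange_matrix_def sum_distrib_right by (intro sum.cong) auto
  also have "\<dots> = (\<Sum>i\<in>I. \<Sum>c\<in>{0..<n} - (I - {i}). \<Sum>J\<in>ksubsets n k.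
        if insert c (I - {i}) = J then A $$ (i, c) * exchange_sign (I - {i}) i c * plucker (X t) J
          else 0)"
    by (subst sum.swap, intro sum.cong refl sum.swap)
  also have "\<dots> = (\<Sum>i\<in>I. \<Sum>c\<in>{0..<n} - (I - {i}). A $$ (i, c) * exchange_sign (I - {i}) i c * plucker
    (X t) (insert c (I - {i})))"
    using ksubsets_exchange[OF I] by (intro sum.cong refl) auto
  finally show ?thesis using plucker_derivative[OF X A der ksubsetsD(1)[OF I]] by simp
qed

lemma exchange_sign_cases: "exchange_sign K i j = 1 \<or> exchange_sign K i j = -1"
  unfolding exchange_sign_def using neg_one_even_power neg_one_odd_power by blast

lemma hermitian_entry:
  assumes "A \<in> carrier_mat n n" "mat_adjoint A = A" "i < n" "j < n"
  shows "A $$ (j, i) = cnj (A $$ (i, j))"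
  using mat_adjoint_index[of j A i] assms by simp

section \<open>Nonnegativity of the coordinates along the flow\<close>

locale exchange_system =
  fixes n k :: nat and A :: "complex mat"
  assumes A: "A \<in> carrier_mat n n" and hermitian: "mat_adjoint A = A"
    and nonneg: "exchange_nonneg n k A"
begin

lemma term_nonneg:
  assumes I: "I \<in> ksubsets n k" and i: "i \<in> I" and c: "c < n" "c \<notin> I - {i}" "c \<noteq> i"
  shows "0 \<le> A $$ (i, c) * exchange_sign (I - {i}) i c"
proof -
  have "card (I - {i}) = k - 1" using ksubsetsD[OF I] i by simp
  moreover have "i < n" "I - {i} \<subseteq> {0..<n}" using ksubsetsD(1)[OF I] i by auto
  ultimately show ?thesis using nonneg i c unfolding exchange_nonneg_def by blast
qed

text \<open>The diagonal case \<open>c = i\<close> lies outside \<open>exchange_nonneg\<close>;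
  there the entry is real because \<open>A\<close> is Hermitian.\<close>

lemma term_real:
  assumes I: "I \<in> ksubsets n k" and i: "i \<in> I" and c: "c < n" "c \<notin> I - {i}"
  shows "Im (A $$ (i, c) * exchange_sign (I - {i}) i c) = 0"
proof (cases "c = i")
  case True
  have "A $$ (i, i) = cnj (A $$ (i, i))" using hermitian_entry[OF A hermitian, of i i] c True by simp
  then have "Im (A $$ (i, i)) = 0" by (simp add: complex_eq_iff)
  then show ?thesis using True by simp
next
  case False
  then show ?thesis using term_nonneg[OF I i c] by (simp add: less_eq_complex_def)
qed

lemma matrix_real:
  assumes I: "I \<in> ksubsets n k"
  shows "exchange_matrix n A I J = complex_of_real (Re (exchange_matrix n A I J))"
proof -
  have "Im (exchange_matrix n A I J) = 0"
    unfolding exchange_matrix_def Im_sum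
    using term_real[OF I] by (intro sum.neutral ballI) (auto split: if_splits)
  then show ?thesis by (simp add: complex_eq_iff)
qed

lemma matrix_terms_nonneg:
  assumes I: "I \<in> ksubsets n k" and "I \<noteq> J" "i \<in> I" "c \<in> {0..<n} - (I - {i})"
  shows "0 \<le> Re (if insert c (I - {i}) = J then A $$ (i, c) * exchange_sign (I - {i}) i c else 0)"
proof -
  have "c \<noteq> i" if "insert c (I - {i}) = J" using that assms by (auto simp: insert_absorb)
  then show ?thesis using term_nonneg[OF I, of i c] assms by (auto simp: less_eq_complex_def)
qed

lemma matrix_nonneg:
  assumes I: "I \<in> ksubsets n k" and "I \<noteq> J"
  shows "0 \<le> Re (exchange_matrix n A I J)"
  unfolding exchange_matrix_def Re_sum using matrix_terms_nonneg[OF assms] by (intro sum_nonneg) auto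

text \<open>Off the diagonal all summands are nonnegative, so none of them cancels the nonzero
  contribution of exchanging \<open>i\<close> for \<open>c\<close>.\<close>

lemma matrix_pos:
  assumes I: "I \<in> ksubsets n k" and i: "i \<in> I" and c: "c < n" "c \<notin> I" and ne: "A $$ (i, c) \<noteq> 0"
  shows "0 < Re (exchange_matrix n A I (insert c (I - {i})))"
proof -
  let ?J = "insert c (I - {i})"
  let ?f = "\<lambda>i' c'. Re (if insert c' (I - {i'}) = ?J then A $$ (i', c') * exchange_sign (I - {i'})
    i' c' else 0)"
  have IJ: "I \<noteq> ?J" using i c by auto
  have ci: "c \<noteq> i" using i c by auto
  have "0 < ?f i c"
  proof -
    have "A $$ (i, c) * exchange_sign (I - {i}) i c \<noteq> 0" using ne exchange_sign_cases[of "I - {i}" i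
      c] by auto
    moreover have "0 \<le> A $$ (i, c) * exchange_sign (I - {i}) i c" using term_nonneg[OF I i c(1) _
      ci] c by simp
    ultimately have "0 < A $$ (i, c) * exchange_sign (I - {i}) i c" by (simp only:
      order.strict_iff_order) simp
    then show ?thesis by (simp add: less_complex_def)
  qed
  also have "\<dots> \<le> (\<Sum>c'\<in>{0..<n} - (I - {i}). ?f i c')"
    using c i matrix_terms_nonneg[OF I IJ] by (intro member_le_sum) auto
  also have "\<dots> \<le> (\<Sum>i'\<in>I. \<Sum>c'\<in>{0..<n} - (I - {i'}). ?f i' c')"
    using i matrix_terms_nonneg[OF I IJ] ksubsetsD(3)[OF I]
    by (intro member_le_sum[of i I "\<lambda>i'. \<Sum>c'\<in>{0..<n} - (I - {i'}). ?f i' c'"] sum_nonneg) auto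
  finally show ?thesis unfolding exchange_matrix_def Re_sum .
qed

text \<open>The coefficients are real, which decouples the real parts of the coordinates from the
  imaginary parts.\<close>

lemma flow_derivative:
  assumes g: "g \<in> carrier_mat n n" and I: "I \<in> ksubsets n k"
  shows "((\<lambda>s. w * plucker (mexp A s * g) I) has_vector_derivative
    (\<Sum>J\<in>ksubsets n k. complex_of_real (Re (exchange_matrix n A I J)) * (w * plucker (mexp A t * g)
      J))) (at t)"
proof -
  interpret square_matrices n .
  note [simp] = A g
  have d: "has_mat_derivative n (\<lambda>s. mexp A s * g) (A * (mexp A t * g)) t"
    using has_mat_derivative_mult_const[OF g _ _ mexp_derivative[OF A], of t] by (simp add: sq_simps)
  have "((\<lambda>s. w * plucker (mexp A s * g) I) has_vector_derivative
    w * (\<Sum>J\<in>ksubsets n k. exchange_matrix n A I J * plucker (mexp A t * g) J)) (at t)"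
    by (intro has_vector_derivative_mult_right exchange_derivative[OF _ A d I]) simp
  then show ?thesis unfolding matrix_real[OF I, symmetric] by (simp add: sum_distrib_left mult_ac)
qed

text \<open>The imaginary parts and their negatives both start at 0 and solve a system that
  preserves nonnegativity. Together this forces the coordinates to stay real.\<close>

lemma real_system:
  assumes g: "g \<in> carrier_mat n n" and init: "\<And>I. I \<in> ksubsets n k \<Longrightarrow> 0 \<le> w * plucker g I"
  shows "metzler_system (ksubsets n k) (\<lambda>I J. Re (exchange_matrix n A I J)) (\<lambda>I s. Re (w * plucker
    (mexp A s * g) I))"
    "metzler_system (ksubsets n k) (\<lambda>I J. Re (exchange_matrix n A I J)) (\<lambda>I s. Im (w * plucker (mexp
      A s * g) I))"
    "metzler_system (ksubsets n k) (\<lambda>I J. Re (exchange_matrix n A I J)) (\<lambda>I s. - Im (w * plucker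
      (mexp A s * g) I))"
proof -
  have zero: "mexp A 0 * g = g" using g by (simp add: mexp_zero[OF A] left_mult_one_mat[of _ n n])
  have der: "((\<lambda>s. Re (w * plucker (mexp A s * g) I)) has_real_derivative
      (\<Sum>J\<in>ksubsets n k. Re (exchange_matrix n A I J) * Re (w * plucker (mexp A t * g) J))) (at t)"
    "((\<lambda>s. Im (w * plucker (mexp A s * g) I)) has_real_derivative
      (\<Sum>J\<in>ksubsets n k. Re (exchange_matrix n A I J) * Im (w * plucker (mexp A t * g) J))) (at t)"
    if "I \<in> ksubsets n k" for I t
    using flow_derivative[OF g that, of w t] unfolding has_vector_derivative_complex_iff o_def
    by (simp_all only: Re_sum Im_sum Re_complex_of_real Im_complex_of_real times_complex.sel
      mult_zero_left diff_zero add_0_right)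
  show "metzler_system (ksubsets n k) (\<lambda>I J. Re (exchange_matrix n A I J)) (\<lambda>I s. Re (w * plucker
    (mexp A s * g) I))"
    by unfold_locales (use der(1) matrix_nonneg init zero in \<open>auto simp: less_eq_complex_def\<close>)
  show "metzler_system (ksubsets n k) (\<lambda>I J. Re (exchange_matrix n A I J)) (\<lambda>I s. Im (w * plucker
    (mexp A s * g) I))"
    by unfold_locales (use der(2) matrix_nonneg init zero in \<open>auto simp: less_eq_complex_def\<close>)
  show "metzler_system (ksubsets n k) (\<lambda>I J. Re (exchange_matrix n A I J)) (\<lambda>I s. - Im (w * plucker
    (mexp A s * g) I))"
  proof unfold_locales
    show "((\<lambda>s. - Im (w * plucker (mexp A s * g) I)) has_real_derivative
      (\<Sum>J\<in>ksubsets n k. Re (exchange_matrix n A I J) * - Im (w * plucker (mexp A t * g) J))) (at t)"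
      if "I \<in> ksubsets n k" for I t
      using DERIV_minus[OF der(2)[OF that, of t]] by (simp only: mult_minus_right sum_negf)
  qed (use matrix_nonneg init zero in \<open>auto simp: less_eq_complex_def\<close>)
qed

lemma flow_real:
  assumes "g \<in> carrier_mat n n" "\<And>I. I \<in> ksubsets n k \<Longrightarrow> 0 \<le> w * plucker g I" and "0 \<le> t" "I \<in>
    ksubsets n k"
  shows "Im (w * plucker (mexp A t * g) I) = 0"
proof -
  have "0 \<le> Im (w * plucker (mexp A t * g) I)"
    using metzler_system.nonneg[OF real_system(2)[OF assms(1,2)] assms(3,4)] .
  moreover have "0 \<le> - Im (w * plucker (mexp A t * g) I)"
    using metzler_system.nonneg[OF real_system(3)[OF assms(1,2)] assms(3,4)] .
  ultimately show ?thesis by linarith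
qed

lemma flow_nonneg:
  assumes "g \<in> carrier_mat n n" "\<And>I. I \<in> ksubsets n k \<Longrightarrow> 0 \<le> w * plucker g I" and "0 \<le> t" "I \<in>
    ksubsets n k"
  shows "0 \<le> w * plucker (mexp A t * g) I"
  using metzler_system.nonneg[OF real_system(1)[OF assms(1,2)] assms(3,4)] flow_real[OF assms]
  unfolding less_eq_complex_def by (simp only: zero_complex.sel)

end

text \<open>If the next vertex of the path is occupied, its token is moved to the end first.\<close>

lemma token_path:
  fixes adj :: "nat \<Rightarrow> nat \<Rightarrow> bool"
  assumes adj: "\<And>a b. adj a b \<Longrightarrow> a < n \<and> b < n \<and> a \<noteq> b"
    and move: "\<And>I i c. I \<in> ksubsets n k \<Longrightarrow> i \<in> I \<Longrightarrow> c \<notin> I \<Longrightarrow> adj i c \<Longrightarrow> (I, insert c (I - {i})) \<in> R"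
    and path: "(i, j) \<in> {(a, b). adj a b}\<^sup>*"
  shows "I \<in> ksubsets n k \<Longrightarrow> i \<in> I \<Longrightarrow> j \<notin> I \<Longrightarrow> (I, insert j (I - {i})) \<in> R\<^sup>*"
  using path
proof (induction arbitrary: I rule: converse_rtrancl_induct)
  case base
  then show ?case by simp
next
  case (step i i')
  have ii': "adj i i'" "i \<noteq> i'" "i < n" "i' < n" using step adj by auto
  show ?case
  proof (cases "i' \<in> I")
    case False
    have 1: "(I, insert i' (I - {i})) \<in> R" using move step.prems False ii' by blast
    show ?thesis
    proof (cases "j = i'")
      case True then show ?thesis using 1 by auto
    next
      case ne: False
      have "insert i' (I - {i}) \<in> ksubsets n k" using ksubsets_exchange[OF step.prems(1,2) ii'(4)]
        False by simp
      moreover have "j \<notin> insert i' (I - {i})" using ne step.prems by auto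
      ultimately have "(insert i' (I - {i}), insert j (insert i' (I - {i}) - {i'})) \<in> R\<^sup>*"
        using step.IH by blast
      moreover have "insert i' (I - {i}) - {i'} = I - {i}" using False by auto
      ultimately show ?thesis using 1 by (auto intro: converse_rtrancl_into_rtrancl)
    qed
  next
    case True
    have "(I, insert j (I - {i'})) \<in> R\<^sup>*" using step.IH[OF step.prems(1) True step.prems(3)] .
    moreover have "(insert j (I - {i'}), insert i' (insert j (I - {i'}) - {i})) \<in> R"
    proof (rule move)
      have "j < n"
      proof -
        have "(i', j) \<in> {(a, b). adj a b}\<^sup>*" by fact
        then show ?thesis using ii' by (induction) (auto dest: adj)
      qed
      then show "insert j (I - {i'}) \<in> ksubsets n k" using ksubsets_exchange[OF step.prems(1) True]
        step.prems by simp
      show "i \<in> insert j (I - {i'})" using step.prems ii' by auto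
      show "i' \<notin> insert j (I - {i'})" using True step.prems by auto
    qed fact
    moreover have "insert i' (insert j (I - {i'}) - {i}) = insert j (I - {i})"
      using True step.prems ii' by auto
    ultimately show ?thesis by (auto intro: rtrancl_into_rtrancl)
  qed
qed

text \<open>Induction on the number of tokens outside \<open>J\<close>: one of them is sent to a
  vertex of \<open>J\<close> that is still free.\<close>

lemma token_sliding:
  fixes adj :: "nat \<Rightarrow> nat \<Rightarrow> bool"
  assumes adj: "\<And>a b. adj a b \<Longrightarrow> a < n \<and> b < n \<and> a \<noteq> b"
    and move: "\<And>I i c. I \<in> ksubsets n k \<Longrightarrow> i \<in> I \<Longrightarrow> c \<notin> I \<Longrightarrow> adj i c \<Longrightarrow> (I, insert c (I - {i})) \<in> R"
    and conn: "\<And>i j. i < n \<Longrightarrow> j < n \<Longrightarrow> (i, j) \<in> {(a, b). adj a b}\<^sup>*"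
    and J: "J \<in> ksubsets n k"
  shows "I \<in> ksubsets n k \<Longrightarrow> (I, J) \<in> R\<^sup>*"
proof (induction "card (I - J)" arbitrary: I)
  case 0
  then have "I \<subseteq> J" using ksubsetsD(3)[OF 0(2)] by auto
  then have "I = J" using ksubsetsD[OF 0(2)] ksubsetsD[OF J] by (metis card_subset_eq)
  then show ?case by simp
next
  case (Suc m)
  have fin: "finite I" "finite J" using ksubsetsD Suc.prems J by auto
  have "I - J \<noteq> {}" using Suc(2) by (metis card.empty nat.distinct(1))
  then obtain i where i: "i \<in> I" "i \<notin> J" by auto
  have "\<not> J \<subseteq> I"
  proof
    assume "J \<subseteq> I"
    then have "J = I" using ksubsetsD[OF Suc.prems] ksubsetsD[OF J] by (metis card_subset_eq)
    then show False using i by simp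
  qed
  then obtain j where j: "j \<in> J" "j \<notin> I" by auto
  have ij: "i < n" "j < n" using i j ksubsetsD(1)[OF Suc.prems] ksubsetsD(1)[OF J] by auto
  have "(I, insert j (I - {i})) \<in> R\<^sup>*"
    by (rule token_path[OF adj move conn[OF ij] Suc.prems i(1) j(2)])
  moreover have "insert j (I - {i}) - J = (I - J) - {i}" using j by auto
  then have "m = card (insert j (I - {i}) - J)" using Suc(2) i fin by simp
  then have "(insert j (I - {i}), J) \<in> R\<^sup>*"
    by (rule Suc.hyps(1)) (use ksubsets_exchange[OF Suc.prems i(1) ij(2)] j in simp)
  ultimately show ?case by (rule rtrancl_trans)
qed

section \<open>Strict positivity on a connected graph\<close>

context exchange_system
begin

text \<open>Positivity spreads from the nonzero initial coordinate \<open>J\<close> along token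
  moves. The support of the Hermitian matrix \<open>A\<close> is symmetric, so every edge can be
  used in both directions.\<close>

lemma flow_pos:
  assumes g: "g \<in> carrier_mat n n" and init: "\<And>I. I \<in> ksubsets n k \<Longrightarrow> 0 \<le> w * plucker g I"
    and ne: "J \<in> ksubsets n k" "w * plucker g J \<noteq> 0"
    and conn: "graph_connected {0..<n} (support_graph n A)"
    and t: "0 < t" and I: "I \<in> ksubsets n k"
  shows "0 < w * plucker (mexp A t * g) I"
proof -
  define adj where "adj a b \<longleftrightarrow> a < n \<and> b < n \<and> a \<noteq> b \<and> A $$ (a, b) \<noteq> 0" for a b
  have adj_sym: "adj a b \<longleftrightarrow> adj b a" for a b
    unfolding adj_def using hermitian_entry[OF A hermitian, of a b] by auto
  have e: "{(a, b). {a, b} \<in> support_graph n A} = {(a, b). adj a b}"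
  proof -
    have "{a, b} \<in> support_graph n A \<longleftrightarrow> adj a b" for a b
    proof
      assume "{a, b} \<in> support_graph n A"
      then obtain i j where "{a, b} = {i, j}" "adj i j" by (auto simp: support_graph_def adj_def)
      then show "adj a b" using adj_sym by (auto simp: doubleton_eq_iff)
    qed (auto simp: support_graph_def adj_def)
    then show ?thesis by auto
  qed
  interpret M: metzler_system "ksubsets n k" "\<lambda>I J. Re (exchange_matrix n A I J)" "\<lambda>I s. Re (w *
    plucker (mexp A s * g) I)"
    by (rule real_system(1)[OF g init])
  have "(J, I) \<in> {(I, J). I \<in> ksubsets n k \<and> J \<in> ksubsets n k \<and> I \<noteq> J \<and> 0 < Re (exchange_matrix n A
    J I)}\<^sup>*"
  proof (rule token_sliding[OF _ _ _ I ne(1)])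
    show "adj a b \<Longrightarrow> a < n \<and> b < n \<and> a \<noteq> b" for a b by (auto simp: adj_def)
    show "(i, j) \<in> {(a, b). adj a b}\<^sup>*" if "i < n" "j < n" for i j
      using conn that unfolding graph_connected_def e by auto
    fix L i c assume L: "L \<in> ksubsets n k" "i \<in> L" "c \<notin> L" "adj i c"
    let ?L = "insert c (L - {i})"
    have c: "c < n" "i < n" "A $$ (c, i) \<noteq> 0" using L(4) adj_sym[of i c] by (auto simp: adj_def)
    have L': "?L \<in> ksubsets n k" using ksubsets_exchange[OF L(1,2) c(1)] L by simp
    have restore: "insert i (?L - {c}) = L" using L by auto
    have "i \<notin> ?L" using L by auto
    \<comment> \<open>The coordinate of \<open>L\<close> feeds that of \<open>?L\<close>. The
      relevant coefficient sits in row \<open>?L\<close> and comes from exchanging \<open>c\<close>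
      back for \<open>i\<close>.\<close>
    then have "0 < Re (exchange_matrix n A ?L L)"
      using matrix_pos[OF L' _ c(2) _ c(3)] unfolding restore by auto
    then show "(L, ?L) \<in> {(I, J). I \<in> ksubsets n k \<and> J \<in> ksubsets n k \<and> I \<noteq> J \<and> 0 < Re
      (exchange_matrix n A J I)}"
      using L L' by auto
  qed
  moreover have "mexp A 0 * g = g" using g by (simp add: mexp_zero[OF A] left_mult_one_mat[of _ n n])
  then have "0 < Re (w * plucker (mexp A 0 * g) J)"
    using init[OF ne(1)] ne(2) by (auto simp: less_eq_complex_def complex_eq_iff)
  ultimately have "0 < Re (w * plucker (mexp A t * g) I)"
    using M.pos_of_reachable[OF _ ne(1) _ t] by blast
  then show ?thesis
    using flow_real[OF g init _ I, of t] t unfolding less_complex_def by (simp only: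
      zero_complex.sel less_imp_le)
qed

end

section \<open>An auxiliary flow into the positive part\<close>

text \<open>The adjacency matrix of the path on \<open>{0..<n}\<close>. No index lies between
  neighbours, so the exchange signs on its edges are +1 for every \<open>k\<close>, and the path is
  connected.\<close>

definition path_matrix :: "nat \<Rightarrow> complex mat" where
  "path_matrix n = mat n n (\<lambda>(i, j). if j = Suc i \<or> i = Suc j then 1 else 0)"

lemma exchange_sign_commute: "exchange_sign K i j = exchange_sign K j i"
  by (simp add: exchange_sign_def add.commute)

text \<open>Elements of \<open>K\<close> above \<open>j\<close> are counted twice and cancel; those
  strictly between \<open>i\<close> and \<open>j\<close> remain.\<close>

lemma exchange_sign_less:
  assumes K: "finite K" "j \<notin> K" and ij: "i < j"
  shows "exchange_sign K i j = (-1) ^ card {x \<in> K. i < x \<and> x < j}"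
proof -
  have "{x \<in> K. i < x} = {x \<in> K. i < x \<and> x < j} \<union> {x \<in> K. j < x}"
    using K ij by (auto simp: nat_neq_iff) (metis linorder_neqE_nat)
  then have "card {x \<in> K. i < x} = card ({x \<in> K. i < x \<and> x < j} \<union> {x \<in> K. j < x})" by simp
  also have "\<dots> = card {x \<in> K. i < x \<and> x < j} + card {x \<in> K. j < x}"
    using K by (intro card_Un_disjoint) auto
  finally have "card {x \<in> K. i < x} + card {x \<in> K. j < x} = card {x \<in> K. i < x \<and> x < j} + 2 * card
    {x \<in> K. j < x}" by simp
  then show ?thesis by (simp add: exchange_sign_def power_add power_mult)
qed

lemma exchange_sign_Suc:
  assumes "finite K" "Suc i \<notin> K"
  shows "exchange_sign K i (Suc i) = 1"
proof -
  have e: "{x \<in> K. i < x \<and> x < Suc i} = {}" by auto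
  show ?thesis using exchange_sign_less[OF assms, of i] unfolding e by simp
qed

lemma path_exchange_system: "exchange_system n k (path_matrix n)"
proof
  show "path_matrix n \<in> carrier_mat n n" by (simp add: path_matrix_def)
  show "mat_adjoint (path_matrix n) = path_matrix n"
    by (rule eq_matI) (auto simp: path_matrix_def)
  show "exchange_nonneg n k (path_matrix n)"
    unfolding exchange_nonneg_def
  proof (intro allI impI)
    fix K i j assume a: "K \<subseteq> {0..<n} \<and> card K = k - 1 \<and> i < n \<and> j < n \<and> i \<notin> K \<and> j \<notin> K \<and> i \<noteq> j"
    then have fin: "finite K" using finite_subset by blast
    consider "j = Suc i" | "i = Suc j" | "j \<noteq> Suc i" "i \<noteq> Suc j" by blast
    then show "0 \<le> path_matrix n $$ (i, j) * complex_of_real (exchange_sign K i j)"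
    proof cases
      case 1
      then show ?thesis using exchange_sign_Suc[OF fin, of i] a by (simp add: path_matrix_def
        less_eq_complex_def)
    next
      case 2
      then show ?thesis using exchange_sign_Suc[OF fin, of j] exchange_sign_commute[of K i j] a
        by (simp add: path_matrix_def less_eq_complex_def)
    qed (use a in \<open>simp add: path_matrix_def\<close>)
  qed
qed

lemma symmetric_rtrancl:
  assumes "\<And>a b. (a, b) \<in> R \<Longrightarrow> (b, a) \<in> R" and "(x, y) \<in> R\<^sup>*"
  shows "(y, x) \<in> R\<^sup>*"
  using sym_rtrancl[of R] assms by (meson symD symI)

lemma path_connected: "graph_connected {0..<n} (support_graph n (path_matrix n))"
  unfolding graph_connected_def
proof (intro ballI)
  let ?R = "{(a, b). {a, b} \<in> support_graph n (path_matrix n)}"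
  have step: "(Suc v, v) \<in> ?R" if "Suc v < n" for v
  proof -
    have "{Suc v, v} \<in> support_graph n (path_matrix n)"
      unfolding support_graph_def
      by (rule CollectI, rule exI[of _ "Suc v"], rule exI[of _ v]) (use that in \<open>simp add:
        path_matrix_def\<close>)
    then show ?thesis by simp
  qed
  have to_0: "v < n \<Longrightarrow> (v, 0) \<in> ?R\<^sup>*" for v
  proof (induction v)
    case (Suc v)
    then show ?case using step[of v] by (meson Suc_lessD converse_rtrancl_into_rtrancl)
  qed simp
  fix u v assume "u \<in> {0..<n}" "v \<in> {0..<n}"
  then have u: "(u, 0) \<in> ?R\<^sup>*" and v: "(v, 0) \<in> ?R\<^sup>*" using to_0 by auto
  from v have "(0, v) \<in> ?R\<^sup>*"
    by (rule symmetric_rtrancl[rotated]) (auto simp: insert_commute)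
  with u show "(u, v) \<in> ?R\<^sup>*" by (rule rtrancl_trans)
qed

context two_eigenvalues
begin

text \<open>The flow of the path matrix moves every nonnegative point into the positive part at once,
  so the point is a limit of positive ones.\<close>

lemma orbit_nonneg_of_plucker_nonneg:
  assumes g: "g \<in> unitary_group n" and pos: "plucker_nonneg n k g"
  shows "conj_diag n lam g \<in> orbit_nonneg n lam"
proof -
  interpret exchange_system n k "path_matrix n" by (rule path_exchange_system)
  note g' = unitary_groupD(1)[OF g]
  obtain w where w: "w \<noteq> 0" "\<And>I. I \<in> ksubsets n k \<Longrightarrow> 0 \<le> w * plucker g I"
    using pos by (auto simp: plucker_nonneg_def ksubsets_def)
  obtain J where J: "J \<in> ksubsets n k" "plucker g J \<noteq> 0"
    using exists_plucker_nonzero[OF g' det_unitary[OF g] k_less(2)] by (auto simp: ksubsets_def)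
  obtain h where h: "h 0 = g" "\<And>t. h t \<in> unitary_group n"
    "\<And>t. has_mat_derivative n (\<lambda>s. subspace_proj n k (h s)) (flow_field (path_matrix n)
      (subspace_proj n k (h t))) t"
    using flow_exists[OF A hermitian g, of k] by blast
  have pos: "conj_diag n lam (h t) \<in> orbit_pos n lam" if t: "0 < t" for t
  proof (rule orbit_pos_of_plucker_pos[OF h(2)])
    obtain c where c: "c \<noteq> 0" "\<forall>I. I \<subseteq> {0..<n} \<and> card I = k \<longrightarrow> plucker (mexp (path_matrix n) t * h 0)
      I = c * plucker (h t) I"
      using flow_transport_plucker[OF A k_less(2) h(2,3), of t] t by auto
    have "0 < (w * c) * plucker (h t) I" if I: "I \<subseteq> {0..<n} \<and> card I = k" for I
      using flow_pos[OF g' w(2) J(1) _ path_connected t, of I] I J(2) w(1) c(2) h(1)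
      by (simp add: ksubsets_def mult.assoc)
    then show "plucker_pos n k (h t)" unfolding plucker_pos_def using w(1) c(1) by (intro exI[of _
      "w * c"]) simp
  qed
  define B where "B m = conj_diag n lam (h (1 / real (Suc m)))" for m
  have "(\<lambda>m. B m $$ (i, j)) \<longlonglongrightarrow> conj_diag n lam g $$ (i, j)" if ij: "i < n" "j < n" for i j
  proof -
    have "isCont (\<lambda>s. subspace_proj n k (h s) $$ (i, j)) 0"
      using has_mat_derivativeD[OF h(3) ij] by (rule has_vector_derivative_continuous)
    moreover have "(\<lambda>m. 1 / real (Suc m)) \<longlonglongrightarrow> 0"
      using LIMSEQ_inverse_real_of_nat by (simp add: inverse_eq_divide)
    ultimately have "(\<lambda>m. subspace_proj n k (h (1 / real (Suc m))) $$ (i, j)) \<longlonglongrightarrow> subspace_proj n k (h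
      0) $$ (i, j)"
      by (rule isCont_tendsto_compose)
    then have lim: "(\<lambda>m. \<i> * lam k * (if i = j then 1 else 0) + \<i> * gap * subspace_proj n k (h (1 /
      real (Suc m))) $$ (i, j)) \<longlonglongrightarrow>
      \<i> * lam k * (if i = j then 1 else 0) + \<i> * gap * subspace_proj n k (h 0) $$ (i, j)"
      by (intro tendsto_intros)
    have e: "conj_diag n lam f $$ (i, j) = \<i> * lam k * (if i = j then 1 else 0) + \<i> * gap *
      subspace_proj n k f $$ (i, j)"
      if "f \<in> unitary_group n" for f
      using subspace_proj_of_conj_diag[OF that ij] gap_pos by (simp add: field_simps)
    show ?thesis using lim unfolding B_def e[OF h(2)] e[OF g] h(1) .
  qed
  moreover have "B m \<in> orbit_pos n lam" for m unfolding B_def by (rule pos) simp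
  moreover have "conj_diag n lam g \<in> carrier_mat n n"
    unfolding conj_diag_eq[OF g] using subspace_proj_facts(1)[OF g] by auto
  ultimately show ?thesis unfolding orbit_nonneg_def mat_closure_def by blast
qed

end

section \<open>The positivity condition in terms of exchange signs\<close>

lemma exists_subset_card:
  assumes "finite V" "m \<le> card V"
  obtains K where "K \<subseteq> V" "card K = m" "finite K"
  using obtain_subset_with_card_n[OF assms(2)] assms(1) by metis

locale hermitian_generator =
  fixes n k :: nat and N :: "complex mat"
  assumes N: "N \<in> carrier_mat n n" and k1: "1 \<le> k" and kn: "k \<le> n - 1"
    and sym: "\<And>i j. i < n \<Longrightarrow> j < n \<Longrightarrow> \<i> * N $$ (j, i) = cnj (\<i> * N $$ (i, j))"
begin

text \<open>Conjugation interchanges \<open>i\<close> and \<open>j\<close>, so the entries above the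
  diagonal decide.\<close>

lemma exchange_nonneg_iff:
  "exchange_nonneg n k (\<i> \<cdot>\<^sub>m N) \<longleftrightarrow> (\<forall>K i j. K \<subseteq> {0..<n} \<and> card K = k - 1 \<and> i < j \<and> j < n \<and> i \<notin> K \<and> j
    \<notin> K \<longrightarrow>
     0 \<le> (\<i> * N $$ (i, j)) * (-1) ^ card {x \<in> K. i < x \<and> x < j})" (is "?L \<longleftrightarrow> ?R")
proof
  assume L: ?L
  show ?R
  proof (intro allI impI)
    fix K i j assume a: "K \<subseteq> {0..<n} \<and> card K = k - 1 \<and> i < j \<and> j < n \<and> i \<notin> K \<and> j \<notin> K"
    then have fin: "finite K" using finite_subset by blast
    have "0 \<le> (\<i> \<cdot>\<^sub>m N) $$ (i, j) * complex_of_real (exchange_sign K i j)"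
      using L[unfolded exchange_nonneg_def, rule_format, of K i j] a by simp
    then show "0 \<le> (\<i> * N $$ (i, j)) * (-1) ^ card {x \<in> K. i < x \<and> x < j}"
      using a N exchange_sign_less[OF fin, of j i] by simp
  qed
next
  assume R: ?R
  have less: "0 \<le> (\<i> * N $$ (i, j)) * complex_of_real (exchange_sign K i j)"
    if "K \<subseteq> {0..<n}" "card K = k - 1" "i < j" "j < n" "i \<notin> K" "j \<notin> K" for K i j
  proof -
    have fin: "finite K" using that(1) finite_subset by blast
    show ?thesis using R that exchange_sign_less[OF fin, of j i] by simp
  qed
  show ?L unfolding exchange_nonneg_def
  proof (intro allI impI)
    fix K i j assume a: "K \<subseteq> {0..<n} \<and> card K = k - 1 \<and> i < n \<and> j < n \<and> i \<notin> K \<and> j \<notin> K \<and> i \<noteq> j"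
    show "0 \<le> (\<i> \<cdot>\<^sub>m N) $$ (i, j) * complex_of_real (exchange_sign K i j)"
    proof (cases "i < j")
      case True
      then show ?thesis using less[of K i j] a N by simp
    next
      case False
      then have "0 \<le> (\<i> * N $$ (j, i)) * complex_of_real (exchange_sign K j i)" using less[of K j i]
        a by simp
      also have "(\<i> * N $$ (j, i)) * complex_of_real (exchange_sign K j i) = cnj ((\<i> * N $$ (i, j))
        * complex_of_real (exchange_sign K i j))"
        using sym[of i j] a exchange_sign_commute[of K i j] by simp
      finally show ?thesis using a N by (simp add: less_eq_complex_def)
    qed
  qed
qed

text \<open>For \<open>k = 1\<close> the common part is empty and every sign is +1.\<close>

lemma condition_first:
  assumes "k = 1"
  shows "exchange_nonneg n k (\<i> \<cdot>\<^sub>m N) \<longleftrightarrow> (\<forall>i<n. \<forall>j<n. i \<noteq> j \<longrightarrow> 0 \<le> \<i> * N $$ (i, j))"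
proof -
  have e: "exchange_sign {} i j = 1" for i j by (simp add: exchange_sign_def)
  show ?thesis
  proof
    assume L: "exchange_nonneg n k (\<i> \<cdot>\<^sub>m N)"
    show "\<forall>i<n. \<forall>j<n. i \<noteq> j \<longrightarrow> 0 \<le> \<i> * N $$ (i, j)"
    proof (intro allI impI)
      fix i j assume ij: "i < n" "j < n" "i \<noteq> j"
      show "0 \<le> \<i> * N $$ (i, j)"
        using L[unfolded exchange_nonneg_def, rule_format, of "{}" i j] ij N assms e[of i j] by simp
    qed
  next
    assume R: "\<forall>i<n. \<forall>j<n. i \<noteq> j \<longrightarrow> 0 \<le> \<i> * N $$ (i, j)"
    show "exchange_nonneg n k (\<i> \<cdot>\<^sub>m N)" unfolding exchange_nonneg_def
    proof (intro allI impI)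
      fix L i j assume a: "L \<subseteq> {0..<n} \<and> card L = k - 1 \<and> i < n \<and> j < n \<and> i \<notin> L \<and> j \<notin> L \<and> i \<noteq> j"
      then have "L = {}" using assms finite_subset[of L "{0..<n}"] by auto
      then show "0 \<le> (\<i> \<cdot>\<^sub>m N) $$ (i, j) * complex_of_real (exchange_sign L i j)" using R a N e[of i
        j] by simp
    qed
  qed
qed

text \<open>For \<open>k = n - 1\<close> the common part is forced to be the complement of
  \<open>{i, j}\<close>. It has \<open>j - i - 1\<close> elements between \<open>i < j\<close>, a
  number with the parity of \<open>i + j + 1\<close>.\<close>

lemma condition_last:
  assumes "k = n - 1"
  shows "exchange_nonneg n k (\<i> \<cdot>\<^sub>m N) \<longleftrightarrow> (\<forall>i<n. \<forall>j<n. i \<noteq> j \<longrightarrow> 0 \<le> (-1) ^ (i + j + 1) * \<i> * N $$ (i, j))"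
proof -
  have sign: "complex_of_real (exchange_sign ({0..<n} - {i, j}) i j) = (-1) ^ (i + j + 1)" if "i <
    j" "j < n" for i j
  proof -
    have "{x \<in> {0..<n} - {i, j}. i < x \<and> x < j} = {Suc i..<j}" using that by auto
    then have "exchange_sign ({0..<n} - {i, j}) i j = (-1) ^ (j - Suc i)"
      using exchange_sign_less[of "{0..<n} - {i, j}" j i] that by simp
    moreover have "i + j + 1 = 2 * Suc i + (j - Suc i)" using that by simp
    then have "(-1::complex) ^ (i + j + 1) = (-1) ^ (j - Suc i)" by (simp only: power_add
      power_mult) simp
    ultimately show ?thesis by simp
  qed
  have sign': "complex_of_real (exchange_sign ({0..<n} - {i, j}) i j) = (-1) ^ (i + j + 1)" if "i <
    n" "j < n" "i \<noteq> j" for i j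
  proof (cases "i < j")
    case False
    then have "j < i" using that by simp
    then show ?thesis using sign[of j i] that exchange_sign_commute[of "{0..<n} - {i, j}" i j]
      by (simp add: insert_commute add.commute)
  qed (use sign that in simp)
  have K: "K \<subseteq> {0..<n} \<and> card K = k - 1 \<and> i \<notin> K \<and> j \<notin> K \<longleftrightarrow> K = {0..<n} - {i, j}" if "i < n" "j < n"
    "i \<noteq> j" for K i j
  proof
    assume a: "K \<subseteq> {0..<n} \<and> card K = k - 1 \<and> i \<notin> K \<and> j \<notin> K"
    show "K = {0..<n} - {i, j}"
      by (rule card_subset_eq) (use a assms that in auto)
  qed (use assms that in auto)
  have "exchange_nonneg n k (\<i> \<cdot>\<^sub>m N) \<longleftrightarrow> (\<forall>i<n. \<forall>j<n. i \<noteq> j \<longrightarrow>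
      0 \<le> (\<i> \<cdot>\<^sub>m N) $$ (i, j) * complex_of_real (exchange_sign ({0..<n} - {i, j}) i j))"
  proof
    assume L: "exchange_nonneg n k (\<i> \<cdot>\<^sub>m N)"
    show "\<forall>i<n. \<forall>j<n. i \<noteq> j \<longrightarrow>
      0 \<le> (\<i> \<cdot>\<^sub>m N) $$ (i, j) * complex_of_real (exchange_sign ({0..<n} - {i, j}) i j)"
    proof (intro allI impI)
      fix i j assume ij: "i < n" "j < n" "i \<noteq> j"
      show "0 \<le> (\<i> \<cdot>\<^sub>m N) $$ (i, j) * complex_of_real (exchange_sign ({0..<n} - {i, j}) i j)"
        using L[unfolded exchange_nonneg_def, rule_format, of "{0..<n} - {i, j}" i j]
          K[OF ij, of "{0..<n} - {i, j}"] ij by simp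
    qed
  next
    assume R: "\<forall>i<n. \<forall>j<n. i \<noteq> j \<longrightarrow>
      0 \<le> (\<i> \<cdot>\<^sub>m N) $$ (i, j) * complex_of_real (exchange_sign ({0..<n} - {i, j}) i j)"
    show "exchange_nonneg n k (\<i> \<cdot>\<^sub>m N)" unfolding exchange_nonneg_def
    proof (intro allI impI)
      fix L i j assume a: "L \<subseteq> {0..<n} \<and> card L = k - 1 \<and> i < n \<and> j < n \<and> i \<notin> L \<and> j \<notin> L \<and> i \<noteq> j"
      then have "L = {0..<n} - {i, j}" using K[of i j L] by simp
      then show "0 \<le> (\<i> \<cdot>\<^sub>m N) $$ (i, j) * complex_of_real (exchange_sign L i j)" using R a by simp
    qed
  qed
  also have "\<dots> \<longleftrightarrow> (\<forall>i<n. \<forall>j<n. i \<noteq> j \<longrightarrow> 0 \<le> (-1) ^ (i + j + 1) * \<i> * N $$ (i, j))"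
    using N sign' by (simp add: mult_ac)
  finally show ?thesis .
qed

text \<open>The three differences have absolute value at most \<open>n\<close>, so the only
  multiples of \<open>n\<close> among their values are 0, \<open>n\<close> and
  \<open>- n\<close>.\<close>

lemma not_cong_iff:
  assumes "i < n" "j < n" "2 \<le> n"
  shows "(\<not> [int i - int j = -1] (mod int n) \<and> \<not> [int i - int j = 0] (mod int n) \<and> \<not> [int i - int j
    = 1] (mod int n)) \<longleftrightarrow>
    i \<noteq> j \<and> i \<noteq> Suc j \<and> j \<noteq> Suc i \<and> \<not> (i = 0 \<and> j = n - 1) \<and> \<not> (j = 0 \<and> i = n - 1)"
proof -
  have small: "int n dvd z \<longleftrightarrow> z = 0 \<or> z = int n \<or> z = - int n" if "\<bar>z\<bar> \<le> int n" for z
  proof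
    assume "int n dvd z"
    then obtain q where q: "z = int n * q" by auto
    then have "int n * \<bar>q\<bar> \<le> int n * 1" using that assms by (simp add: abs_mult)
    then have "\<bar>q\<bar> \<le> 1" using assms by (simp only: mult_le_cancel_left_pos of_nat_0_less_iff)
    then have "q = 0 \<or> q = 1 \<or> q = -1" by linarith
    then show "z = 0 \<or> z = int n \<or> z = - int n" using q by auto
  qed auto
  have bounds: "\<bar>int i - int j + 1\<bar> \<le> int n" "\<bar>int i - int j\<bar> \<le> int n" "\<bar>int i - int j - 1\<bar> \<le> int n"
    using assms by linarith+
  have "[int i - int j = -1] (mod int n) \<longleftrightarrow> j = Suc i \<or> (j = 0 \<and> i = n - 1)"
  proof -
    have "[int i - int j = -1] (mod int n) \<longleftrightarrow> int n dvd (int i - int j + 1)"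
      by (simp add: cong_iff_dvd_diff)
    also have "\<dots> \<longleftrightarrow> j = Suc i \<or> (j = 0 \<and> i = n - 1)"
      unfolding small[OF bounds(1)] using assms by (auto simp: of_nat_diff)
    finally show ?thesis .
  qed
  moreover have "[int i - int j = 0] (mod int n) \<longleftrightarrow> i = j"
  proof -
    have "[int i - int j = 0] (mod int n) \<longleftrightarrow> int n dvd (int i - int j)"
      by (simp add: cong_iff_dvd_diff)
    also have "\<dots> \<longleftrightarrow> i = j"
      unfolding small[OF bounds(2)] using assms by (auto simp: of_nat_diff)
    finally show ?thesis .
  qed
  moreover have "[int i - int j = 1] (mod int n) \<longleftrightarrow> i = Suc j \<or> (i = 0 \<and> j = n - 1)"
  proof -
    have "[int i - int j = 1] (mod int n) \<longleftrightarrow> int n dvd (int i - int j - 1)"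
      by (simp add: cong_iff_dvd_diff)
    also have "\<dots> \<longleftrightarrow> i = Suc j \<or> (i = 0 \<and> j = n - 1)"
      unfolding small[OF bounds(3)] using assms by (auto simp: of_nat_diff)
    finally show ?thesis .
  qed
  ultimately show ?thesis by blast
qed

text \<open>The sign required of an entry depends on how many elements of \<open>K\<close> lie
  between \<open>i\<close> and \<open>j\<close>. For neighbours there are none and for the corner
  all \<open>k - 1\<close> of them, so the sign is determined. For any other pair \<open>K\<close>
  can be chosen with either parity, and the entry must vanish; \<open>2 \<le> k\<close> and
  \<open>k \<le> n - 2\<close> leave room for that choice.\<close>

lemma condition_middle:
  assumes k: "2 \<le> k" "k \<le> n - 2"
  shows "exchange_nonneg n k (\<i> \<cdot>\<^sub>m N) \<longleftrightarrow>
    (\<forall>i. i + 1 < n \<longrightarrow> 0 \<le> \<i> * N $$ (i, i + 1)) \<and> 0 \<le> (-1) ^ (k - 1) * \<i> * N $$ (n - 1, 0) \<and>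
    (\<forall>i<n. \<forall>j<n. \<not> [int i - int j = -1] (mod int n) \<and> \<not> [int i - int j = 0] (mod int n) \<and>
       \<not> [int i - int j = 1] (mod int n) \<longrightarrow> N $$ (i, j) = 0)" (is "?L \<longleftrightarrow> ?A \<and> ?B \<and> ?C")
proof -
  have n4: "4 \<le> n" and n2: "2 \<le> n" using k by simp_all
  \<comment> \<open>The condition names the lower left corner, the sign criterion the upper right
    one; the two are conjugate.\<close>
  have corner: "0 \<le> (-1) ^ (k - 1) * \<i> * N $$ (n - 1, 0) \<longleftrightarrow> 0 \<le> (\<i> * N $$ (0, n - 1)) * (-1) ^ (k - 1)"
  proof -
    have "\<i> * N $$ (n - 1, 0) = cnj (\<i> * N $$ (0, n - 1))" by (rule sym) (use n4 in auto)
    then have "(-1) ^ (k - 1) * \<i> * N $$ (n - 1, 0) = cnj ((\<i> * N $$ (0, n - 1)) * (-1) ^ (k - 1))"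
      by (simp only: mult.assoc) (simp add: mult_ac)
    moreover have "0 \<le> cnj z \<longleftrightarrow> 0 \<le> z" for z by (auto simp: less_eq_complex_def)
    ultimately show ?thesis by (simp only:)
  qed
  show ?thesis
  proof
    assume ?L
    note L = exchange_nonneg_iff[THEN iffD1, OF this, rule_format]
    have ?A
    proof (intro allI impI)
      fix i assume i: "i + 1 < n"
      obtain K where K: "K \<subseteq> {0..<n} - {i, i + 1}" "card K = k - 1"
        by (rule exists_subset_card[of "{0..<n} - {i, i + 1}" "k - 1"]) (use i k in auto)
      have e: "{x \<in> K. i < x \<and> x < i + 1} = {}" by auto
      have "K \<subseteq> {0..<n} \<and> card K = k - 1 \<and> i < i + 1 \<and> i + 1 < n \<and> i \<notin> K \<and> i + 1 \<notin> K" using K i by auto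
      from L[OF this] show "0 \<le> \<i> * N $$ (i, i + 1)" unfolding e by simp
    qed
    moreover have ?B
    proof -
      obtain K where K: "K \<subseteq> {0..<n} - {0, n - 1}" "card K = k - 1"
        by (rule exists_subset_card[of "{0..<n} - {0, n - 1}" "k - 1"]) (use n4 k in auto)
      have "x < n - 1" "0 < x" if "x \<in> K" for x
      proof -
        have "x < n" "x \<noteq> 0" "x \<noteq> n - 1" using K that by auto
        then show "x < n - 1" "0 < x" by linarith+
      qed
      then have e: "{x \<in> K. 0 < x \<and> x < n - 1} = K" by auto
      have "K \<subseteq> {0..<n} \<and> card K = k - 1 \<and> 0 < n - 1 \<and> n - 1 < n \<and> 0 \<notin> K \<and> n - 1 \<notin> K" using K n4 by auto
      from L[OF this] show ?thesis unfolding corner e K(2) .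
    qed
    moreover have ?C
    proof -
      have zero: "N $$ (i, j) = 0" if ij: "i < j" "j < n" "j \<noteq> Suc i" "\<not> (i = 0 \<and> j = n - 1)" for i j
      proof -
        \<comment> \<open>\<open>x\<close> lies between \<open>i\<close> and \<open>j\<close>, and
          \<open>y\<close> outside. Adding one or the other to the same \<open>k - 2\<close>
          elements gives two admissible sets whose counts differ by one.\<close>
        obtain x where x: "i < x" "x < j" by (rule that[of "Suc i"]) (use ij in auto)
        obtain y where y: "y < n" "y < i \<or> j < y"
        proof (cases "i = 0")
          case True
          then have "j < n - 1" using ij by simp
          then show ?thesis using that[of "n - 1"] ij by simp
        next
          case False
          then show ?thesis using that[of 0] ij by simp
        qed
        have "card {i, j, x, y} = 4" "{i, j, x, y} \<subseteq> {0..<n}" using ij x y by auto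
        then have "k - 2 \<le> card ({0..<n} - {i, j, x, y})" using k by (simp add: card_Diff_subset)
        then obtain M where M: "M \<subseteq> {0..<n} - {i, j, x, y}" "card M = k - 2" "finite M"
          using exists_subset_card[OF finite_Diff[OF finite_atLeastLessThan]] by metis
        have MM: "x \<notin> M" "y \<notin> M" "i \<notin> M" "j \<notin> M" "M \<subseteq> {0..<n}" using M by auto
        let ?b = "card {z \<in> M. i < z \<and> z < j}"
        have "{z \<in> insert x M. i < z \<and> z < j} = insert x {z \<in> M. i < z \<and> z < j}" using x by auto
        then have b1: "card {z \<in> insert x M. i < z \<and> z < j} = Suc ?b" using M MM by simp
        have b2: "{z \<in> insert y M. i < z \<and> z < j} = {z \<in> M. i < z \<and> z < j}" using y by auto
        have cards: "card (insert x M) = k - 1" "card (insert y M) = k - 1" using M MM k by simp_all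
        have "insert x M \<subseteq> {0..<n} \<and> card (insert x M) = k - 1 \<and> i < j \<and> j < n \<and> i \<notin> insert x M \<and> j
          \<notin> insert x M"
          using MM cards ij x by auto
        from L[OF this] have "0 \<le> (\<i> * N $$ (i, j)) * (-1) ^ Suc ?b" unfolding b1 .
        moreover have "insert y M \<subseteq> {0..<n} \<and> card (insert y M) = k - 1 \<and> i < j \<and> j < n \<and> i \<notin> insert
          y M \<and> j \<notin> insert y M"
          using MM cards ij y by auto
        from L[OF this] have "0 \<le> (\<i> * N $$ (i, j)) * (-1) ^ ?b" unfolding b2 .
        ultimately have "\<i> * N $$ (i, j) * (-1) ^ ?b = 0"
          by (simp add: less_eq_complex_def complex_eq_iff)
        then show ?thesis by simp
      qed
      show ?C
      proof (intro allI impI)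
        fix i j assume ij: "i < n" "j < n" and nc: "\<not> [int i - int j = -1] (mod int n) \<and> \<not> [int i -
          int j = 0] (mod int n) \<and>
           \<not> [int i - int j = 1] (mod int n)"
        have c: "i \<noteq> j \<and> i \<noteq> Suc j \<and> j \<noteq> Suc i \<and> \<not> (i = 0 \<and> j = n - 1) \<and> \<not> (j = 0 \<and> i = n - 1)"
          using not_cong_iff[OF ij n2] nc by blast
        show "N $$ (i, j) = 0"
        proof (cases "i < j")
          case True
          then show ?thesis using zero[of i j] c ij by blast
        next
          case False
          then have "j < i" using c by linarith
          then have "N $$ (j, i) = 0" using zero[of j i] c ij by blast
          then show ?thesis using sym[of j i] ij by simp
        qed
      qed
    qed
    ultimately show "?A \<and> ?B \<and> ?C" by blast
  next
    assume ABC: "?A \<and> ?B \<and> ?C"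
    show ?L unfolding exchange_nonneg_iff
    proof (intro allI impI)
      fix K i j assume a: "K \<subseteq> {0..<n} \<and> card K = k - 1 \<and> i < j \<and> j < n \<and> i \<notin> K \<and> j \<notin> K"
      consider "j = Suc i" | "i = 0" "j = n - 1" | "j \<noteq> Suc i" "\<not> (i = 0 \<and> j = n - 1)" by blast
      then show "0 \<le> (\<i> * N $$ (i, j)) * (-1) ^ card {x \<in> K. i < x \<and> x < j}"
      proof cases
        case 1
        then have e: "{x \<in> K. i < x \<and> x < j} = {}" by auto
        have "0 \<le> \<i> * N $$ (i, i + 1)" using ABC a 1 by simp
        then show ?thesis unfolding e using 1 by simp
      next
        case 2
        have "x < n - 1" "0 < x" if "x \<in> K" for x
        proof -
          have "x < n" "x \<noteq> i" "x \<noteq> j" using a that by auto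
          then show "x < n - 1" "0 < x" using 2 by linarith+
        qed
        then have "{x \<in> K. i < x \<and> x < j} = K" using 2 by auto
        then show ?thesis using ABC corner 2 a by simp
      next
        case 3
        have ij: "i < n" "j < n" "i < j" using a by auto
        have "i \<noteq> j \<and> i \<noteq> Suc j \<and> j \<noteq> Suc i \<and> \<not> (i = 0 \<and> j = n - 1) \<and> \<not> (j = 0 \<and> i = n - 1)"
          using 3 ij by auto
        then have "N $$ (i, j) = 0" using ABC ij(1,2) not_cong_iff[OF ij(1,2) n2] by blast
        then show ?thesis by simp
      qed
    qed
  qed
qed

text \<open>For \<open>n = 2\<close> the cases \<open>k = 1\<close> and \<open>k = n - 1\<close>
  coincide. Each case alone is equivalent to the sign criterion, so their conjunction is
  too.\<close>

lemma positivity_condition_iff: "positivity_condition n k N \<longleftrightarrow> exchange_nonneg n k (\<i> \<cdot>\<^sub>m N)"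
proof -
  have "k = 1 \<or> k = n - 1 \<or> (2 \<le> k \<and> k \<le> n - 2)" using k1 kn by linarith
  moreover have "positivity_condition n k N \<longleftrightarrow> (k = 1 \<longrightarrow> exchange_nonneg n k (\<i> \<cdot>\<^sub>m N)) \<and>
    (k = n - 1 \<longrightarrow> exchange_nonneg n k (\<i> \<cdot>\<^sub>m N)) \<and> (2 \<le> k \<and> k \<le> n - 2 \<longrightarrow> exchange_nonneg n k (\<i> \<cdot>\<^sub>m N))"
    unfolding positivity_condition_def
    by (intro arg_cong2[where f = "(\<and>)"] imp_cong refl condition_first[symmetric]
      condition_last[symmetric]
        condition_middle[symmetric]) simp_all
  ultimately show ?thesis by blast
qed

end

section \<open>Connectedness of a subgraph of the cycle\<close>

text \<open>The edge from \<open>i\<close> to its successor modulo \<open>n\<close> is labelled by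
  \<open>i\<close>. A cycle that lacks at most one edge is connected, while two missing edges
  separate an arc from the rest.\<close>

lemma cycle_connected_iff:
  assumes n: "2 \<le> n" and E: "E \<subseteq> {0..<n}"
    and R: "\<And>a b. (a, b) \<in> R \<longleftrightarrow> (\<exists>i\<in>E. {a, b} = {i, Suc i mod n})"
  shows "(\<forall>u\<in>{0..<n}. \<forall>v\<in>{0..<n}. (u, v) \<in> R\<^sup>*) \<longleftrightarrow> n - 1 \<le> card E"
proof
  have fin: "finite E" using E finite_subset by blast
  have R_sym: "(b, a) \<in> R" if "(a, b) \<in> R" for a b
    using that unfolding R by (simp add: insert_commute)
  assume "n - 1 \<le> card E"
  then have "card ({0..<n} - E) \<le> 1" using E by (simp add: card_Diff_subset[OF fin])
  \<comment> \<open>\<open>m\<close> is the missing edge, or 0 if the cycle is complete.\<close>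
  then obtain m where m: "m < n" "{0..<n} - E \<subseteq> {m}"
  proof (cases "{0..<n} - E = {}")
    case True then show ?thesis using that[of 0] n by auto
  next
    case False
    then obtain m where m: "m \<in> {0..<n} - E" by blast
    have "\<forall>a\<in>{0..<n} - E. \<forall>b\<in>{0..<n} - E. a = b"
      using \<open>card ({0..<n} - E) \<le> 1\<close> card_le_Suc0_iff_eq[of "{0..<n} - E"] by simp
    then have "{0..<n} - E \<subseteq> {m}" using m by blast
    then show ?thesis using that[of m] m by simp
  qed
  have mem: "i \<in> E" if "i < n" "i \<noteq> m" for i using that m by auto
  \<comment> \<open>Vertices up to \<open>m\<close> walk down to 0, and those beyond
    \<open>m\<close> walk up and around to 0; neither walk uses the edge \<open>m\<close>.\<close>
  have low: "v \<le> m \<Longrightarrow> (v, 0) \<in> R\<^sup>*" for v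
  proof (induction v)
    case (Suc v)
    then have "(Suc v, v) \<in> R" unfolding R using mem[of v] m by (intro bexI[of _ v]) auto
    then show ?case using Suc by (meson Suc_leD converse_rtrancl_into_rtrancl)
  qed simp
  have high: "m < v \<Longrightarrow> v < n \<Longrightarrow> (v, 0) \<in> R\<^sup>*" for v
  proof (induction "n - v" arbitrary: v)
    case (Suc d)
    have e: "(v, Suc v mod n) \<in> R" unfolding R using mem[of v] Suc.prems by (intro bexI[of _ v]) auto
    show ?case
    proof (cases "Suc v = n")
      case True then show ?thesis using e by auto
    next
      case False
      then have "(Suc v, 0) \<in> R\<^sup>*" using Suc by (intro Suc.hyps(1)) auto
      then show ?thesis using e False Suc.prems by (auto intro: converse_rtrancl_into_rtrancl)
    qed
  qed simp
  have to_0: "(v, 0) \<in> R\<^sup>*" if "v < n" for v using low high that not_le by blast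
  show "\<forall>u\<in>{0..<n}. \<forall>v\<in>{0..<n}. (u, v) \<in> R\<^sup>*"
  proof (intro ballI)
    fix u v assume "u \<in> {0..<n}" "v \<in> {0..<n}"
    then have u: "(u, 0) \<in> R\<^sup>*" and v: "(v, 0) \<in> R\<^sup>*" using to_0 by auto
    have "(0, v) \<in> R\<^sup>*" by (rule symmetric_rtrancl[OF R_sym v])
    with u show "(u, v) \<in> R\<^sup>*" by (rule rtrancl_trans)
  qed
next
  have fin: "finite E" using E finite_subset by blast
  assume conn: "\<forall>u\<in>{0..<n}. \<forall>v\<in>{0..<n}. (u, v) \<in> R\<^sup>*"
  show "n - 1 \<le> card E"
  proof (rule ccontr)
    assume "\<not> n - 1 \<le> card E"
    then have "2 \<le> card ({0..<n} - E)" using E by (simp add: card_Diff_subset[OF fin])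
    then obtain D where D: "D \<subseteq> {0..<n} - E" "card D = 2" using obtain_subset_with_card_n by metis
    then obtain x y where xy: "D = {x, y}" "x \<noteq> y" by (meson card_2_iff)
    define a b where "a = min x y" and "b = max x y"
    have ab: "a < b" "b < n" "a \<notin> E" "b \<notin> E" using D xy by (auto simp: a_def b_def min_def max_def)
    \<comment> \<open>The arc between the missing edges \<open>a\<close> and \<open>b\<close>: it
      contains \<open>b\<close> but not \<open>a\<close>, and every edge in \<open>E\<close> has
      both ends inside or both outside.\<close>
    let ?S = "{Suc a..b}"
    have inv: "i \<in> ?S \<longleftrightarrow> Suc i mod n \<in> ?S" if "i \<in> E" for i
    proof -
      have "i \<noteq> a" "i \<noteq> b" "i < n" using that ab E by auto
      then show ?thesis using ab by (cases "Suc i = n") auto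
    qed
    have S_step: "q \<in> ?S" if "(p, q) \<in> R" "p \<in> ?S" for p q
    proof -
      obtain i where i: "i \<in> E" "{p, q} = {i, Suc i mod n}" using \<open>(p, q) \<in> R\<close> R by blast
      then have "p = i \<and> q = Suc i mod n \<or> p = Suc i mod n \<and> q = i" by (simp add: doubleton_eq_iff)
      then show ?thesis using inv[OF i(1)] that(2) by blast
    qed
    have "q \<in> ?S" if "(b, q) \<in> R\<^sup>*" for q
      using that
    proof (induction rule: rtrancl_induct)
      case base
      show ?case using ab by simp
    next
      case (step p q)
      show ?case by (rule S_step[OF step.hyps(2) step.IH])
    qed
    from this[of a] show False using conn ab by simp
  qed
qed

context hermitian_generator
begin

lemma entry_ne_zero_commute: "i < n \<Longrightarrow> j < n \<Longrightarrow> N $$ (i, j) \<noteq> 0 \<Longrightarrow> N $$ (j, i) \<noteq> 0"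
  using sym[of i j] by auto

lemma support_graph_iff: "{a, b} \<in> support_graph n N \<longleftrightarrow> a < n \<and> b < n \<and> a \<noteq> b \<and> N $$ (a, b) \<noteq> 0"
proof
  assume "{a, b} \<in> support_graph n N"
  then obtain i j where ij: "{a, b} = {i, j}" "i < n" "j < n" "i \<noteq> j" "N $$ (i, j) \<noteq> 0" by (auto
    simp: support_graph_def)
  then have "a = i \<and> b = j \<or> a = j \<and> b = i" by (simp add: doubleton_eq_iff)
  then show "a < n \<and> b < n \<and> a \<noteq> b \<and> N $$ (a, b) \<noteq> 0" using ij entry_ne_zero_commute by blast
qed (auto simp: support_graph_def)

text \<open>Under the condition the cyclic entries are nonnegative, so an entry is positive exactly
  if it is nonzero, that is, if its edge of the cycle is present. All edges off the cycle are
  excluded.\<close>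

lemma cycle_connected:
  assumes k: "2 \<le> k" "k \<le> n - 2" and cond: "positivity_condition n k N"
  shows "graph_connected {0..<n} (support_graph n N) \<longleftrightarrow> n - 1 \<le> card {i. i < n \<and> 0 < cyclic_entry n k
    N i}"
proof -
  have n: "4 \<le> n" "2 \<le> n" using k by simp_all
  define E where "E = {i. i < n \<and> 0 < cyclic_entry n k N i}"
  have A: "\<And>i. i + 1 < n \<Longrightarrow> 0 \<le> \<i> * N $$ (i, i + 1)" and B: "0 \<le> (-1) ^ (k - 1) * \<i> * N $$ (n - 1, 0)"
    and C: "\<And>i j. i < n \<Longrightarrow> j < n \<Longrightarrow> \<not> [int i - int j = -1] (mod int n) \<and> \<not> [int i - int j = 0] (mod
      int n) \<and>
       \<not> [int i - int j = 1] (mod int n) \<Longrightarrow> N $$ (i, j) = 0"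
  proof -
    have *: "(\<forall>i. i + 1 < n \<longrightarrow> 0 \<le> \<i> * N $$ (i, i + 1)) \<and> 0 \<le> (-1) ^ (k - 1) * \<i> * N $$ (n - 1, 0) \<and>
      (\<forall>i<n. \<forall>j<n. \<not> [int i - int j = -1] (mod int n) \<and> \<not> [int i - int j = 0] (mod int n) \<and>
       \<not> [int i - int j = 1] (mod int n) \<longrightarrow> N $$ (i, j) = 0)"
      using condition_middle[OF k] positivity_condition_iff cond by (simp only:)
    show "\<And>i. i + 1 < n \<Longrightarrow> 0 \<le> \<i> * N $$ (i, i + 1)" using *[THEN conjunct1] by blast
    show "0 \<le> (-1) ^ (k - 1) * \<i> * N $$ (n - 1, 0)" using *[THEN conjunct2, THEN conjunct1] .
    show "\<And>i j. i < n \<Longrightarrow> j < n \<Longrightarrow> \<not> [int i - int j = -1] (mod int n) \<and> \<not> [int i - int j = 0] (mod int n) \<and>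
       \<not> [int i - int j = 1] (mod int n) \<Longrightarrow> N $$ (i, j) = 0" using *[THEN conjunct2, THEN conjunct2]
         by blast
  qed
  have E_iff: "i \<in> E \<longleftrightarrow> i < n \<and> N $$ (i, Suc i mod n) \<noteq> 0" for i
  proof (cases "i + 1 < n")
    case True
    have "0 < cyclic_entry n k N i \<longleftrightarrow> \<i> * N $$ (i, i + 1) \<noteq> 0"
      using A[OF True] True by (simp add: cyclic_entry_def order.strict_iff_order)
    then show ?thesis using True by (simp add: E_def)
  next
    case False
    show ?thesis
    proof (cases "i < n")
      case True
      then have Suc_i: "Suc i = n" using False by simp
      then have i: "i = n - 1" "Suc i mod n = 0" by auto
      have e: "cyclic_entry n k N i = (-1) ^ (k - 1) * \<i> * N $$ (n - 1, 0)"
        unfolding cyclic_entry_def using False by (rule if_not_P)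
      have "0 < cyclic_entry n k N i \<longleftrightarrow> (-1) ^ (k - 1) * \<i> * N $$ (n - 1, 0) \<noteq> 0"
        unfolding e order_less_le using B by simp
      then show ?thesis using i True by (simp add: E_def)
    qed (simp add: E_def)
  qed
  have R: "(a, b) \<in> {(a, b). {a, b} \<in> support_graph n N} \<longleftrightarrow> (\<exists>i\<in>E. {a, b} = {i, Suc i mod n})" for a b
  proof
    assume "(a, b) \<in> {(a, b). {a, b} \<in> support_graph n N}"
    then have ab: "a < n" "b < n" "a \<noteq> b" "N $$ (a, b) \<noteq> 0" by (simp_all add: support_graph_iff)
    then have "\<not> (a \<noteq> b \<and> a \<noteq> Suc b \<and> b \<noteq> Suc a \<and> \<not> (a = 0 \<and> b = n - 1) \<and> \<not> (b = 0 \<and> a = n - 1))"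
      using C[OF ab(1,2)] not_cong_iff[OF ab(1,2) n(2)] by blast
    then consider "a = Suc b" | "b = Suc a" | "a = 0" "b = n - 1" | "b = 0" "a = n - 1" using ab(3)
      by blast
    then have "b = Suc a mod n \<or> a = Suc b mod n"
      by cases (use ab(1,2) n in simp_all)
    then show "\<exists>i\<in>E. {a, b} = {i, Suc i mod n}"
    proof
      assume b: "b = Suc a mod n"
      then have "a \<in> E" using ab by (simp add: E_iff)
      then show ?thesis using b by blast
    next
      assume a: "a = Suc b mod n"
      then have "b \<in> E" using ab entry_ne_zero_commute[OF ab(1,2,4)] by (simp add: E_iff)
      then show ?thesis using a by blast
    qed
  next
    assume "\<exists>i\<in>E. {a, b} = {i, Suc i mod n}"
    then obtain i where i: "i \<in> E" "{a, b} = {i, Suc i mod n}" by blast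
    have "i < n" "N $$ (i, Suc i mod n) \<noteq> 0" using i(1) by (simp_all add: E_iff)
    moreover have "Suc i mod n < n" using n by simp
    moreover have "i \<noteq> Suc i mod n" using \<open>i < n\<close> n by (cases "Suc i = n") auto
    ultimately have "{i, Suc i mod n} \<in> support_graph n N" by (simp only: support_graph_iff simp_thms)
    then show "(a, b) \<in> {(a, b). {a, b} \<in> support_graph n N}" using i(2) by simp
  qed
  have "E \<subseteq> {0..<n}" by (auto simp: E_def)
  from cycle_connected_iff[OF n(2) this R] show ?thesis
    unfolding graph_connected_def E_def .
qed

end

section \<open>The three metrics and the gradient\<close>

lemma mat_trace_linear:
  "A \<in> carrier_mat n n \<Longrightarrow> B \<in> carrier_mat n n \<Longrightarrow> mat_trace (A + B) = mat_trace A + mat_trace B"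
  "A \<in> carrier_mat n n \<Longrightarrow> B \<in> carrier_mat n n \<Longrightarrow> mat_trace (A - B) = mat_trace A - mat_trace B"
  "A \<in> carrier_mat n n \<Longrightarrow> mat_trace (c \<cdot>\<^sub>m A) = c * mat_trace A"
  by (simp_all add: mat_trace_def sum.distrib sum_subtractf sum_distrib_left)

lemma mat_trace_commute:
  assumes "A \<in> carrier_mat n n" "B \<in> carrier_mat n n"
  shows "mat_trace (A * B) = mat_trace (B * A)"
proof -
  have "mat_trace (A * B) = (\<Sum>i<n. \<Sum>j<n. A $$ (i, j) * B $$ (j, i))"
    unfolding mat_trace_def using assms mat_mult_entry[OF assms] by (simp del: index_mult_mat(1))
  also have "\<dots> = (\<Sum>j<n. \<Sum>i<n. B $$ (j, i) * A $$ (i, j))"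
    by (subst sum.swap) (simp add: mult.commute)
  also have "\<dots> = mat_trace (B * A)"
    unfolding mat_trace_def using assms mat_mult_entry[OF assms(2,1)] by (simp del: index_mult_mat(1))
  finally show ?thesis .
qed

lemma skew_hermitian_carrier: "X \<in> skew_hermitian n \<Longrightarrow> X \<in> carrier_mat n n"
  by (simp add: skew_hermitian_def)

lemma skew_hermitian_entry: "X \<in> skew_hermitian n \<Longrightarrow> i < n \<Longrightarrow> j < n \<Longrightarrow> X $$ (j, i) = - cnj (X $$ (i, j))"
proof -
  assume X: "X \<in> skew_hermitian n" "i < n" "j < n"
  then have "mat_adjoint X $$ (j, i) = (- X) $$ (j, i)" by (simp add: skew_hermitian_def)
  then have "cnj (X $$ (i, j)) = - X $$ (j, i)" using X skew_hermitian_carrier[OF X(1)] by simp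
  then show ?thesis by simp
qed

lemma skew_hermitianI:
  assumes "X \<in> carrier_mat n n" "\<And>i j. i < n \<Longrightarrow> j < n \<Longrightarrow> X $$ (j, i) = - cnj (X $$ (i, j))"
  shows "X \<in> skew_hermitian n"
proof -
  have "mat_adjoint X = - X"
  proof (rule eq_matI)
    fix i j assume "i < dim_row (- X)" "j < dim_col (- X)"
    then have ij: "i < n" "j < n" using assms(1) by auto
    then show "mat_adjoint X $$ (i, j) = (- X) $$ (i, j)" using assms(1) assms(2)[OF ij(2,1)] by simp
  qed (use assms(1) in auto)
  then show ?thesis using assms(1) by (simp add: skew_hermitian_def)
qed

lemma skew_hermitian_add:
  assumes X: "X \<in> skew_hermitian n" and Y: "Y \<in> skew_hermitian n"
  shows "X + Y \<in> skew_hermitian n"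
proof (rule skew_hermitianI)
  fix i j assume ij: "i < n" "j < n"
  show "(X + Y) $$ (j, i) = - cnj ((X + Y) $$ (i, j))"
    using ij skew_hermitian_carrier[OF X] skew_hermitian_carrier[OF Y]
      skew_hermitian_entry[OF X ij] skew_hermitian_entry[OF Y ij] by simp
qed (use skew_hermitian_carrier[OF Y] in simp)

lemma skew_hermitian_scale:
  assumes X: "X \<in> skew_hermitian n"
  shows "complex_of_real c \<cdot>\<^sub>m X \<in> skew_hermitian n"
proof (rule skew_hermitianI)
  fix i j assume ij: "i < n" "j < n"
  show "(complex_of_real c \<cdot>\<^sub>m X) $$ (j, i) = - cnj ((complex_of_real c \<cdot>\<^sub>m X) $$ (i, j))"
    using ij skew_hermitian_carrier[OF X] skew_hermitian_entry[OF X ij] by simp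
qed (use skew_hermitian_carrier[OF X] in simp)

lemma skew_trace_square:
  assumes "X \<in> skew_hermitian n"
  shows "- mat_trace (X * X) = complex_of_real (\<Sum>i<n. \<Sum>j<n. (cmod (X $$ (i, j)))\<^sup>2)"
proof -
  note X = skew_hermitian_carrier[OF assms]
  have "- mat_trace (X * X) = (\<Sum>i<n. \<Sum>j<n. - (X $$ (i, j) * X $$ (j, i)))"
    unfolding mat_trace_def using X mat_mult_entry[OF X X] by (simp add: sum_negf del:
      index_mult_mat(1))
  also have "\<dots> = (\<Sum>i<n. \<Sum>j<n. complex_of_real ((cmod (X $$ (i, j)))\<^sup>2))"
  proof (intro sum.cong refl)
    fix i j assume "i \<in> {..<n}" "j \<in> {..<n}"
    then have "X $$ (j, i) = - cnj (X $$ (i, j))" by (intro skew_hermitian_entry[OF assms]) auto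
    then show "- (X $$ (i, j) * X $$ (j, i)) = complex_of_real ((cmod (X $$ (i, j)))\<^sup>2)"
      by (simp only: complex_norm_square mult_minus_right minus_minus)
  qed
  finally show ?thesis by (simp only: of_real_sum)
qed

section \<open>The tangent space at a point of the orbit\<close>

locale orbit_point = two_eigenvalues n k lam for n k and lam :: "nat \<Rightarrow> real" +
  fixes g :: "complex mat"
  assumes g: "g \<in> unitary_group n"
begin

abbreviation "P \<equiv> subspace_proj n k g"
abbreviation "L \<equiv> conj_diag n lam g"
abbreviation "T \<equiv> tangent_space n L"

lemma P_carrier [simp]: "P \<in> carrier_mat n n" by (rule subspace_proj_facts(1)[OF g])

lemma PP: "P * P = P" by (rule subspace_proj_facts(3)[OF g])

lemma PPX: "X \<in> carrier_mat n n \<Longrightarrow> P * (P * X) = P * X"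
  using assoc_mult_mat[of P n n P n X n] PP by simp

lemma L_carrier [simp]: "L \<in> carrier_mat n n"
  unfolding conj_diag_eq[OF g] by auto

lemma ad_eq:
  assumes [simp]: "X \<in> carrier_mat n n"
  shows "ad L X = (\<i> * gap) \<cdot>\<^sub>m (P * X - X * P)"
  unfolding ad_def conj_diag_eq[OF g]
  by (rule sq_eqI) (simp_all add: sq_simps sq_index algebra_simps del: index_mult_mat(1))

lemma ad_carrier [simp]: "X \<in> carrier_mat n n \<Longrightarrow> ad L X \<in> carrier_mat n n"
  by (simp add: ad_def)

text \<open>Up to the scalar this is the part of \<open>X\<close> that is off-diagonal for the
  splitting into image and kernel of \<open>P\<close>. Applied to \<open>N\<close> it becomes the
  flow field.\<close>

lemma ad_ad:
  assumes [simp]: "X \<in> carrier_mat n n"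
  shows "ad L (ad L X) = (- (complex_of_real gap)\<^sup>2) \<cdot>\<^sub>m (P * X + X * P - 2 \<cdot>\<^sub>m (P * (X * P)))"
  unfolding ad_eq[OF ad_carrier[OF assms]] unfolding ad_eq[OF assms]
  by (rule sq_eqI)
    (simp_all add: sq_simps sq_index PP PPX algebra_simps power2_eq_square del: index_mult_mat(1))

text \<open>The eigenvalues of \<open>ad L\<close> are 0 and plus or minus
  \<open>\<i> * gap\<close>. Hence \<open>- ad L (ad L V)\<close> is \<open>gap\<^sup>2\<close>
  times \<open>V\<close> on tangent vectors, which is why the three metrics are
  proportional.\<close>

lemma ad_ad_ad:
  assumes [simp]: "X \<in> carrier_mat n n"
  shows "ad L (ad L (ad L X)) = (- (complex_of_real gap)\<^sup>2) \<cdot>\<^sub>m ad L X"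
  unfolding ad_ad[OF ad_carrier[OF assms]] unfolding ad_eq[OF assms]
  by (rule sq_eqI)
    (simp_all add: sq_simps sq_index PP PPX algebra_simps del: index_mult_mat(1))

lemma ad_add: "X \<in> carrier_mat n n \<Longrightarrow> Y \<in> carrier_mat n n \<Longrightarrow> ad L (X + Y) = ad L X + ad L Y"
  by (rule sq_eqI) (simp_all add: ad_eq sq_simps sq_index algebra_simps del: index_mult_mat(1))

lemma ad_minus: "X \<in> carrier_mat n n \<Longrightarrow> Y \<in> carrier_mat n n \<Longrightarrow> ad L (X - Y) = ad L X - ad L Y"
  by (rule sq_eqI) (simp_all add: ad_eq sq_simps sq_index algebra_simps del: index_mult_mat(1))

lemma ad_scale: "X \<in> carrier_mat n n \<Longrightarrow> ad L (c \<cdot>\<^sub>m X) = c \<cdot>\<^sub>m ad L X"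
  by (rule sq_eqI) (simp_all add: ad_eq sq_simps sq_index algebra_simps del: index_mult_mat(1))

lemma ad_skew:
  assumes X: "X \<in> skew_hermitian n"
  shows "ad L X \<in> skew_hermitian n"
proof -
  note [simp] = skew_hermitian_carrier[OF X]
  have XA: "mat_adjoint X = - X" using X by (simp add: skew_hermitian_def)
  have "mat_adjoint (ad L X) = - ad L X"
    unfolding ad_eq[OF skew_hermitian_carrier[OF X]]
    by (rule sq_eqI) (simp_all add: mat_adjoint_smult mat_adjoint_minus[of _ "_ :: complex mat"]
      mat_adjoint_mult[of _ n n _ n]
        subspace_proj_facts(2)[OF g] XA carrier_matD[OF P_carrier] carrier_matD[OF
          skew_hermitian_carrier[OF X]]
        sq_uminus sq_index algebra_simps del: index_mult_mat(1))
  then show ?thesis by (simp add: skew_hermitian_def)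
qed

lemma T_skew: "V \<in> T \<Longrightarrow> V \<in> skew_hermitian n"
  by (auto simp: tangent_space_def intro: ad_skew)

lemma T_carrier: "V \<in> T \<Longrightarrow> V \<in> carrier_mat n n"
  by (rule skew_hermitian_carrier[OF T_skew])

lemma T_ad_ad: "V \<in> T \<Longrightarrow> ad L (ad L V) = (- (complex_of_real gap)\<^sup>2) \<cdot>\<^sub>m V"
  by (auto simp: tangent_space_def skew_hermitian_carrier intro: ad_ad_ad)

lemma T_ad: "X \<in> skew_hermitian n \<Longrightarrow> ad L X \<in> T"
  by (simp add: tangent_space_def)

lemma T_add:
  assumes "V \<in> T" "W \<in> T"
  shows "V + W \<in> T"
proof -
  obtain X Y where X: "X \<in> skew_hermitian n" "V = ad L X" and Y: "Y \<in> skew_hermitian n" "W = ad L Y"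
    using assms unfolding tangent_space_def by blast
  have "V + W = ad L (X + Y)"
    unfolding X(2) Y(2) by (rule ad_add[symmetric]) (rule skew_hermitian_carrier, fact)+
  then show ?thesis using T_ad[OF skew_hermitian_add[OF X(1) Y(1)]] by simp
qed

lemma T_scale:
  assumes "V \<in> T"
  shows "complex_of_real c \<cdot>\<^sub>m V \<in> T"
proof -
  obtain X where X: "X \<in> skew_hermitian n" "V = ad L X"
    using assms unfolding tangent_space_def by blast
  have "complex_of_real c \<cdot>\<^sub>m V = ad L (complex_of_real c \<cdot>\<^sub>m X)"
    unfolding X(2) by (rule ad_scale[symmetric]) (rule skew_hermitian_carrier, fact)
  then show ?thesis using T_ad[OF skew_hermitian_scale[OF X(1)]] by simp
qed

lemma trace_ad: "X \<in> carrier_mat n n \<Longrightarrow> mat_trace (ad L X) = 0"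
  unfolding ad_def using mat_trace_commute[of L n X] by (simp add: mat_trace_linear[of _ n])

text \<open>Tangent vectors are commutators and have trace 0, which removes the second term of
  \<open>kappa\<close>.\<close>

lemma kappa_T: "V \<in> T \<Longrightarrow> kappa n V X = 2 * of_nat n * mat_trace (V * X)"
  unfolding kappa_def by (auto simp: tangent_space_def skew_hermitian_carrier trace_ad)

text \<open>Invariance of the trace form under conjugation, in infinitesimal form:
  \<open>ad L\<close> is skew-adjoint.\<close>

lemma trace_ad_commute:
  assumes [simp]: "X \<in> carrier_mat n n" "Y \<in> carrier_mat n n"
  shows "mat_trace (ad L X * Y) = - mat_trace (X * ad L Y)"
proof -
  have "mat_trace (L * (X * Y)) = mat_trace (X * (Y * L))"
    using mat_trace_commute[of L n "X * Y"] by (simp add: sq_simps)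
  then show ?thesis unfolding ad_def by (simp add: sq_simps mat_trace_linear[of _ n])
qed

lemma trace_ad_ad:
  assumes V: "V \<in> T" and X: "X \<in> carrier_mat n n"
  shows "mat_trace (ad L (ad L X) * V) = (- (complex_of_real gap)\<^sup>2) * mat_trace (X * V)"
proof -
  note [simp] = T_carrier[OF V] X
  have "mat_trace (ad L (ad L X) * V) = mat_trace (X * ad L (ad L V))"
    using trace_ad_commute[of "ad L X" V] trace_ad_commute[of X "ad L V"] by simp
  then show ?thesis unfolding T_ad_ad[OF V] by (simp add: sq_simps mat_trace_linear[of _ n])
qed

lemma kappa_definite:
  assumes V: "V \<in> T"
  shows "- kappa n V V = complex_of_real (2 * real n * (\<Sum>i<n. \<Sum>j<n. (cmod (V $$ (i, j)))\<^sup>2))"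
proof -
  have "- kappa n V V = 2 * of_nat n * (- mat_trace (V * V))" unfolding kappa_T[OF V] by simp
  then show ?thesis unfolding skew_trace_square[OF T_skew[OF V]] by (simp del: of_real_sum)
qed

text \<open>On tangent vectors \<open>- kappa\<close> is a sum of squares. The uniqueness arguments
  for the square root and for the gradient both end here.\<close>

lemma kappa_definite_zero:
  assumes V: "V \<in> T" and "0 \<le> kappa n V V"
  shows "V = 0\<^sub>m n n"
proof -
  have "kappa n V V = - complex_of_real (2 * real n * (\<Sum>i<n. \<Sum>j<n. (cmod (V $$ (i, j)))\<^sup>2))"
    using kappa_definite[OF V] by (metis minus_minus)
  then have "real n * (\<Sum>i<n. \<Sum>j<n. (cmod (V $$ (i, j)))\<^sup>2) \<le> 0"
    using assms(2) by (simp add: less_eq_complex_def del: of_real_sum)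
  then have "(\<Sum>i<n. \<Sum>j<n. (cmod (V $$ (i, j)))\<^sup>2) \<le> 0"
    using k_less by (simp add: mult_le_0_iff)
  moreover have "0 \<le> (\<Sum>i<n. \<Sum>j<n. (cmod (V $$ (i, j)))\<^sup>2)" by (intro sum_nonneg) auto
  ultimately have "(\<Sum>i<n. \<Sum>j<n. (cmod (V $$ (i, j)))\<^sup>2) = 0" by linarith
  then have "(\<Sum>j<n. (cmod (V $$ (i, j)))\<^sup>2) = 0" if "i < n" for i
    using that by (subst (asm) sum_nonneg_eq_0_iff) (auto intro: sum_nonneg)
  then have "(cmod (V $$ (i, j)))\<^sup>2 = 0" if "i < n" "j < n" for i j
    using that sum_nonneg_eq_0_iff[of "{..<n}" "\<lambda>j. (cmod (V $$ (i, j)))\<^sup>2"] by auto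
  then show ?thesis using T_carrier[OF V] by (intro sq_eqI) auto
qed

section \<open>Evaluation of the metrics\<close>

text \<open>Because the cube of \<open>ad L\<close> is \<open>- gap\<^sup>2\<close> times
  \<open>ad L\<close>, the operator \<open>- 1 / gap\<^sup>2\<close> times its square is the
  projection onto the image along the kernel.\<close>

lemma im_part_eq:
  assumes X: "X \<in> skew_hermitian n"
  shows "im_part n L X = complex_of_real (- 1 / gap\<^sup>2) \<cdot>\<^sub>m ad L (ad L X)"
  unfolding im_part_def
proof (rule the_equality)
  note [simp] = skew_hermitian_carrier[OF X]
  let ?Z = "complex_of_real (- 1 / gap\<^sup>2) \<cdot>\<^sub>m ad L (ad L X)"
  have "ad L ?Z = ad L X"
    using gap_pos ad_ad_ad[of X]
    by (subst ad_scale) (simp_all, rule sq_eqI, simp_all add: sq_index)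
  then have "ad L (X - ?Z) = 0\<^sub>m n n"
    by (subst ad_minus) simp_all
  then show "?Z \<in> T \<and> ad L (X - ?Z) = 0\<^sub>m n n" using T_scale[OF T_ad[OF ad_skew[OF X]]] by blast
  fix Z assume Z: "Z \<in> T \<and> ad L (X - Z) = 0\<^sub>m n n"
  then have Zc [simp]: "Z \<in> carrier_mat n n" using T_carrier by blast
  have e: "ad L X - ad L Z = 0\<^sub>m n n" using Z ad_minus[of X Z] by simp
  have "ad L X = ad L Z"
  proof (rule sq_eqI)
    fix i j assume ij: "i < n" "j < n"
    have "(ad L X - ad L Z) $$ (i, j) = 0" using e ij by simp
    then show "ad L X $$ (i, j) = ad L Z $$ (i, j)" using ij by (simp add: sq_index)
  qed simp_all
  then have "ad L (ad L X) = (- (complex_of_real gap)\<^sup>2) \<cdot>\<^sub>m Z" using T_ad_ad Z by simp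
  then show "Z = ?Z" using gap_pos by (intro sq_eqI) (simp_all add: sq_index)
qed

text \<open>The result does not depend on the preimage chosen, since \<open>ad L (ad L X)\<close>
  equals \<open>ad L V\<close> whenever \<open>ad L X = V\<close>.\<close>

lemma im_part_preimage:
  assumes V: "V \<in> T"
  shows "im_part n L (ad_preimage n L V) = complex_of_real (- 1 / gap\<^sup>2) \<cdot>\<^sub>m ad L V"
proof -
  have "\<exists>X. X \<in> skew_hermitian n \<and> ad L X = V" using V by (auto simp: tangent_space_def)
  then have "ad_preimage n L V \<in> skew_hermitian n \<and> ad L (ad_preimage n L V) = V"
    unfolding ad_preimage_def by (rule someI_ex)
  then show ?thesis using im_part_eq by simp
qed

text \<open>The two projections contribute \<open>1 / gap ^ 4\<close>, and moving
  \<open>ad L\<close> across the trace gives back \<open>gap\<^sup>2\<close>.\<close>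

lemma normal_metric_eq:
  assumes V: "V \<in> T" and W: "W \<in> T"
  shows "normal_metric n L V W = - complex_of_real (1 / gap\<^sup>2) * kappa n V W"
proof -
  note [simp] = T_carrier[OF V] T_carrier[OF W]
  let ?c = "complex_of_real (- 1 / gap\<^sup>2)"
  have "normal_metric n L V W = - kappa n (?c \<cdot>\<^sub>m ad L V) (?c \<cdot>\<^sub>m ad L W)"
    unfolding normal_metric_def im_part_preimage[OF V] im_part_preimage[OF W] ..
  also have "\<dots> = - (2 * of_nat n * mat_trace ((?c \<cdot>\<^sub>m ad L V) * (?c \<cdot>\<^sub>m ad L W)))"
    unfolding kappa_T[OF T_scale[OF T_ad[OF T_skew[OF V]]]] ..
  also have "mat_trace ((?c \<cdot>\<^sub>m ad L V) * (?c \<cdot>\<^sub>m ad L W)) = ?c * ?c * mat_trace (ad L V * ad L W)"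
    by (simp add: sq_simps mat_trace_linear[of _ n])
  also have "mat_trace (ad L V * ad L W) = (complex_of_real gap)\<^sup>2 * mat_trace (V * W)"
    using trace_ad_commute[of V "ad L W"] T_ad_ad[OF W] by (simp add: sq_simps mat_trace_linear[of _ n])
  finally show ?thesis using gap_pos unfolding kappa_T[OF V]
    by (simp add: field_simps power2_eq_square)
qed

lemma kappa_scale_left: "V \<in> T \<Longrightarrow> X \<in> carrier_mat n n \<Longrightarrow>
    kappa n (complex_of_real c \<cdot>\<^sub>m V) X = complex_of_real c * kappa n V X"
  using kappa_T[OF T_scale] T_carrier[of V] by (simp add: kappa_T sq_simps mat_trace_linear[of _ n])

lemma sqrt_exists: "is_positive_sqrt_neg_ad_sq n L (\<lambda>V. complex_of_real gap \<cdot>\<^sub>m V)"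
  unfolding is_positive_sqrt_neg_ad_sq_def
proof (intro conjI ballI allI)
  fix V W assume V: "V \<in> T" and W: "W \<in> T"
  note [simp] = T_carrier[OF V] T_carrier[OF W]
  show "complex_of_real gap \<cdot>\<^sub>m (V + W) = complex_of_real gap \<cdot>\<^sub>m V + complex_of_real gap \<cdot>\<^sub>m W"
    by (rule sq_eqI) (simp_all add: sq_index algebra_simps)
  show "kappa n (complex_of_real gap \<cdot>\<^sub>m V) W = kappa n V (complex_of_real gap \<cdot>\<^sub>m W)"
    unfolding kappa_scale_left[OF V T_carrier[OF W]] kappa_T[OF V] by (simp add: sq_simps
      mat_trace_linear[of _ n])
next
  fix V assume V: "V \<in> T"
  note [simp] = T_carrier[OF V]
  show "complex_of_real gap \<cdot>\<^sub>m V \<in> T" by (rule T_scale[OF V])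
  have "- kappa n (complex_of_real gap \<cdot>\<^sub>m V) V = complex_of_real gap * (- kappa n V V)"
    unfolding kappa_scale_left[OF V T_carrier[OF V]] by simp
  also have "\<dots> = complex_of_real (gap * (2 * real n * (\<Sum>i<n. \<Sum>j<n. (cmod (V $$ (i, j)))\<^sup>2)))"
    unfolding kappa_definite[OF V] by simp
  finally show "0 \<le> - kappa n (complex_of_real gap \<cdot>\<^sub>m V) V"
    using gap_pos by (simp add: less_eq_complex_def sum_nonneg del: of_real_sum of_real_mult)
  show "complex_of_real gap \<cdot>\<^sub>m (complex_of_real gap \<cdot>\<^sub>m V) = - ad L (ad L V)"
    unfolding T_ad_ad[OF V] by (rule sq_eqI) (simp_all add: sq_index power2_eq_square)
  show "complex_of_real gap \<cdot>\<^sub>m (complex_of_real c \<cdot>\<^sub>m V) = complex_of_real c \<cdot>\<^sub>m (complex_of_real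
    gap \<cdot>\<^sub>m V)" for c
    by (rule sq_eqI) (simp_all add: sq_index)
qed

text \<open>The vector \<open>W = S V - gap V\<close> satisfies \<open>S W = - gap W\<close>.
  Positivity of \<open>S\<close> and definiteness of \<open>- kappa\<close> force it to be
  0.\<close>

lemma sqrt_unique:
  assumes S: "is_positive_sqrt_neg_ad_sq n L S" and V: "V \<in> T"
  shows "S V = complex_of_real gap \<cdot>\<^sub>m V"
proof -
  note S' = S[unfolded is_positive_sqrt_neg_ad_sq_def]
  have SV: "S V \<in> T" using S' V by blast
  note [simp] = T_carrier[OF V] T_carrier[OF SV]
  define W where "W = S V + complex_of_real (- gap) \<cdot>\<^sub>m V"
  have W: "W \<in> T" unfolding W_def by (intro T_add SV T_scale V)
  note [simp] = T_carrier[OF W]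
  have "S W = S (S V) + S (complex_of_real (- gap) \<cdot>\<^sub>m V)"
    unfolding W_def using S' SV T_scale[OF V] by blast
  also have "S (S V) = - ad L (ad L V)" using S' V by blast
  also have "S (complex_of_real (- gap) \<cdot>\<^sub>m V) = complex_of_real (- gap) \<cdot>\<^sub>m S V" using S' V by blast
  finally have "S W = complex_of_real (- gap) \<cdot>\<^sub>m W"
    unfolding T_ad_ad[OF V] W_def
    by (intro sq_eqI) (simp_all add: sq_index algebra_simps power2_eq_square)
  then have e: "kappa n (S W) W = complex_of_real (- gap) * kappa n W W"
    by (simp only: kappa_scale_left[OF W T_carrier[OF W]])
  have "0 \<le> - kappa n (S W) W" using S' W by blast
  then have "0 \<le> complex_of_real gap * kappa n W W" unfolding e by simp
  then have "0 \<le> kappa n W W" using gap_pos by (simp add: less_eq_complex_def zero_le_mult_iff)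
  then have "W = 0\<^sub>m n n" by (rule kappa_definite_zero[OF W])
  then have z: "W $$ (i, j) = 0" if "i < n" "j < n" for i j using that by simp
  show ?thesis
  proof (rule sq_eqI)
    fix i j assume ij: "i < n" "j < n"
    then show "S V $$ (i, j) = (complex_of_real gap \<cdot>\<^sub>m V) $$ (i, j)"
      using z[OF ij] by (simp add: W_def sq_index)
  qed simp_all
qed

lemma kaehler_metric_eq:
  assumes V: "V \<in> T" and W: "W \<in> T"
  shows "kaehler_metric n L V W = - complex_of_real (1 / gap) * kappa n V W"
proof -
  have "is_positive_sqrt_neg_ad_sq n L (sqrt_neg_ad_sq n L)"
    unfolding sqrt_neg_ad_sq_def by (rule someI[where P = "is_positive_sqrt_neg_ad_sq n L", OF
      sqrt_exists])
  then have "sqrt_neg_ad_sq n L V = complex_of_real gap \<cdot>\<^sub>m V" using V by (rule sqrt_unique)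
  then show ?thesis
    unfolding kaehler_metric_def using normal_metric_eq[OF T_scale[OF V] W] gap_pos
    by (simp add: kappa_scale_left[OF V T_carrier[OF W]] power2_eq_square)
qed

section \<open>The gradient of the height function\<close>

lemma height_derivative:
  assumes W: "W \<in> T" and N: "N \<in> carrier_mat n n"
  shows "((\<lambda>s. kappa n (L + complex_of_real s \<cdot>\<^sub>m W) N) has_vector_derivative kappa n W N) (at 0)"
proof -
  note [simp] = T_carrier[OF W] N
  have "kappa n (L + complex_of_real s \<cdot>\<^sub>m W) N = kappa n L N + complex_of_real s * kappa n W N" for s
    unfolding kappa_def by (simp add: sq_simps mat_trace_linear[of _ n] algebra_simps)
  then show ?thesis
    by (auto intro!: derivative_eq_intros)
qed

text \<open>The gradient is \<open>- 1 / m\<close> times the tangential part of \<open>N\<close>.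
  The factor \<open>\<i> * gap\<close> is the rate at which the orbit point changes with
  \<open>P\<close>; dividing it out leaves the flow field of a positive multiple of
  \<open>\<i> \<cdot>\<^sub>m N\<close>.\<close>

lemma is_gradient_iff:
  assumes m: "0 < m" and metric: "\<And>V W. V \<in> T \<Longrightarrow> W \<in> T \<Longrightarrow> G L V W = - complex_of_real m * kappa n V W"
    and N: "N \<in> skew_hermitian n"
  shows "is_gradient n G (\<lambda>M. kappa n M N) L V \<longleftrightarrow>
    V = (\<i> * gap) \<cdot>\<^sub>m flow_field (complex_of_real (1 / (m * gap)) \<cdot>\<^sub>m (\<i> \<cdot>\<^sub>m N)) P"
proof -
  note Nc [simp] = skew_hermitian_carrier[OF N]
  define V0 where "V0 = complex_of_real (1 / (m * gap\<^sup>2)) \<cdot>\<^sub>m ad L (ad L N)"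
  have V0: "V0 \<in> T" unfolding V0_def by (intro T_scale T_ad ad_skew N)
  note [simp] = T_carrier[OF V0]
  have V0_eq: "V0 = (\<i> * gap) \<cdot>\<^sub>m flow_field (complex_of_real (1 / (m * gap)) \<cdot>\<^sub>m (\<i> \<cdot>\<^sub>m N)) P"
    unfolding V0_def ad_ad[OF Nc] flow_field_def
    using gap_pos m by (intro sq_eqI) (simp_all add: sq_simps sq_index field_simps power2_eq_square
      del: index_mult_mat(1))
  have V0_metric: "G L V0 W = kappa n W N" if W: "W \<in> T" for W
  proof -
    note [simp] = T_carrier[OF W]
    have "mat_trace (V0 * W) = complex_of_real (1 / (m * gap\<^sup>2)) * mat_trace (ad L (ad L N) * W)"
      unfolding V0_def by (simp add: sq_simps mat_trace_linear[of _ n])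
    also have "\<dots> = - complex_of_real (1 / m) * mat_trace (W * N)"
      unfolding trace_ad_ad[OF W Nc] mat_trace_commute[OF Nc T_carrier[OF W]] using gap_pos by simp
    finally show ?thesis unfolding metric[OF V0 W] kappa_T[OF V0] kappa_T[OF W] using m by simp
  qed
  have grad0: "is_gradient n G (\<lambda>M. kappa n M N) L V0"
    unfolding is_gradient_def using V0 V0_metric height_derivative[OF _ Nc] by simp
  show ?thesis
  proof
    assume V: "is_gradient n G (\<lambda>M. kappa n M N) L V"
    then have VT: "V \<in> T" by (simp add: is_gradient_def)
    note [simp] = T_carrier[OF VT]
    \<comment> \<open>Both gradients have the same inner product with every tangent vector; testing
      with their difference shows that the difference is 0.\<close>
    define D where "D = V + complex_of_real (- 1) \<cdot>\<^sub>m V0"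
    have D: "D \<in> T" unfolding D_def by (intro T_add VT T_scale V0)
    note [simp] = T_carrier[OF D]
    have "G L V D = kappa n D N"
      using V D height_derivative[OF D Nc] unfolding is_gradient_def
      by (blast intro: vector_derivative_unique_at)
    then have "G L V D = G L V0 D" using V0_metric[OF D] by simp
    then have e: "kappa n V D = kappa n V0 D" unfolding metric[OF VT D] metric[OF V0 D] using m by simp
    have "kappa n D D = kappa n V D - kappa n V0 D"
      unfolding kappa_T[OF D] kappa_T[OF VT] kappa_T[OF V0]
      by (subst (1) D_def) (simp add: sq_simps mat_trace_linear[of _ n] right_diff_distrib)
    then have "0 \<le> kappa n D D" using e by simp
    then have "D = 0\<^sub>m n n" by (rule kappa_definite_zero[OF D])
    then have z: "D $$ (i, j) = 0" if "i < n" "j < n" for i j using that by simp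
    have "V = V0"
    proof (rule sq_eqI)
      fix i j assume ij: "i < n" "j < n"
      then show "V $$ (i, j) = V0 $$ (i, j)" using z[OF ij] by (simp add: D_def sq_index)
    qed simp_all
    then show "V = (\<i> * gap) \<cdot>\<^sub>m flow_field (complex_of_real (1 / (m * gap)) \<cdot>\<^sub>m (\<i> \<cdot>\<^sub>m N)) P"
      using V0_eq by simp
  qed (use grad0 V0_eq in simp)
qed

end

section \<open>Necessity of the conditions\<close>

lemma sum_single_support:
  assumes "finite S" "J \<in> S" "\<And>I. I \<in> S \<Longrightarrow> I \<noteq> J \<Longrightarrow> f I = (0::complex)"
  shows "(\<Sum>I\<in>S. f I) = f J"
proof -
  have "(\<Sum>I\<in>S. f I) = f J + (\<Sum>I\<in>S - {J}. f I)" using assms by (intro sum.remove) auto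
  also have "(\<Sum>I\<in>S - {J}. f I) = 0" using assms by (intro sum.neutral) auto
  finally show ?thesis by simp
qed

text \<open>A permutation matrix whose first \<open>k\<close> columns are the coordinate vectors of
  \<open>J\<close> in increasing order. Another \<open>k\<close>-set contains an index outside
  \<open>J\<close>, and the corresponding row vanishes in these columns.\<close>

lemma coordinate_flag:
  assumes J: "J \<in> ksubsets n k"
  shows "\<exists>g \<in> unitary_group n. \<forall>I \<in> ksubsets n k. plucker g I = (if I = J then 1 else 0)"
proof -
  define xs where "xs = slist J @ slist ({0..<n} - J)"
  have J': "J \<subseteq> {0..<n}" "card J = k" "finite J" using ksubsetsD[OF J] by auto
  have set_xs: "set xs = {0..<n}" and dist: "distinct xs" using J' by (auto simp: xs_def)
  have len: "length xs = n" using distinct_card[OF dist] set_xs by simp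
  have nth_less: "xs ! b < n" if "b < n" for b using nth_mem[of b xs] that len set_xs by auto
  have inj: "xs ! a = xs ! b \<longleftrightarrow> a = b" if "a < n" "b < n" for a b
    using nth_eq_iff_index_eq[OF dist] that len by simp
  have kn: "k \<le> n" using J' card_mono[of "{0..<n}" J] by simp
  have low: "xs ! b = slist J ! b" if "b < k" for b using that J' by (simp add: xs_def nth_append)
  define g where "g = mat n n (\<lambda>(a, b). if a = xs ! b then 1 else 0 :: complex)"
  have g: "g \<in> carrier_mat n n" by (simp add: g_def)
  have "g \<in> unitary_group n"
  proof (rule unitary_groupI[OF g])
    show "mat_adjoint g * g = 1\<^sub>m n"
    proof (rule eq_matI)
      fix a b assume "a < dim_row (1\<^sub>m n)" "b < dim_col (1\<^sub>m n)"
      then have ab: "a < n" "b < n" by auto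
      have "(mat_adjoint g * g) $$ (a, b) = (\<Sum>i<n. cnj (g $$ (i, a)) * g $$ (i, b))"
        using mat_mult_entry[OF mat_adjoint_carrier[OF g] g ab] g ab by simp
      also have "\<dots> = (\<Sum>i<n. if i = xs ! a then (if a = b then 1 else 0) else 0)"
        using ab inj[OF ab] by (intro sum.cong) (auto simp: g_def)
      also have "\<dots> = (if a = b then 1 else 0)" using nth_less[OF ab(1)] by simp
      finally show "(mat_adjoint g * g) $$ (a, b) = 1\<^sub>m n $$ (a, b)" using ab by simp
    qed (use g in auto)
  qed
  moreover have "plucker g I = (if I = J then 1 else 0)" if I: "I \<in> ksubsets n k" for I
  proof (cases "I = J")
    case True
    have "mat k k (\<lambda>(a, b). g $$ (slist J ! a, b)) = 1\<^sub>m k"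
    proof (rule eq_matI)
      fix a b assume "a < dim_row (1\<^sub>m k)" "b < dim_col (1\<^sub>m k)"
      then have ab: "a < k" "b < k" by auto
      then have ab': "a < n" "b < n" using kn by auto
      show "mat k k (\<lambda>(a, b). g $$ (slist J ! a, b)) $$ (a, b) = 1\<^sub>m k $$ (a, b)"
        using ab ab' nth_less[OF ab'(1)] inj[OF ab'] by (simp add: g_def low[OF ab(1), symmetric])
    qed auto
    then show ?thesis using True J' by (simp add: plucker_eq_det)
  next
    case False
    have I': "I \<subseteq> {0..<n}" "card I = k" "finite I" using ksubsetsD[OF I] by auto
    have "\<not> I \<subseteq> J" using False card_subset_eq[OF J'(3), of I] I' J' by auto
    then obtain i where i: "i \<in> I" "i \<notin> J" by blast
    then have "i \<in> set (slist I)" using I' by simp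
    then obtain a where a: "a < length (slist I)" "slist I ! a = i" by (auto simp: in_set_conv_nth)
    have ak: "a < k" using a I' by simp
    have zero: "g $$ (i, b) = 0" if "b < k" for b
    proof -
      have "slist J ! b \<in> J" using nth_mem[of b "slist J"] that J' by simp
      then have "i \<noteq> xs ! b" using i low[OF that] by auto
      then show ?thesis using i I' that kn by (auto simp: g_def)
    qed
    have "row_minor g (slist I) = 0"
      unfolding row_minor_expand
    proof (intro sum.neutral ballI)
      fix p assume "p \<in> {p. p permutes {0..<length (slist I)}}"
      then have "p a < k" using permutes_in_image[of p "{0..<length (slist I)}" a] ak I' by simp
      then have "g $$ (slist I ! a, p a) = 0" using zero a(2) by simp
      then have "(\<Prod>a = 0..<length (slist I). g $$ (slist I ! a, p a)) = 0"
        using a(1) by (intro prod_zero) (auto intro: bexI[of _ a])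
      then show "complex_of_int (sign p) * (\<Prod>a = 0..<length (slist I). g $$ (slist I ! a, p a)) = 0"
        by simp
    qed
    then show ?thesis using False by (simp add: plucker_def)
  qed
  ultimately show ?thesis by blast
qed

text \<open>The sign of \<open>f\<close> is known only to the right of 0. The imaginary part
  vanishes there, so its derivative can be neither positive nor negative.\<close>

lemma deriv_nonneg_of_nonneg:
  assumes der: "(f has_vector_derivative D) (at (0::real))" and zero: "f 0 = (0::complex)"
    and nonneg: "\<And>t. 0 \<le> t \<Longrightarrow> 0 \<le> f t"
  shows "0 \<le> D"
proof -
  have re: "((\<lambda>t. Re (f t)) has_real_derivative Re D) (at 0)" and im: "((\<lambda>t. Im (f t))
    has_real_derivative Im D) (at 0)"
    using der by (auto simp: has_vector_derivative_complex_iff o_def)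
  have f: "0 \<le> Re (f t)" "Im (f t) = 0" if "0 \<le> t" for t
    using nonneg[OF that] by (auto simp: less_eq_complex_def)
  have "\<not> Re D < 0"
  proof
    assume "Re D < 0"
    from DERIV_neg_dec_right[OF re this] obtain d where d: "0 < d" "\<forall>h>0. h < d \<longrightarrow> Re (f (0 + h)) <
      Re (f 0)" by blast
    then have "Re (f (d / 2)) < 0" using zero by simp
    then show False using f(1)[of "d / 2"] d(1) by simp
  qed
  moreover have "\<not> Im D < 0"
  proof
    assume "Im D < 0"
    from DERIV_neg_dec_right[OF im this] obtain d where d: "0 < d" "\<forall>h>0. h < d \<longrightarrow> Im (f (0 + h)) <
      Im (f 0)" by blast
    then have "Im (f (d / 2)) < 0" using zero by simp
    then show False using f(2)[of "d / 2"] d(1) by simp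
  qed
  moreover have "\<not> 0 < Im D"
  proof
    assume "0 < Im D"
    from DERIV_pos_inc_right[OF im this] obtain d where d: "0 < d" "\<forall>h>0. h < d \<longrightarrow> Im (f 0) < Im (f
      (0 + h))" by blast
    then have "0 < Im (f (d / 2))" using zero by simp
    then show False using f(2)[of "d / 2"] d(1) by simp
  qed
  ultimately show ?thesis by (simp add: less_eq_complex_def)
qed

text \<open>Exactly one exchange turns \<open>insert i K\<close> into \<open>insert j K\<close>, so
  the double sum has a single nonzero term.\<close>

lemma exchange_matrix_entry:
  assumes K: "K \<subseteq> {0..<n}" and ij: "i < n" "j < n" "i \<notin> K" "j \<notin> K" "i \<noteq> j"
  shows "exchange_matrix n A (insert i K) (insert j K) = A $$ (i, j) * exchange_sign K i j"
proof -
  let ?I = "insert i K" and ?J = "insert j K"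
  have fin: "finite K" using K finite_subset by blast
  have IK: "?I - {i} = K" using ij by auto
  let ?f = "\<lambda>i' c. if insert c (?I - {i'}) = ?J then A $$ (i', c) * exchange_sign (?I - {i'}) i' c
    else 0"
  have uniq: "i' = i \<and> c = j" if "i' \<in> ?I" "c \<notin> ?I - {i'}" "insert c (?I - {i'}) = ?J" for i' c
  proof -
    have "i \<notin> ?J" using ij by auto
    then have "i' = i" using that by auto
    then show ?thesis using that ij IK by auto
  qed
  have "exchange_matrix n A ?I ?J = (\<Sum>i'\<in>?I. \<Sum>c\<in>{0..<n} - (?I - {i'}). ?f i' c)"
    by (simp add: exchange_matrix_def)
  also have "\<dots> = (\<Sum>c\<in>{0..<n} - (?I - {i}). ?f i c)"
  proof (rule sum_single_support)
    fix i' assume i': "i' \<in> ?I" "i' \<noteq> i"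
    show "(\<Sum>c\<in>{0..<n} - (?I - {i'}). ?f i' c) = 0"
    proof (intro sum.neutral ballI)
      fix c assume "c \<in> {0..<n} - (?I - {i'})"
      then have "insert c (?I - {i'}) \<noteq> ?J" using uniq[OF i'(1), of c] i'(2) by blast
      then show "?f i' c = 0" by (rule if_not_P)
    qed
  qed (use fin in simp_all)
  also have "\<dots> = ?f i j"
  proof (rule sum_single_support)
    show "j \<in> {0..<n} - (?I - {i})" using ij by simp
    fix c assume c: "c \<in> {0..<n} - (?I - {i})" "c \<noteq> j"
    then have "insert c (?I - {i}) \<noteq> ?J" using uniq[of i c] by blast
    then show "?f i c = 0" by (rule if_not_P)
  qed simp
  finally show ?thesis using IK by simp
qed

lemma exchange_matrix_bound:
  assumes "I \<in> ksubsets n k" "J \<in> ksubsets n k"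
  shows "cmod (exchange_matrix n A I J) \<le> (\<Sum>I\<in>ksubsets n k. \<Sum>J\<in>ksubsets n k. cmod (exchange_matrix n
    A I J))"
proof -
  have "cmod (exchange_matrix n A I J) \<le> (\<Sum>J\<in>ksubsets n k. cmod (exchange_matrix n A I J))"
    using assms by (intro member_le_sum) auto
  also have "\<dots> \<le> (\<Sum>I\<in>ksubsets n k. \<Sum>J\<in>ksubsets n k. cmod (exchange_matrix n A I J))"
    using assms by (intro member_le_sum[of I "ksubsets n k" "\<lambda>I. \<Sum>J\<in>ksubsets n k. cmod
      (exchange_matrix n A I J)"]) (auto intro: sum_nonneg)
  finally show ?thesis .
qed

text \<open>If A does not connect S to its complement, tokens never enter or leave S, so the number of
  tokens in S is conserved.\<close>

lemma exchange_matrix_conserves: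
  assumes A: "\<And>i c. i < n \<Longrightarrow> c < n \<Longrightarrow> A $$ (i, c) \<noteq> 0 \<Longrightarrow> i \<noteq> c \<Longrightarrow> i \<in> S \<longleftrightarrow> c \<in> S"
    and I: "I \<in> ksubsets n k" and ne: "card (I \<inter> S) \<noteq> card (J \<inter> S)"
  shows "exchange_matrix n A I J = 0"
  unfolding exchange_matrix_def
proof (intro sum.neutral ballI)
  fix i c assume i: "i \<in> I" and c: "c \<in> {0..<n} - (I - {i})"
  have "A $$ (i, c) = 0" if e: "insert c (I - {i}) = J"
  proof (rule ccontr)
    assume nz: "A $$ (i, c) \<noteq> 0"
    have i_less: "i < n" using ksubsetsD(1)[OF I] i by auto
    have ic: "i \<noteq> c"
    proof
      assume "i = c"
      then have "J = I" using e i by auto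
      then show False using ne by simp
    qed
    have iff: "i \<in> S \<longleftrightarrow> c \<in> S" using A[OF i_less _ nz ic] c by simp
    have fin: "finite (I \<inter> S)" using ksubsetsD(3)[OF I] by simp
    have "card (J \<inter> S) = card (I \<inter> S)"
    proof (cases "i \<in> S")
      case True
      then have "J \<inter> S = insert c ((I \<inter> S) - {i})" using e iff by auto
      moreover have "c \<notin> (I \<inter> S) - {i}" using c by auto
      ultimately have "card (J \<inter> S) = Suc (card ((I \<inter> S) - {i}))" using fin by simp
      also have "\<dots> = card (I \<inter> S)" using card_Suc_Diff1[OF fin, of i] True i by simp
      finally show ?thesis .
    next
      case False
      then have "J \<inter> S = I \<inter> S" using e iff by auto
      then show ?thesis by simp
    qed
    then show False using ne by simp
  qed
  then show "(if insert c (I - {i}) = J then A $$ (i, c) * complex_of_real (exchange_sign (I - {i})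
    i c) else 0) = 0" by simp
qed

lemma mexp_mult_derivative:
  assumes [simp]: "A \<in> carrier_mat n n" "g \<in> carrier_mat n n"
  shows "has_mat_derivative n (\<lambda>s. mexp A s * g) (A * (mexp A t * g)) t"
proof -
  interpret square_matrices n .
  show ?thesis
    using has_mat_derivative_mult_const[OF assms(2) _ _ mexp_derivative[OF assms(1)], of t] by (simp
      add: sq_simps)
qed

section \<open>Gradient curves for a metric proportional to \<open>kappa\<close>\<close>

text \<open>Treats the three metrics together: on tangent vectors they differ only in the constant
  \<open>m\<close>, which rescales time.\<close>

locale positivity_flow = two_eigenvalues n k lam for n k and lam :: "nat \<Rightarrow> real" +
  fixes N :: "complex mat" and G :: "complex mat \<Rightarrow> complex mat \<Rightarrow> complex mat \<Rightarrow> complex" and m :: real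
  assumes N: "N \<in> skew_hermitian n" and m: "0 < m"
    and metric: "\<And>g V W. g \<in> unitary_group n \<Longrightarrow> V \<in> tangent_space n (conj_diag n lam g) \<Longrightarrow>
      W \<in> tangent_space n (conj_diag n lam g) \<Longrightarrow> G (conj_diag n lam g) V W = - complex_of_real m *
        kappa n V W"
begin

definition A :: "complex mat" where
  "A = complex_of_real (1 / (m * gap)) \<cdot>\<^sub>m (\<i> \<cdot>\<^sub>m N)"

lemma N_carrier [simp]: "N \<in> carrier_mat n n" by (rule skew_hermitian_carrier[OF N])

lemma A_carrier [simp]: "A \<in> carrier_mat n n" by (simp add: A_def)

lemma scale_pos: "0 < 1 / (m * gap)" using m gap_pos by simp

lemma A_entry: "i < n \<Longrightarrow> j < n \<Longrightarrow> A $$ (i, j) = complex_of_real (1 / (m * gap)) * (\<i> * N $$ (i, j))"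
  unfolding A_def by (simp add: sq_index carrier_matD[OF N_carrier])

lemma A_hermitian: "mat_adjoint A = A"
proof (rule sq_eqI)
  fix i j assume ij: "i < n" "j < n"
  have "N $$ (j, i) = - cnj (N $$ (i, j))" by (rule skew_hermitian_entry[OF N ij])
  then show "mat_adjoint A $$ (i, j) = A $$ (i, j)"
    using ij A_carrier by (simp add: A_entry carrier_matD[OF A_carrier])
qed simp_all

lemma exchange_nonneg_A: "exchange_nonneg n k A \<longleftrightarrow> exchange_nonneg n k (\<i> \<cdot>\<^sub>m N)"
proof -
  have scale: "0 \<le> complex_of_real s * z \<longleftrightarrow> 0 \<le> z" if "0 < s" for s z
    using that by (simp add: less_eq_complex_def zero_le_mult_iff)
  have "0 \<le> A $$ (i, j) * complex_of_real r \<longleftrightarrow> 0 \<le> (\<i> \<cdot>\<^sub>m N) $$ (i, j) * complex_of_real r" if "i <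
    n" "j < n" for i j r
  proof -
    have "A $$ (i, j) * complex_of_real r = complex_of_real (1 / (m * gap)) * ((\<i> \<cdot>\<^sub>m N) $$ (i, j) *
      complex_of_real r)"
      using that by (simp add: A_entry sq_index)
    then show ?thesis by (simp only: scale[OF scale_pos])
  qed
  then show ?thesis unfolding exchange_nonneg_def by blast
qed

lemma support_graph_A: "support_graph n A = support_graph n N"
proof -
  have "A $$ (i, j) = 0 \<longleftrightarrow> N $$ (i, j) = 0" if "i < n" "j < n" for i j
    using A_entry[OF that] m gap_pos by simp
  then show ?thesis unfolding support_graph_def by blast
qed

lemma gradient_at:
  assumes "g \<in> unitary_group n"
  shows "is_gradient n G (\<lambda>M. kappa n M N) (conj_diag n lam g) V \<longleftrightarrow> V = (\<i> * gap) \<cdot>\<^sub>m flow_field A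
    (subspace_proj n k g)"
proof -
  interpret orbit_point n k lam g by unfold_locales fact
  show ?thesis unfolding A_def by (rule is_gradient_iff[where G = G, OF m _ N]) (rule metric[OF assms])
qed

lemma flow_field_carrier: "P \<in> carrier_mat n n \<Longrightarrow> flow_field A P \<in> carrier_mat n n"
  by (simp add: flow_field_def)

lemma conj_diag_entry: "g \<in> unitary_group n \<Longrightarrow> i < n \<Longrightarrow> j < n \<Longrightarrow>
    conj_diag n lam g $$ (i, j) = \<i> * lam k * (if i = j then 1 else 0) + \<i> * gap * subspace_proj n k
      g $$ (i, j)"
  using subspace_proj_of_conj_diag[of g i j] gap_pos by (simp add: field_simps)

text \<open>Supplies the gradient curves on which the necessity arguments are tested.\<close>

lemma gradient_curve_of_flow:
  assumes h: "\<And>t. h t \<in> unitary_group n"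
    and der: "\<And>t. has_mat_derivative n (\<lambda>s. subspace_proj n k (h s)) (flow_field A (subspace_proj n
      k (h t))) t"
  shows "gradient_curve n lam G N (\<lambda>t. conj_diag n lam (h t))"
  unfolding gradient_curve_def
proof (intro allI conjI exI)
  fix t
  let ?V = "(\<i> * gap) \<cdot>\<^sub>m flow_field A (subspace_proj n k (h t))"
  show "conj_diag n lam (h t) \<in> adjoint_orbit n lam" using h by (simp add: adjoint_orbit_def)
  show "is_gradient n G (\<lambda>M. kappa n M N) (conj_diag n lam (h t)) ?V" using gradient_at[OF h] by simp
  show "has_mat_derivative n (\<lambda>t. conj_diag n lam (h t)) ?V t"
    unfolding has_mat_derivative_def
  proof (intro allI impI)
    fix i j assume ij: "i < n" "j < n"
    have "((\<lambda>s. \<i> * lam k * (if i = j then 1 else 0) + \<i> * gap * subspace_proj n k (h s) $$ (i, j))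
      has_vector_derivative
        (0 + \<i> * gap * flow_field A (subspace_proj n k (h t)) $$ (i, j))) (at t)"
      by (intro has_vector_derivative_add has_vector_derivative_const
        has_vector_derivative_mult_right has_mat_derivativeD[OF der] ij)
    then show "((\<lambda>s. conj_diag n lam (h s) $$ (i, j)) has_vector_derivative ?V $$ (i, j)) (at t)"
      unfolding conj_diag_entry[OF h ij]
      using sq_index(3)[OF flow_field_carrier[OF subspace_proj_facts(1)[OF h]] ij] by simp
  qed
qed

text \<open>Representatives are picked separately at each time. The projections inherit the
  differential equation because they depend affinely on the orbit point.\<close>

lemma flow_of_gradient_curve:
  assumes curve: "gradient_curve n lam G N L"
  shows "\<exists>h. (\<forall>t. h t \<in> unitary_group n \<and> L t = conj_diag n lam (h t)) \<and>
    (\<forall>t. has_mat_derivative n (\<lambda>s. subspace_proj n k (h s)) (flow_field A (subspace_proj n k (h t))) t)"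
proof -
  have "\<forall>t. \<exists>g. g \<in> unitary_group n \<and> L t = conj_diag n lam g"
    using curve by (auto simp: gradient_curve_def adjoint_orbit_def)
  then obtain h where "\<forall>t. h t \<in> unitary_group n \<and> L t = conj_diag n lam (h t)" by (rule choice[THEN
    exE])
  then have h: "\<And>t. h t \<in> unitary_group n" "\<And>t. L t = conj_diag n lam (h t)" by blast+
  have "has_mat_derivative n (\<lambda>s. subspace_proj n k (h s)) (flow_field A (subspace_proj n k (h t)))
    t" for t
    unfolding has_mat_derivative_def
  proof (intro allI impI)
    fix i j assume ij: "i < n" "j < n"
    obtain V where V: "is_gradient n G (\<lambda>M. kappa n M N) (L t) V" "has_mat_derivative n L V t"
      using curve unfolding gradient_curve_def by blast
    have V': "V = (\<i> * gap) \<cdot>\<^sub>m flow_field A (subspace_proj n k (h t))"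
      using V(1) unfolding h(2) gradient_at[OF h(1)] .
    have "((\<lambda>s. (L s $$ (i, j) - \<i> * lam k * (if i = j then 1 else 0)) / (\<i> * gap))
      has_vector_derivative
        (V $$ (i, j) - 0) / (\<i> * gap)) (at t)"
      by (intro has_vector_derivative_divide has_vector_derivative_diff has_vector_derivative_const
        has_mat_derivativeD[OF V(2)] ij)
    moreover have "(V $$ (i, j) - 0) / (\<i> * gap) = flow_field A (subspace_proj n k (h t)) $$ (i, j)"
      unfolding V' using sq_index(3)[OF flow_field_carrier[OF subspace_proj_facts(1)[OF h(1)]] ij]
        gap_pos by simp
    ultimately show "((\<lambda>s. subspace_proj n k (h s) $$ (i, j)) has_vector_derivative flow_field A
      (subspace_proj n k (h t)) $$ (i, j)) (at t)"
      unfolding subspace_proj_of_conj_diag[OF h(1) ij] h(2)[symmetric] by simp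
  qed
  then show ?thesis using h by blast
qed

lemma orbit_pos_subset: "orbit_pos n lam \<subseteq> orbit_nonneg n lam"
proof
  fix M assume M: "M \<in> orbit_pos n lam"
  then have "M \<in> carrier_mat n n"
    by (auto simp: orbit_pos_def unitary_pos_def unitary_group_def conj_diag_def)
  then show "M \<in> orbit_nonneg n lam"
    unfolding orbit_nonneg_def mat_closure_def using M by (auto intro!: exI[of _ "\<lambda>_. M"])
qed

lemma weakly_if:
  assumes cond: "exchange_nonneg n k A"
  shows "weakly_preserves_positivity n lam G N"
  unfolding weakly_preserves_positivity_def
proof (intro allI impI)
  fix L and t :: real
  assume L: "gradient_curve n lam G N L \<and> L 0 \<in> orbit_nonneg n lam" and t: "0 \<le> t"
  interpret E: exchange_system n k A by unfold_locales (use A_hermitian cond in auto)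
  obtain h where "\<forall>t. h t \<in> unitary_group n \<and> L t = conj_diag n lam (h t)"
    and der: "\<forall>t. has_mat_derivative n (\<lambda>s. subspace_proj n k (h s)) (flow_field A (subspace_proj n
      k (h t))) t"
    using flow_of_gradient_curve[OF conjunct1[OF L]] by (elim exE conjE)
  then have h: "\<And>t. h t \<in> unitary_group n" "\<And>t. L t = conj_diag n lam (h t)"
    "\<And>t. has_mat_derivative n (\<lambda>s. subspace_proj n k (h s)) (flow_field A (subspace_proj n k (h t))) t"
    by simp_all
  have "plucker_nonneg n k (h 0)" using plucker_nonneg_of_orbit_nonneg[OF h(1)] L h(2) by simp
  then obtain w where w: "w \<noteq> 0" "\<And>I. I \<in> ksubsets n k \<Longrightarrow> 0 \<le> w * plucker (h 0) I"
    by (auto simp: plucker_nonneg_def ksubsets_def)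
  obtain c where c: "c \<noteq> 0" "\<And>I. I \<subseteq> {0..<n} \<and> card I = k \<Longrightarrow> plucker (mexp A t * h 0) I = c * plucker
    (h t) I"
    using flow_transport_plucker[OF A_carrier k_less(2) h(1,3) t] by blast
  have "0 \<le> (w * c) * plucker (h t) I" if I: "I \<subseteq> {0..<n} \<and> card I = k" for I
  proof -
    have "I \<in> ksubsets n k" using I by (simp add: ksubsets_def)
    from E.flow_nonneg[OF unitary_groupD(1)[OF h(1)] w(2) t this] show ?thesis
      unfolding c(2)[OF I] by (simp only: mult.assoc)
  qed
  then have "plucker_nonneg n k (h t)" unfolding plucker_nonneg_def using w(1) c(1) by (intro exI[of
    _ "w * c"]) simp
  then show "L t \<in> orbit_nonneg n lam" unfolding h(2) by (rule orbit_nonneg_of_plucker_nonneg[OF h(1)])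
qed

lemma strictly_if:
  assumes cond: "exchange_nonneg n k A" and conn: "graph_connected {0..<n} (support_graph n A)"
  shows "strictly_preserves_positivity n lam G N"
  unfolding strictly_preserves_positivity_def
proof (intro allI impI)
  fix L and t :: real
  assume L: "gradient_curve n lam G N L \<and> L 0 \<in> orbit_nonneg n lam" and t: "0 < t"
  interpret E: exchange_system n k A by unfold_locales (use A_hermitian cond in auto)
  obtain h where "\<forall>t. h t \<in> unitary_group n \<and> L t = conj_diag n lam (h t)"
    and der: "\<forall>t. has_mat_derivative n (\<lambda>s. subspace_proj n k (h s)) (flow_field A (subspace_proj n
      k (h t))) t"
    using flow_of_gradient_curve[OF conjunct1[OF L]] by (elim exE conjE)
  then have h: "\<And>t. h t \<in> unitary_group n" "\<And>t. L t = conj_diag n lam (h t)"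
    "\<And>t. has_mat_derivative n (\<lambda>s. subspace_proj n k (h s)) (flow_field A (subspace_proj n k (h t))) t"
    by simp_all
  have "plucker_nonneg n k (h 0)" using plucker_nonneg_of_orbit_nonneg[OF h(1)] L h(2) by simp
  then obtain w where w: "w \<noteq> 0" "\<And>I. I \<in> ksubsets n k \<Longrightarrow> 0 \<le> w * plucker (h 0) I"
    by (auto simp: plucker_nonneg_def ksubsets_def)
  obtain J where J: "J \<in> ksubsets n k" "plucker (h 0) J \<noteq> 0"
    using exists_plucker_nonzero[OF unitary_groupD(1)[OF h(1)] det_unitary[OF h(1)] k_less(2)] by
      (auto simp: ksubsets_def)
  have wJ: "w * plucker (h 0) J \<noteq> 0" using J w(1) by simp
  obtain c where c: "c \<noteq> 0" "\<And>I. I \<subseteq> {0..<n} \<and> card I = k \<Longrightarrow> plucker (mexp A t * h 0) I = c * plucker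
    (h t) I"
    using flow_transport_plucker[OF A_carrier k_less(2) h(1,3) less_imp_le[OF t]] by blast
  have "0 < (w * c) * plucker (h t) I" if I: "I \<subseteq> {0..<n} \<and> card I = k" for I
  proof -
    have "I \<in> ksubsets n k" using I by (simp add: ksubsets_def)
    from E.flow_pos[OF unitary_groupD(1)[OF h(1)] w(2) J(1) wJ conn t this] show ?thesis
      unfolding c(2)[OF I] by (simp only: mult.assoc)
  qed
  then have "plucker_pos n k (h t)" unfolding plucker_pos_def using w(1) c(1) by (intro exI[of _ "w
    * c"]) simp
  then show "L t \<in> orbit_pos n lam" unfolding h(2) by (rule orbit_pos_of_plucker_pos[OF h(1)])
qed

lemma weakly_of_strictly:
  assumes "strictly_preserves_positivity n lam G N"
  shows "weakly_preserves_positivity n lam G N"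
  unfolding weakly_preserves_positivity_def
proof (intro allI impI)
  fix L and t :: real
  assume L: "gradient_curve n lam G N L \<and> L 0 \<in> orbit_nonneg n lam" and t: "0 \<le> t"
  show "L t \<in> orbit_nonneg n lam"
  proof (cases "t = 0")
    case False
    then have "L t \<in> orbit_pos n lam" using assms L t by (simp add: strictly_preserves_positivity_def)
    then show ?thesis using orbit_pos_subset by blast
  qed (use L in simp)
qed

text \<open>The flow started at the coordinate subspace of \<open>J\<close>. It is a gradient curve
  with a nonnegative start, so the preservation hypotheses apply to it.\<close>

lemma coordinate_flow:
  assumes J: "J \<in> ksubsets n k"
  shows "\<exists>h. (\<forall>t. h t \<in> unitary_group n) \<and> gradient_curve n lam G N (\<lambda>t. conj_diag n lam (h t)) \<and>
    conj_diag n lam (h 0) \<in> orbit_nonneg n lam \<and> (\<forall>I \<in> ksubsets n k. plucker (h 0) I = (if I = J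
      then 1 else 0)) \<and>
    (\<forall>t\<ge>0. \<exists>c. c \<noteq> 0 \<and> (\<forall>I \<in> ksubsets n k. plucker (mexp A t * h 0) I = c * plucker (h t) I))"
proof -
  obtain g where g: "g \<in> unitary_group n" "\<And>I. I \<in> ksubsets n k \<Longrightarrow> plucker g I = (if I = J then 1
    else 0)"
    using coordinate_flag[OF J] by blast
  obtain h where h: "h 0 = g" "\<And>t. h t \<in> unitary_group n"
    "\<And>t. has_mat_derivative n (\<lambda>s. subspace_proj n k (h s)) (flow_field A (subspace_proj n k (h t))) t"
    using flow_exists[OF A_carrier A_hermitian g(1), of k] by (elim exE conjE) simp
  have "plucker_nonneg n k g" unfolding plucker_nonneg_def
  proof (intro exI[of _ 1] conjI allI impI)
    fix I assume "I \<subseteq> {0..<n} \<and> card I = k"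
    then have "I \<in> ksubsets n k" by (simp add: ksubsets_def)
    then show "0 \<le> 1 * plucker g I" using g(2) by (simp add: less_eq_complex_def)
  qed simp
  then have nonneg: "conj_diag n lam g \<in> orbit_nonneg n lam" by (rule
    orbit_nonneg_of_plucker_nonneg[OF g(1)])
  have tr: "\<exists>c. c \<noteq> 0 \<and> (\<forall>I \<in> ksubsets n k. plucker (mexp A t * h 0) I = c * plucker (h t) I)" if "0
    \<le> t" for t
    using flow_transport_plucker[OF A_carrier k_less(2) h(2,3) that] by (simp add: ksubsets_def)
  show ?thesis
  proof (intro exI[of _ h] conjI)
    show "gradient_curve n lam G N (\<lambda>t. conj_diag n lam (h t))" by (rule gradient_curve_of_flow[OF
      h(2,3)])
  qed (use h(2) nonneg g(2) tr in \<open>simp_all add: h(1)\<close>)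
qed

text \<open>From the coordinate subspace of \<open>insert j K\<close>, the coordinate of
  \<open>insert i K\<close> starts at 0 with derivative
  \<open>A $$ (i, j) * exchange_sign K i j\<close>. Preserved nonnegativity forbids this derivative
  to be negative or nonreal.\<close>

lemma condition_of_weakly:
  assumes weak: "weakly_preserves_positivity n lam G N"
  shows "exchange_nonneg n k A"
  unfolding exchange_nonneg_def
proof (intro allI impI)
  fix K i j assume a: "K \<subseteq> {0..<n} \<and> card K = k - 1 \<and> i < n \<and> j < n \<and> i \<notin> K \<and> j \<notin> K \<and> i \<noteq> j"
  let ?I = "insert i K" and ?J = "insert j K"
  have fin: "finite K" using a finite_subset by blast
  have I: "?I \<in> ksubsets n k" and J: "?J \<in> ksubsets n k" using a fin k1 by (auto simp: ksubsets_def)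
  have IJ: "?I \<noteq> ?J" using a by auto
  obtain h where h': "\<forall>t. h t \<in> unitary_group n" and h'': "gradient_curve n lam G N (\<lambda>t. conj_diag n
    lam (h t))"
    "conj_diag n lam (h 0) \<in> orbit_nonneg n lam" and init': "\<forall>I \<in> ksubsets n k. plucker (h 0) I =
      (if I = ?J then 1 else 0)"
    and tr': "\<forall>t\<ge>0. \<exists>c. c \<noteq> 0 \<and> (\<forall>I \<in> ksubsets n k. plucker (mexp A t * h 0) I = c * plucker (h t) I)"
    using coordinate_flow[OF J] by (elim exE conjE)
  note h = h'[rule_format] h'' and init = init'[rule_format] and tr = tr'[rule_format]
  define q where "q I t = plucker (mexp A t * h 0) I" for I t
  have q0: "q I 0 = (if I = ?J then 1 else 0)" if "I \<in> ksubsets n k" for I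
    using init[OF that] by (simp add: q_def mexp_zero[OF A_carrier] left_mult_one_mat[OF
      unitary_groupD(1)[OF h(1)]])
  \<comment> \<open>Multiplying by the conjugate of a second coordinate removes the unknown phases
    of the factors \<open>w\<close> and \<open>c\<close>.\<close>
  have nonneg: "0 \<le> q ?I t * cnj (q ?J t)" if t: "0 \<le> t" for t
  proof -
    have "conj_diag n lam (h t) \<in> orbit_nonneg n lam"
      using weak[unfolded weakly_preserves_positivity_def, rule_format, of "\<lambda>t. conj_diag n lam (h
        t)" t]
        h(2,3) t by simp
    from plucker_nonneg_of_orbit_nonneg[OF h(1) this]
    obtain w where w: "w \<noteq> 0" "\<And>I. I \<in> ksubsets n k \<Longrightarrow> 0 \<le> w * plucker (h t) I"
      by (auto simp: plucker_nonneg_def ksubsets_def)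
    obtain c where "\<forall>I \<in> ksubsets n k. plucker (mexp A t * h 0) I = c * plucker (h t) I"
      using tr[OF t] by (elim exE conjE)
    then have c: "q I t = c * plucker (h t) I" if "I \<in> ksubsets n k" for I using that by (simp add:
      q_def)
    have "(q ?I t * cnj (q ?J t)) * complex_of_real ((cmod w)\<^sup>2) =
        complex_of_real ((cmod c)\<^sup>2) * ((w * plucker (h t) ?I) * cnj (w * plucker (h t) ?J))"
      unfolding c[OF I] c[OF J] complex_norm_square by (simp add: mult_ac)
    moreover have "0 \<le> (w * plucker (h t) ?I) * cnj (w * plucker (h t) ?J)"
      using w(2)[OF I] w(2)[OF J] by (simp add: less_eq_complex_def)
    ultimately have "0 \<le> (q ?I t * cnj (q ?J t)) * complex_of_real ((cmod w)\<^sup>2)"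
      by (simp only:) (simp add: less_eq_complex_def del: of_real_power)
    then show ?thesis using w(1) by (simp add: less_eq_complex_def zero_le_mult_iff del: of_real_power)
  qed
  have der: "(q I has_vector_derivative (\<Sum>L\<in>ksubsets n k. exchange_matrix n A I L * q L 0)) (at 0)"
    if "I \<in> ksubsets n k" for I
    unfolding q_def
    by (rule exchange_derivative[OF _ A_carrier mexp_mult_derivative that])
      (use unitary_groupD(1)[OF h(1)] in simp_all)
  have "(\<Sum>L\<in>ksubsets n k. exchange_matrix n A ?I L * q L 0) = exchange_matrix n A ?I ?J * q ?J 0"
    using J q0 by (intro sum_single_support) auto
  also have "\<dots> = A $$ (i, j) * exchange_sign K i j"
    using q0[OF J] exchange_matrix_entry[of K n i j A] a by simp
  finally have dI: "(q ?I has_vector_derivative A $$ (i, j) * exchange_sign K i j) (at 0)" using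
    der[OF I] by simp
  \<comment> \<open>At time 0 the first factor is 0 and the second is 1, so only the derivative of
    \<open>q ?I\<close> survives.\<close>
  have "((\<lambda>t. q ?I t * cnj (q ?J t)) has_vector_derivative
      q ?I 0 * cnj (\<Sum>L\<in>ksubsets n k. exchange_matrix n A ?J L * q L 0) + (A $$ (i, j) *
        exchange_sign K i j) * cnj (q ?J 0)) (at 0)"
    by (intro has_vector_derivative_mult dI has_vector_derivative_cnj der J)
  then have "((\<lambda>t. q ?I t * cnj (q ?J t)) has_vector_derivative A $$ (i, j) * exchange_sign K i j)
    (at 0)"
    using q0[OF I] q0[OF J] IJ by simp
  then show "0 \<le> A $$ (i, j) * complex_of_real (exchange_sign K i j)"
    by (rule deriv_nonneg_of_nonneg) (use nonneg q0[OF I] IJ in auto)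
qed

text \<open>Let \<open>S\<close> be the component of \<open>u\<close>. The coordinates whose number
  of tokens in \<open>S\<close> differs from the initial one form a closed linear system with zero
  initial values and stay 0. The set \<open>insert v K\<close> is among them, against strict
  positivity at time 1.\<close>

lemma connected_of_strictly:
  assumes strict: "strictly_preserves_positivity n lam G N"
  shows "graph_connected {0..<n} (support_graph n A)"
proof (rule ccontr)
  let ?R = "{(a, b). {a, b} \<in> support_graph n A}"
  assume "\<not> graph_connected {0..<n} (support_graph n A)"
  then obtain u v where uv: "u < n" "v < n" "(u, v) \<notin> ?R\<^sup>*" by (auto simp: graph_connected_def)
  define S where "S = {x. (u, x) \<in> ?R\<^sup>*}"
  have S: "u \<in> S" "v \<notin> S" using uv by (auto simp: S_def)
  have edge: "i \<in> S \<longleftrightarrow> c \<in> S" if "i < n" "c < n" "A $$ (i, c) \<noteq> 0" "i \<noteq> c" for i c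
  proof -
    have "{i, c} \<in> support_graph n A" using that unfolding support_graph_def by blast
    then have "(i, c) \<in> ?R" "(c, i) \<in> ?R" by (auto simp: insert_commute)
    then have "(u, i) \<in> ?R\<^sup>* \<Longrightarrow> (u, c) \<in> ?R\<^sup>*" "(u, c) \<in> ?R\<^sup>* \<Longrightarrow> (u, i) \<in> ?R\<^sup>*"
      by (simp_all only: rtrancl_into_rtrancl)
    then show ?thesis unfolding S_def mem_Collect_eq by (rule iffI)
  qed
  have "u \<noteq> v" using S by auto
  then have "k - 1 \<le> card ({0..<n} - {u, v})" using uv kn by (simp add: card_Diff_subset)
  then obtain K where K: "K \<subseteq> {0..<n} - {u, v}" "card K = k - 1" "finite K"
    using exists_subset_card[OF finite_Diff[OF finite_atLeastLessThan]] by metis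
  let ?J = "insert u K" and ?I = "insert v K"
  have "u \<notin> K" "v \<notin> K" "K \<subseteq> {0..<n}" using K by auto
  then have I: "?I \<in> ksubsets n k" and J: "?J \<in> ksubsets n k" using K(2,3) uv k1 by (simp_all add:
    ksubsets_def)
  define F where "F = {I \<in> ksubsets n k. card (I \<inter> S) \<noteq> card (?J \<inter> S)}"
  have "?J \<inter> S = insert u (K \<inter> S)" "?I \<inter> S = K \<inter> S" "u \<notin> K \<inter> S" using S K by auto
  then have "?I \<in> F" using I K(3) by (simp add: F_def)
  obtain h where h': "\<forall>t. h t \<in> unitary_group n" and h'': "gradient_curve n lam G N (\<lambda>t. conj_diag n
    lam (h t))"
    "conj_diag n lam (h 0) \<in> orbit_nonneg n lam" and init': "\<forall>I \<in> ksubsets n k. plucker (h 0) I =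
      (if I = ?J then 1 else 0)"
    and tr': "\<forall>t\<ge>0. \<exists>c. c \<noteq> 0 \<and> (\<forall>I \<in> ksubsets n k. plucker (mexp A t * h 0) I = c * plucker (h t) I)"
    using coordinate_flow[OF J] by (elim exE conjE)
  note h = h'[rule_format] h'' and init = init'[rule_format] and tr = tr'[rule_format]
  define q where "q I t = plucker (mexp A t * h 0) I" for I t
  have "q ?I 1 = 0"
  proof (rule linear_system_zero[where y = q and S = F and M = "\<lambda>s. exchange_matrix n A" and
        C = "\<Sum>I\<in>ksubsets n k. \<Sum>J\<in>ksubsets n k. cmod (exchange_matrix n A I J)"])
    fix I' s assume I': "I' \<in> F"
    then have I'': "I' \<in> ksubsets n k" by (simp add: F_def)
    have "(\<Sum>L\<in>F. exchange_matrix n A I' L * q L s) = (\<Sum>L\<in>ksubsets n k. exchange_matrix n A I' L * q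
      L s)"
    proof (rule sum.mono_neutral_left)
      show "\<forall>L\<in>ksubsets n k - F. exchange_matrix n A I' L * q L s = 0"
      proof
        fix L assume "L \<in> ksubsets n k - F"
        then have ne: "card (I' \<inter> S) \<noteq> card (L \<inter> S)" using I' by (simp add: F_def)
        have "exchange_matrix n A I' L = 0"
          by (rule exchange_matrix_conserves[OF _ I'' ne]) (rule edge)
        then show "exchange_matrix n A I' L * q L s = 0" by simp
      qed
    qed (auto simp: F_def)
    moreover have "(q I' has_vector_derivative (\<Sum>L\<in>ksubsets n k. exchange_matrix n A I' L * q L s))
      (at s)"
      unfolding q_def
      by (rule exchange_derivative[OF _ A_carrier mexp_mult_derivative I''])
        (use unitary_groupD(1)[OF h(1)] in simp_all)
    ultimately show "(q I' has_vector_derivative (\<Sum>L\<in>F. exchange_matrix n A I' L * q L s)) (at s)"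
      by simp
  next
    fix I' assume "I' \<in> F"
    then have "I' \<in> ksubsets n k" "I' \<noteq> ?J" by (auto simp: F_def)
    then show "q I' 0 = 0"
      using init by (simp add: q_def mexp_zero[OF A_carrier] left_mult_one_mat[OF
        unitary_groupD(1)[OF h(1)]])
  next
    show "cmod (exchange_matrix n A I' J') \<le> (\<Sum>I\<in>ksubsets n k. \<Sum>J\<in>ksubsets n k. cmod
      (exchange_matrix n A I J))"
      if "I' \<in> F" "J' \<in> F" for I' J' by (rule exchange_matrix_bound) (use that in \<open>auto simp: F_def\<close>)
  qed (use \<open>?I \<in> F\<close> in \<open>auto simp: F_def\<close>)
  moreover have "q ?I 1 \<noteq> 0"
  proof -
    have "conj_diag n lam (h 1) \<in> orbit_pos n lam"
      using strict[unfolded strictly_preserves_positivity_def, rule_format, of "\<lambda>t. conj_diag n lam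
        (h t)" 1]
        h(2,3) by simp
    from plucker_pos_of_orbit_pos[OF h(1) this]
    obtain w where "\<forall>I. I \<subseteq> {0..<n} \<and> card I = k \<longrightarrow> 0 < w * plucker (h 1) I"
      unfolding plucker_pos_def by blast
    then have "0 < w * plucker (h 1) ?I" using I by (simp add: ksubsets_def)
    then have "plucker (h 1) ?I \<noteq> 0" by auto
    moreover obtain c where "c \<noteq> 0" "\<forall>I \<in> ksubsets n k. plucker (mexp A 1 * h 0) I = c * plucker (h
      1) I"
      using tr[OF zero_le_one] by (elim exE conjE)
    ultimately show ?thesis using I by (simp add: q_def)
  qed
  ultimately show False by simp
qed

lemma weakly_iff: "weakly_preserves_positivity n lam G N \<longleftrightarrow> exchange_nonneg n k (\<i> \<cdot>\<^sub>m N)"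
  unfolding exchange_nonneg_A[symmetric] by (rule iffI[OF condition_of_weakly weakly_if])

lemma strictly_iff: "strictly_preserves_positivity n lam G N \<longleftrightarrow>
    exchange_nonneg n k (\<i> \<cdot>\<^sub>m N) \<and> graph_connected {0..<n} (support_graph n N)"
  unfolding exchange_nonneg_A[symmetric] support_graph_A[symmetric]
  by (intro iffI conjI; (elim conjE)?)
    (rule condition_of_weakly[OF weakly_of_strictly] connected_of_strictly strictly_if; assumption)+

end

lemma (in two_eigenvalues) metric_proportional:
  assumes "metric \<in> {kaehler_metric, normal_metric, induced_metric}"
  shows "\<exists>m>0. \<forall>g V W. g \<in> unitary_group n \<longrightarrow> V \<in> tangent_space n (conj_diag n lam g) \<longrightarrow>
    W \<in> tangent_space n (conj_diag n lam g) \<longrightarrow> metric n (conj_diag n lam g) V W = - complex_of_real m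
      * kappa n V W"
proof -
  consider "metric = kaehler_metric" | "metric = normal_metric" | "metric = induced_metric" using
    assms by blast
  then show ?thesis
  proof cases
    case 1
    show ?thesis
    proof (intro exI[of _ "1 / gap"] conjI allI impI)
      fix g V W assume g: "g \<in> unitary_group n" and V: "V \<in> tangent_space n (conj_diag n lam g)"
        and W: "W \<in> tangent_space n (conj_diag n lam g)"
      interpret orbit_point n k lam g by unfold_locales fact
      show "metric n (conj_diag n lam g) V W = - complex_of_real (1 / gap) * kappa n V W"
        unfolding 1 by (rule kaehler_metric_eq[OF V W])
    qed (use gap_pos in simp)
  next
    case 2
    show ?thesis
    proof (intro exI[of _ "1 / gap\<^sup>2"] conjI allI impI)
      fix g V W assume g: "g \<in> unitary_group n" and V: "V \<in> tangent_space n (conj_diag n lam g)"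
        and W: "W \<in> tangent_space n (conj_diag n lam g)"
      interpret orbit_point n k lam g by unfold_locales fact
      show "metric n (conj_diag n lam g) V W = - complex_of_real (1 / gap\<^sup>2) * kappa n V W"
        unfolding 2 by (rule normal_metric_eq[OF V W])
    qed (use gap_pos in simp)
  next
    case 3
    show ?thesis unfolding 3 by (intro exI[of _ 1]) (simp add: induced_metric_def)
  qed
qed

theorem corollary5p15:
  fixes n k :: nat and lam :: "nat \<Rightarrow> real" and N :: "complex mat"
    and metric :: "nat \<Rightarrow> complex mat \<Rightarrow> complex mat \<Rightarrow> complex mat \<Rightarrow> complex"
  assumes "1 \<le> k" and "k \<le> n - 1"
    and "\<forall>i<k. lam i = lam 0"
    and "lam (k - 1) > lam k"
    and "\<forall>i. k \<le> i \<and> i < n \<longrightarrow> lam i = lam k"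
    and "N \<in> skew_hermitian n"
    and "metric \<in> {kaehler_metric, normal_metric, induced_metric}"
  shows "(weakly_preserves_positivity n lam (metric n) N \<longleftrightarrow> positivity_condition n k N) \<and>
    (strictly_preserves_positivity n lam (metric n) N \<longleftrightarrow>
       positivity_condition n k N \<and> graph_connected {0..<n} (support_graph n N)) \<and>
    (2 \<le> k \<and> k \<le> n - 2 \<and> positivity_condition n k N \<longrightarrow>
       (graph_connected {0..<n} (support_graph n N) \<longleftrightarrow>
        n - 1 \<le> card {i. i < n \<and> 0 < cyclic_entry n k N i}))"
proof -
  interpret two_eigenvalues n k lam by unfold_locales fact+
  from metric_proportional[OF assms(7)]
  obtain m where m: "0 < m" and metric: "\<forall>g V W. g \<in> unitary_group n \<longrightarrow> V \<in> tangent_space n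
    (conj_diag n lam g) \<longrightarrow>
    W \<in> tangent_space n (conj_diag n lam g) \<longrightarrow> metric n (conj_diag n lam g) V W = - complex_of_real m
      * kappa n V W"
    by (elim exE conjE)
  interpret F: positivity_flow n k lam N "metric n" m
    by unfold_locales (fact assms(6), fact m, rule metric[rule_format])
  interpret H: hermitian_generator n k N
  proof
    show "\<i> * N $$ (j, i) = cnj (\<i> * N $$ (i, j))" if "i < n" "j < n" for i j
      using skew_hermitian_entry[OF assms(6) that] by simp
  qed (use assms(1,2) skew_hermitian_carrier[OF assms(6)] in simp_all)
  show ?thesis
    unfolding F.weakly_iff F.strictly_iff H.positivity_condition_iff[symmetric]
    using H.cycle_connected by simp
qed

end
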